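(* Assume $\mathrm{char}(k)=2$. Let $(P,Q)\in X_2(\mathcal{O}_K)$ be a non-singular generalised binary quartic with $v(P,Q)\in\{0,1\}$ and positive level. Then: (i) the reduction mod $\pi$ of $Q_1(x,z)=P(x,z)$ if $v(P)=0$; $Q_1=\partial^2Q/\partial x\partial z$ if $v(P)\geq1$ and $v(P,Q)=0$; $Q_1=\pi^{-1}Q(x,z)$ if $v(P)\geq1$ and $v(Q)=1$, has a unique repeated root, and it is defined over $k$; (ii) the following procedure replaces $(P,Q)$ by a $K$-equivalent integral model of the same level: if $v(P,Q)=1$, make a $y$-substitution so that $v(Q)\geq1$; move the repeated root of $Q_1$ mod $\pi$ to $(x:z)=(0:1)$ by a substitution with matrix in $GL_2(\mathcal{O}_K)$; make a $y$-substitution so that $\pi\mid e$; then replace $P(x,z)$ by $\pi^{-1}P(\pi x,z)$ and $Q(x,z)$ by $\pi^{-2}Q(\pi x,z)$; (iii) if $(P,Q)$ is non-minimal, then at most $2$ iterations of the procedure in (ii) produce a model with $v(P,Q)\geq2$.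
   Context: $K$ is a field with normalised discrete valuation $v$, valuation ring $\mathcal{O}_K$, uniformiser $\pi$, perfect residue field $k$. $X_2(R)$: pairs $(P,Q)$ of binary forms in $x,z$ over $R$, $P=lx^2+mxz+nz^2$, $Q=ax^4+bx^3z+cx^2z^2+dxz^3+ez^4$, representing $y^2+P(x,z)y=Q(x,z)$. $R$-equivalence: substitutions $x\leftarrow m_{11}x+m_{21}z$, $z\leftarrow m_{12}x+m_{22}z$, $y\leftarrow\mu^{-1}y+r_0x^2+r_1xz+r_2z^2$ (then rescale to make the $y^2$-coefficient $1$), with $\mu\in R^\times$, $r_i\in R$, $(m_{ij})\in GL_2(R)$. A $y$-substitution is one with $M=I_2$, $\mu=1$: $y\leftarrow y+r_0x^2+r_1xz+r_2z^2$ ($r_i\in\mathcal{O}_K$); models related by one are $y$-equivalent. For a form $G$, $v(G)$ is the minimum valuation of its coefficients; $v(P,Q)=\max\{\min(2v(P'),v(Q')):(P',Q')\ y\text{-equivalent to }(P,Q)\}$. Invariants: for $G=\tfrac14P^2+Q=\alpha x^4+\beta x^3z+\gamma x^2z^2+\delta xz^3+\epsilon z^4$, $I=12\alpha\epsilon-3\beta\delta+\gamma^2$, $J=72\alpha\gamma\epsilon-27\alpha\delta^2-27\beta^2\epsilon+9\beta\gamma\delta-2\gamma^3$, $c_4=2^4I$, $c_6=2^5J$, $\Delta(P,Q)=(c_4^3-c_6^2)/1728$ (an integer polynomial in $l,m,n,a,\dots,e$). Non-singular: $\Delta\ne0$; then $y^2+Py=Q$ is a smooth genus one curve with Jacobian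 $E$ of minimal discriminant $\Delta_E$, and $v(\Delta(P,Q))=v(\Delta_E)+12\ell$, $\ell\in\mathbb{Z}$ the level. Integral: coefficients in $\mathcal{O}_K$. An integral model is minimal if $v(\Delta)$ is minimal among integral models $K$-equivalent to it, non-minimal otherwise. *)

theory Defs
  imports "HOL-Computational_Algebra.Polynomial"
begin

text \<open>A normalised discrete valuation on a field K is modelled by a function
  v :: K \<Rightarrow> int whose values at nonzero elements are meaningful; the value
  at 0 is to be read as +infinity, which is why all inequalities go through vge.\<close>

definition discrete_valuation :: "('a::field \<Rightarrow> int) \<Rightarrow> bool" where
  "discrete_valuation v \<longleftrightarrow>
     (\<forall>x y. x \<noteq> 0 \<longrightarrow> y \<noteq> 0 \<longrightarrow> v (x * y) = v x + v y) \<and>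
     (\<forall>x y. x \<noteq> 0 \<longrightarrow> y \<noteq> 0 \<longrightarrow> x + y \<noteq> 0 \<longrightarrow> min (v x) (v y) \<le> v (x + y)) \<and>
     (\<exists>x. x \<noteq> 0 \<and> v x = 1)"

definition vge :: "('a::field \<Rightarrow> int) \<Rightarrow> 'a \<Rightarrow> int \<Rightarrow> bool" where
  "vge v x k \<longleftrightarrow> x = 0 \<or> k \<le> v x"

definition intg :: "('a::field \<Rightarrow> int) \<Rightarrow> 'a \<Rightarrow> bool" where
  "intg v x \<longleftrightarrow> vge v x 0"

definition residue_char :: "('a::field \<Rightarrow> int) \<Rightarrow> nat \<Rightarrow> bool" where
  "residue_char v p \<longleftrightarrow> 0 < p \<and> vge v (of_nat p) 1 \<and>
     (\<forall>q. 0 < q \<and> q < p \<longrightarrow> \<not> vge v (of_nat q) 1)"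

definition residue_perfect :: "('a::field \<Rightarrow> int) \<Rightarrow> bool" where
  "residue_perfect v \<longleftrightarrow>
     (\<forall>p. prime p \<and> vge v (of_nat p) 1 \<longrightarrow>
        (\<forall>x. intg v x \<longrightarrow> (\<exists>y. intg v y \<and> vge v (x - y ^ p) 1)))"

text \<open>red : O_K \<rightarrow> L is a ring homomorphism with kernel exactly the maximal ideal, i.e. it
  identifies the residue field k with a subfield of L.  L is taken algebraically closed,
  so that it contains an algebraic closure of k.\<close>
definition residue_map :: "('a::field \<Rightarrow> int) \<Rightarrow> ('a \<Rightarrow> 'b::field) \<Rightarrow> bool" where
  "residue_map v red \<longleftrightarrow>
     (\<forall>x y. intg v x \<longrightarrow> intg v y \<longrightarrow> red (x + y) = red x + red y \<and> red (x * y) = red x * red y) \<and>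
     red 1 = 1 \<and>
     (\<forall>x. intg v x \<longrightarrow> (red x = 0 \<longleftrightarrow> vge v x 1))"

definition form_eval :: "'a::comm_ring_1 list \<Rightarrow> 'a \<Rightarrow> 'a \<Rightarrow> 'a" where
  "form_eval cs x z = (\<Sum>i<length cs. cs ! i * x ^ (length cs - 1 - i) * z ^ i)"

definition vform_ge :: "('a::field \<Rightarrow> int) \<Rightarrow> 'a list \<Rightarrow> int \<Rightarrow> bool" where
  "vform_ge v cs k \<longleftrightarrow> (\<forall>c\<in>set cs. vge v c k)"

definition rep_root :: "'b::field list \<Rightarrow> 'b \<Rightarrow> 'b \<Rightarrow> bool" where
  "rep_root f X Z \<longleftrightarrow> (X, Z) \<noteq> (0, 0) \<and>
     (\<exists>g. length g + 2 = length f \<and>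
          (\<forall>x z. form_eval f x z = (Z * x - X * z)^2 * form_eval g x z))"

definition unique_rep_root_over_k ::
    "('a::field \<Rightarrow> int) \<Rightarrow> ('a \<Rightarrow> 'b::field) \<Rightarrow> 'a list \<Rightarrow> bool" where
  "unique_rep_root_over_k v red f \<longleftrightarrow>
     (\<exists>x0 z0. intg v x0 \<and> intg v z0 \<and> rep_root (map red f) (red x0) (red z0) \<and>
        (\<forall>X Z. rep_root (map red f) X Z \<longrightarrow> (\<exists>t. X = t * red x0 \<and> Z = t * red z0)))"

text \<open>GBQ l m n a b c d e represents y^2 + P(x,z) y = Q(x,z) with
  P = l x^2 + m x z + n z^2 and Q = a x^4 + b x^3 z + c x^2 z^2 + d x z^3 + e z^4.\<close>
datatype 'a gbq = GBQ (cl: 'a) (cm: 'a) (cn: 'a) (ca: 'a) (cb: 'a) (cc: 'a) (cd: 'a) (ce: 'a)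

definition Pcoeffs :: "'a gbq \<Rightarrow> 'a list" where
  "Pcoeffs F = [cl F, cm F, cn F]"

definition Qcoeffs :: "'a gbq \<Rightarrow> 'a list" where
  "Qcoeffs F = [ca F, cb F, cc F, cd F, ce F]"

definition Pev :: "'a::comm_ring_1 gbq \<Rightarrow> 'a \<Rightarrow> 'a \<Rightarrow> 'a" where
  "Pev F x z = cl F * x^2 + cm F * x * z + cn F * z^2"

definition Qev :: "'a::comm_ring_1 gbq \<Rightarrow> 'a \<Rightarrow> 'a \<Rightarrow> 'a" where
  "Qev F x z = ca F * x^4 + cb F * x^3 * z + cc F * x^2 * z^2 + cd F * x * z^3 + ce F * z^4"

definition gbq_integral :: "('a::field \<Rightarrow> int) \<Rightarrow> 'a gbq \<Rightarrow> bool" where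
  "gbq_integral v F \<longleftrightarrow> vform_ge v (Pcoeffs F) 0 \<and> vform_ge v (Qcoeffs F) 0"

text \<open>F' is obtained from F by the substitution x \<leftarrow> m11 x + m21 z, z \<leftarrow> m12 x + m22 z,
  y \<leftarrow> mu^-1 y + r0 x^2 + r1 x z + r2 z^2, followed by rescaling so that the y^2-coefficient is 1:
  y^2 + P y = Q becomes y^2 + mu (P + 2R) y = mu^2 (Q - R^2 - P R)
  (P, Q evaluated at the substituted x, z).  Equality of forms is expressed as equality of
  the associated functions K^2 \<rightarrow> K (K is infinite, so this is equality of coefficients).\<close>
definition gen_sub :: "'a::field gbq \<Rightarrow> 'a gbq \<Rightarrow> 'a \<Rightarrow> 'a \<Rightarrow> 'a \<Rightarrow> 'a \<Rightarrow> 'a \<Rightarrow> 'a \<Rightarrow> 'a \<Rightarrow> 'a \<Rightarrow> bool" where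
  "gen_sub F F' m11 m12 m21 m22 \<mu> r0 r1 r2 \<longleftrightarrow>
     (\<forall>x z. let X = m11 * x + m21 * z; Z = m12 * x + m22 * z;
                R = r0 * x^2 + r1 * x * z + r2 * z^2 in
       Pev F' x z = \<mu> * (Pev F X Z + 2 * R) \<and>
       Qev F' x z = \<mu>^2 * (Qev F X Z - R^2 - Pev F X Z * R))"

definition K_equiv :: "'a::field gbq \<Rightarrow> 'a gbq \<Rightarrow> bool" where
  "K_equiv F F' \<longleftrightarrow> (\<exists>m11 m12 m21 m22 \<mu> r0 r1 r2.
     \<mu> \<noteq> 0 \<and> m11 * m22 - m12 * m21 \<noteq> 0 \<and> gen_sub F F' m11 m12 m21 m22 \<mu> r0 r1 r2)"

definition y_sub :: "('a::field \<Rightarrow> int) \<Rightarrow> 'a gbq \<Rightarrow> 'a gbq \<Rightarrow> bool" where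
  "y_sub v F F' \<longleftrightarrow> (\<exists>r0 r1 r2. intg v r0 \<and> intg v r1 \<and> intg v r2 \<and>
     gen_sub F F' 1 0 0 1 1 r0 r1 r2)"

text \<open>v(P,Q) \<ge> k, where v(P,Q) = max over y-equivalent (P',Q') of min(2 v(P'), v(Q'))\<close>
definition vPQ_ge :: "('a::field \<Rightarrow> int) \<Rightarrow> 'a gbq \<Rightarrow> int \<Rightarrow> bool" where
  "vPQ_ge v F k \<longleftrightarrow> (\<exists>F'. y_sub v F F' \<and>
     (\<forall>c\<in>set (Pcoeffs F'). c = 0 \<or> k \<le> 2 * v c) \<and> vform_ge v (Qcoeffs F') k)"

text \<open>The discriminant Delta(P,Q) = (c4^3 - c6^2)/1728, written out as the integer polynomial
  in l,m,n,a,b,c,d,e (c4 = 2^4 I, c6 = 2^5 J, I, J the invariants of G = P^2/4 + Q).\<close>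
definition gbq_disc :: "'a::comm_ring_1 gbq \<Rightarrow> 'a" where
  "gbq_disc F = (case F of GBQ l m n a b c d e \<Rightarrow>
     16 * l^6 * n^2 * e^2
     + 64 * l^6 * e^3
     - 8 * l^5 * m^2 * n * e^2
     - 16 * l^5 * m * n^2 * d * e
     - 96 * l^5 * m * d * e^2
     - 32 * l^5 * n^3 * c * e
     + 16 * l^5 * n^3 * d^2
     - 128 * l^5 * n * c * e^2
     + 72 * l^5 * n * d^2 * e
     + l^4 * m^4 * e^2
     + 8 * l^4 * m^3 * n * d * e
     + 32 * l^4 * m^2 * n^2 * c * e
     - 8 * l^4 * m^2 * n^2 * d^2
     + 80 * l^4 * m^2 * c * e^2
     + 30 * l^4 * m^2 * d^2 * e
     + 48 * l^4 * m * n^3 * b * e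
     - 16 * l^4 * m * n^3 * c * d
     + 192 * l^4 * m * n * b * e^2
     - 16 * l^4 * m * n * c * d * e
     - 36 * l^4 * m * n * d^3
     + 32 * l^4 * n^4 * a * e
     - 32 * l^4 * n^4 * b * d
     + 16 * l^4 * n^4 * c^2
     + 320 * l^4 * n^2 * a * e^2
     - 176 * l^4 * n^2 * b * d * e
     + 32 * l^4 * n^2 * c^2 * e
     + 24 * l^4 * n^2 * c * d^2
     + 768 * l^4 * a * e^3
     - 192 * l^4 * b * d * e^2
     - 128 * l^4 * c^2 * e^2
     + 144 * l^4 * c * d^2 * e
     - 27 * l^4 * d^4
     - l^3 * m^5 * d * e
     - 10 * l^3 * m^4 * n * c * e
     + l^3 * m^4 * n * d^2
     - 40 * l^3 * m^3 * n^2 * b * e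
     + 8 * l^3 * m^3 * n^2 * c * d
     - 72 * l^3 * m^3 * b * e^2
     - 44 * l^3 * m^3 * c * d * e
     + l^3 * m^3 * d^3
     - 80 * l^3 * m^2 * n^3 * a * e
     + 32 * l^3 * m^2 * n^3 * b * d
     - 8 * l^3 * m^2 * n^3 * c^2
     - 352 * l^3 * m^2 * n * a * e^2
     + 4 * l^3 * m^2 * n * b * d * e
     - 8 * l^3 * m^2 * n * c^2 * e
     + 46 * l^3 * m^2 * n * c * d^2
     + 48 * l^3 * m * n^4 * a * d
     - 16 * l^3 * m * n^4 * b * c
     + 32 * l^3 * m * n^2 * a * d * e
     + 80 * l^3 * m * n^2 * b * c * e
     + 52 * l^3 * m * n^2 * b * d^2
     - 64 * l^3 * m * n^2 * c^2 * d
     - 768 * l^3 * m * a * d * e^2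
     + 576 * l^3 * m * b * c * e^2
     - 24 * l^3 * m * b * d^2 * e
     - 160 * l^3 * m * c^2 * d * e
     + 36 * l^3 * m * c * d^3
     - 32 * l^3 * n^5 * a * c
     + 16 * l^3 * n^5 * b^2
     - 384 * l^3 * n^3 * a * c * e
     + 136 * l^3 * n^3 * a * d^2
     + 136 * l^3 * n^3 * b^2 * e
     - 80 * l^3 * n^3 * b * c * d
     + 32 * l^3 * n^3 * c^3
     - 1024 * l^3 * n * a * c * e^2
     + 576 * l^3 * n * a * d^2 * e
     + 288 * l^3 * n * b^2 * e^2
     - 320 * l^3 * n * b * c * d * e
     + 36 * l^3 * n * b * d^3
     + 128 * l^3 * n * c^3 * e
     - 24 * l^3 * n * c^2 * d^2
     + l^2 * m^6 * c * e
     + 11 * l^2 * m^5 * n * b * e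
     - l^2 * m^5 * n * c * d
     + 50 * l^2 * m^4 * n^2 * a * e
     - 10 * l^2 * m^4 * n^2 * b * d
     + l^2 * m^4 * n^2 * c^2
     + 80 * l^2 * m^4 * a * e^2
     + 34 * l^2 * m^4 * b * d * e
     + 12 * l^2 * m^4 * c^2 * e
     - l^2 * m^4 * c * d^2
     - 40 * l^2 * m^3 * n^3 * a * d
     + 8 * l^2 * m^3 * n^3 * b * c
     + 104 * l^2 * m^3 * n * a * d * e
     - 20 * l^2 * m^3 * n * b * c * e
     - 41 * l^2 * m^3 * n * b * d^2
     - 8 * l^2 * m^3 * n * c^2 * d
     + 32 * l^2 * m^2 * n^4 * a * c
     - 8 * l^2 * m^2 * n^4 * b^2
     + 192 * l^2 * m^2 * n^2 * a * c * e
     - 162 * l^2 * m^2 * n^2 * a * d^2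
     - 162 * l^2 * m^2 * n^2 * b^2 * e
     + 84 * l^2 * m^2 * n^2 * b * c * d
     + 8 * l^2 * m^2 * n^2 * c^3
     + 64 * l^2 * m^2 * a * c * e^2
     + 264 * l^2 * m^2 * a * d^2 * e
     - 504 * l^2 * m^2 * b^2 * e^2
     + 56 * l^2 * m^2 * b * c * d * e
     - 30 * l^2 * m^2 * b * d^3
     + 48 * l^2 * m^2 * c^3 * e
     - 8 * l^2 * m^2 * c^2 * d^2
     - 16 * l^2 * m * n^5 * a * b
     + 32 * l^2 * m * n^3 * a * b * e
     + 80 * l^2 * m * n^3 * a * c * d
     + 52 * l^2 * m * n^3 * b^2 * d
     - 64 * l^2 * m * n^3 * b * c^2
     + 384 * l^2 * m * n * a * b * e^2
     + 512 * l^2 * m * n * a * c * d * e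
     - 360 * l^2 * m * n * a * d^3
     + 192 * l^2 * m * n * b^2 * d * e
     - 256 * l^2 * m * n * b * c^2 * e
     + 124 * l^2 * m * n * b * c * d^2
     - 16 * l^2 * m * n * c^3 * d
     + 16 * l^2 * n^6 * a^2
     + 320 * l^2 * n^4 * a^2 * e
     - 176 * l^2 * n^4 * a * b * d
     + 32 * l^2 * n^4 * a * c^2
     + 24 * l^2 * n^4 * b^2 * c
     + 1792 * l^2 * n^2 * a^2 * e^2
     - 1088 * l^2 * n^2 * a * b * d * e
     - 128 * l^2 * n^2 * a * c^2 * e
     + 240 * l^2 * n^2 * a * c * d^2
     + 240 * l^2 * n^2 * b^2 * c * e
     - 2 * l^2 * n^2 * b^2 * d^2
     - 80 * l^2 * n^2 * b * c^2 * d
     + 16 * l^2 * n^2 * c^4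
     + 3072 * l^2 * a^2 * e^3
     - 1536 * l^2 * a * b * d * e^2
     - 1024 * l^2 * a * c^2 * e^2
     + 1152 * l^2 * a * c * d^2 * e
     - 216 * l^2 * a * d^4
     + 576 * l^2 * b^2 * c * e^2
     - 24 * l^2 * b^2 * d^2 * e
     - 320 * l^2 * b * c^2 * d * e
     + 72 * l^2 * b * c * d^3
     + 64 * l^2 * c^4 * e
     - 16 * l^2 * c^3 * d^2
     - l * m^7 * b * e
     - 12 * l * m^6 * n * a * e
     + l * m^6 * n * b * d
     + 11 * l * m^5 * n^2 * a * d
     - l * m^5 * n^2 * b * c
     - 40 * l * m^5 * a * d * e
     - 12 * l * m^5 * b * c * e
     + l * m^5 * b * d^2
     - 10 * l * m^4 * n^3 * a * c
     + l * m^4 * n^3 * b^2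
     - 64 * l * m^4 * n * a * c * e
     + 48 * l * m^4 * n * a * d^2
     + 48 * l * m^4 * n * b^2 * e
     + 8 * l * m^4 * n * b * c * d
     + 8 * l * m^3 * n^4 * a * b
     + 104 * l * m^3 * n^2 * a * b * e
     - 20 * l * m^3 * n^2 * a * c * d
     - 41 * l * m^3 * n^2 * b^2 * d
     - 8 * l * m^3 * n^2 * b * c^2
     + 576 * l * m^3 * a * b * e^2
     - 320 * l * m^3 * a * c * d * e
     + 36 * l * m^3 * a * d^3
     + 108 * l * m^3 * b^2 * d * e
     - 48 * l * m^3 * b * c^2 * e
     + 8 * l * m^3 * b * c * d^2
     - 8 * l * m^2 * n^5 * a^2
     - 352 * l * m^2 * n^3 * a^2 * e
     + 4 * l * m^2 * n^3 * a * b * d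
     - 8 * l * m^2 * n^3 * a * c^2
     + 46 * l * m^2 * n^3 * b^2 * c
     - 1280 * l * m^2 * n * a^2 * e^2
     - 416 * l * m^2 * n * a * b * d * e
     + 64 * l * m^2 * n * a * c^2 * e
     + 168 * l * m^2 * n * a * c * d^2
     + 168 * l * m^2 * n * b^2 * c * e
     - 140 * l * m^2 * n * b^2 * d^2
     + 16 * l * m^2 * n * b * c^2 * d
     + 192 * l * m * n^4 * a^2 * d
     - 16 * l * m * n^4 * a * b * c
     - 36 * l * m * n^4 * b^3
     + 384 * l * m * n^2 * a^2 * d * e
     + 512 * l * m * n^2 * a * b * c * e
     + 192 * l * m * n^2 * a * b * d^2
     - 256 * l * m * n^2 * a * c^2 * d
     - 360 * l * m * n^2 * b^3 * e
     + 124 * l * m * n^2 * b^2 * c * d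
     - 16 * l * m * n^2 * b * c^3
     - 1536 * l * m * a^2 * d * e^2
     + 2304 * l * m * a * b * c * e^2
     - 96 * l * m * a * b * d^2 * e
     - 640 * l * m * a * c^2 * d * e
     + 144 * l * m * a * c * d^3
     - 864 * l * m * b^3 * e^2
     + 432 * l * m * b^2 * c * d * e
     - 96 * l * m * b^2 * d^3
     - 64 * l * m * b * c^3 * e
     + 16 * l * m * b * c^2 * d^2
     - 128 * l * n^5 * a^2 * c
     + 72 * l * n^5 * a * b^2
     - 1024 * l * n^3 * a^2 * c * e
     + 288 * l * n^3 * a^2 * d^2
     + 576 * l * n^3 * a * b^2 * e
     - 320 * l * n^3 * a * b * c * d
     + 128 * l * n^3 * a * c^3
     + 36 * l * n^3 * b^3 * d
     - 24 * l * n^3 * b^2 * c^2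
     - 2048 * l * n * a^2 * c * e^2
     + 1152 * l * n * a^2 * d^2 * e
     + 1152 * l * n * a * b^2 * e^2
     - 1280 * l * n * a * b * c * d * e
     + 144 * l * n * a * b * d^3
     + 512 * l * n * a * c^3 * e
     - 96 * l * n * a * c^2 * d^2
     + 144 * l * n * b^3 * d * e
     - 96 * l * n * b^2 * c^2 * e
     + 16 * l * n * b^2 * c * d^2
     + m^8 * a * e
     - m^7 * n * a * d
     + m^6 * n^2 * a * c
     + 16 * m^6 * a * c * e
     - m^6 * a * d^2
     - m^6 * b^2 * e
     - m^5 * n^3 * a * b
     - 40 * m^5 * n * a * b * e
     - 12 * m^5 * n * a * c * d
     + m^5 * n * b^2 * d
     + m^4 * n^4 * a^2
     + 80 * m^4 * n^2 * a^2 * e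
     + 34 * m^4 * n^2 * a * b * d
     + 12 * m^4 * n^2 * a * c^2
     - m^4 * n^2 * b^2 * c
     - 128 * m^4 * a^2 * e^2
     - 80 * m^4 * a * b * d * e
     + 96 * m^4 * a * c^2 * e
     - 12 * m^4 * a * c * d^2
     - 12 * m^4 * b^2 * c * e
     + m^4 * b^2 * d^2
     - 72 * m^3 * n^3 * a^2 * d
     - 44 * m^3 * n^3 * a * b * c
     + m^3 * n^3 * b^3
     + 576 * m^3 * n * a^2 * d * e
     - 320 * m^3 * n * a * b * c * e
     + 108 * m^3 * n * a * b * d^2
     - 48 * m^3 * n * a * c^2 * d
     + 36 * m^3 * n * b^3 * e
     + 8 * m^3 * n * b^2 * c * d
     + 80 * m^2 * n^4 * a^2 * c
     + 30 * m^2 * n^4 * a * b^2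
     + 64 * m^2 * n^2 * a^2 * c * e
     - 504 * m^2 * n^2 * a^2 * d^2
     + 264 * m^2 * n^2 * a * b^2 * e
     + 56 * m^2 * n^2 * a * b * c * d
     + 48 * m^2 * n^2 * a * c^3
     - 30 * m^2 * n^2 * b^3 * d
     - 8 * m^2 * n^2 * b^2 * c^2
     - 1024 * m^2 * a^2 * c * e^2
     + 576 * m^2 * a^2 * d^2 * e
     + 576 * m^2 * a * b^2 * e^2
     - 640 * m^2 * a * b * c * d * e
     + 72 * m^2 * a * b * d^3
     + 256 * m^2 * a * c^3 * e
     - 48 * m^2 * a * c^2 * d^2
     + 72 * m^2 * b^3 * d * e
     - 48 * m^2 * b^2 * c^2 * e
     + 8 * m^2 * b^2 * c * d^2
     - 96 * m * n^5 * a^2 * b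
     - 768 * m * n^3 * a^2 * b * e
     + 576 * m * n^3 * a^2 * c * d
     - 24 * m * n^3 * a * b^2 * d
     - 160 * m * n^3 * a * b * c^2
     + 36 * m * n^3 * b^3 * c
     - 1536 * m * n * a^2 * b * e^2
     + 2304 * m * n * a^2 * c * d * e
     - 864 * m * n * a^2 * d^3
     - 96 * m * n * a * b^2 * d * e
     - 640 * m * n * a * b * c^2 * e
     + 432 * m * n * a * b * c * d^2
     - 64 * m * n * a * c^3 * d
     + 144 * m * n * b^3 * c * e
     - 96 * m * n * b^3 * d^2
     + 16 * m * n * b^2 * c^2 * d
     + 64 * n^6 * a^3
     + 768 * n^4 * a^3 * e
     - 192 * n^4 * a^2 * b * d
     - 128 * n^4 * a^2 * c^2
     + 144 * n^4 * a * b^2 * c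
     - 27 * n^4 * b^4
     + 3072 * n^2 * a^3 * e^2
     - 1536 * n^2 * a^2 * b * d * e
     - 1024 * n^2 * a^2 * c^2 * e
     + 576 * n^2 * a^2 * c * d^2
     + 1152 * n^2 * a * b^2 * c * e
     - 24 * n^2 * a * b^2 * d^2
     - 320 * n^2 * a * b * c^2 * d
     + 64 * n^2 * a * c^4
     - 216 * n^2 * b^4 * e
     + 72 * n^2 * b^3 * c * d
     - 16 * n^2 * b^2 * c^3
     + 4096 * a^3 * e^3
     - 3072 * a^2 * b * d * e^2
     - 2048 * a^2 * c^2 * e^2
     + 2304 * a^2 * c * d^2 * e
     - 432 * a^2 * d^4
     + 2304 * a * b^2 * c * e^2
     - 96 * a * b^2 * d^2 * e
     - 1280 * a * b * c^2 * d * e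
     + 288 * a * b * c * d^3
     + 256 * a * c^4 * e
     - 64 * a * c^3 * d^2
     - 432 * b^4 * e^2
     + 288 * b^3 * c * d * e
     - 64 * b^3 * d^3
     - 64 * b^2 * c^3 * e
     + 16 * b^2 * c^2 * d^2
)"

text \<open>Weierstrass equations y^2 + a1 x y + a3 y = x^3 + a2 x^2 + a4 x + a6\<close>
datatype 'a weier = Weier (wa1: 'a) (wa2: 'a) (wa3: 'a) (wa4: 'a) (wa6: 'a)

definition w_disc :: "'a::comm_ring_1 weier \<Rightarrow> 'a" where
  "w_disc W = (case W of Weier a1 a2 a3 a4 a6 \<Rightarrow>
     (let b2 = a1^2 + 4 * a2; b4 = 2 * a4 + a1 * a3; b6 = a3^2 + 4 * a6;
          b8 = a1^2 * a6 + 4 * a2 * a6 - a1 * a3 * a4 + a2 * a3^2 - a4^2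
      in (- (b2^2 * b8)) - 8 * b4^3 - 27 * b6^2 + 9 * b2 * b4 * b6))"

definition w_integral :: "('a::field \<Rightarrow> int) \<Rightarrow> 'a weier \<Rightarrow> bool" where
  "w_integral v W \<longleftrightarrow> intg v (wa1 W) \<and> intg v (wa2 W) \<and> intg v (wa3 W) \<and> intg v (wa4 W) \<and> intg v (wa6 W)"

text \<open>K-isomorphism of Weierstrass equations: W' is obtained from W by the change of variables
  x = u^2 x' + r, y = u^3 y' + s u^2 x' + t with u \<noteq> 0 (Silverman, Table 3.1).\<close>
definition w_iso :: "'a::field weier \<Rightarrow> 'a weier \<Rightarrow> bool" where
  "w_iso W W' \<longleftrightarrow> (\<exists>u r s t. u \<noteq> 0 \<and>
     u * wa1 W' = wa1 W + 2 * s \<and>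
     u^2 * wa2 W' = wa2 W - s * wa1 W + 3 * r - s^2 \<and>
     u^3 * wa3 W' = wa3 W + r * wa1 W + 2 * t \<and>
     u^4 * wa4 W' = wa4 W - s * wa3 W + 2 * r * wa2 W - (t + r * s) * wa1 W + 3 * r^2 - 2 * s * t \<and>
     u^6 * wa6 W' = wa6 W + r * wa4 W + r^2 * wa2 W + r^3 - t * wa3 W - t^2 - r * t * wa1 W)"

text \<open>A Weierstrass equation for the Jacobian E of y^2 + P y = Q (valid in all characteristics).\<close>
definition jac :: "'a::comm_ring_1 gbq \<Rightarrow> 'a weier" where
  "jac F = (case F of GBQ l m n a b c d e \<Rightarrow>
     Weier m (c - l * n) (l * d + n * b)
       (b * d - 4 * a * e - l^2 * e - l * n * c - n^2 * a)
       (a * d^2 + b^2 * e - 4 * a * c * e - l^2 * c * e + l * m * b * e - l * n * b * d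
        - m^2 * a * e + m * n * a * d - n^2 * a * c))"

definition has_level :: "('a::field \<Rightarrow> int) \<Rightarrow> 'a gbq \<Rightarrow> int \<Rightarrow> bool" where
  "has_level v F lev \<longleftrightarrow> (\<exists>W. w_integral v W \<and> w_iso (jac F) W \<and>
     (\<forall>W'. w_integral v W' \<and> w_iso (jac F) W' \<longrightarrow> v (w_disc W) \<le> v (w_disc W')) \<and>
     v (gbq_disc F) = v (w_disc W) + 12 * lev)"

definition non_minimal :: "('a::field \<Rightarrow> int) \<Rightarrow> 'a gbq \<Rightarrow> bool" where
  "non_minimal v F \<longleftrightarrow> (\<exists>F'. gbq_integral v F' \<and> K_equiv F F' \<and> gbq_disc F' \<noteq> 0 \<and>
     v (gbq_disc F') < v (gbq_disc F))"

text \<open>Q_1 (for an integral model with v(P,Q) \<in> {0,1}, after step 1 when v(P,Q) = 1)\<close>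
definition Q1 :: "('a::field \<Rightarrow> int) \<Rightarrow> 'a \<Rightarrow> 'a gbq \<Rightarrow> 'a list" where
  "Q1 v \<pi> F =
     (if \<not> vform_ge v (Pcoeffs F) 1 then Pcoeffs F
      else if \<not> vPQ_ge v F 1 then [3 * cb F, 4 * cc F, 3 * cd F]
      else map (\<lambda>c. c / \<pi>) (Qcoeffs F))"

definition proc_step :: "('a::field \<Rightarrow> int) \<Rightarrow> 'a \<Rightarrow> ('a \<Rightarrow> 'b::field) \<Rightarrow> 'a gbq \<Rightarrow> 'a gbq \<Rightarrow> bool" where
  "proc_step v \<pi> red F F' \<longleftrightarrow> (\<exists>F1 F2 F3.
     (if vPQ_ge v F 1 then y_sub v F F1 \<and> vform_ge v (Qcoeffs F1) 1 else F1 = F) \<and>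
     (\<exists>m11 m12 m21 m22. intg v m11 \<and> intg v m12 \<and> intg v m21 \<and> intg v m22 \<and>
        m11 * m22 - m12 * m21 \<noteq> 0 \<and> v (m11 * m22 - m12 * m21) = 0 \<and>
        gen_sub F1 F2 m11 m12 m21 m22 1 0 0 0 \<and>
        rep_root (map red (Q1 v \<pi> F1)) (red m21) (red m22)) \<and>
     y_sub v F2 F3 \<and> vge v (ce F3) 1 \<and>
     (\<forall>x z. Pev F' x z = Pev F3 (\<pi> * x) z / \<pi> \<and> Qev F' x z = Qev F3 (\<pi> * x) z / \<pi>^2))"

end

theory Submission
  imports Defs
begin

text \<open>
  The level of a model is positive iff its Jacobian, in the Weierstrass form \<^term>\<open>jac F\<close>, admits a
  substitution with integral \<open>r\<close>, \<open>s\<close>, \<open>t\<close> after which \<open>\<pi>^i\<close> divides the coefficient \<open>a_i\<close>.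
  In residue characteristic two these divisibilities force \<open>m\<close> to vanish modulo \<open>\<pi>\<close>, give the relations
  \<open>c^2 = b d\<close> and \<open>a d^2 + b^2 e + b c d = 0\<close> for \<open>\<pi>^{-1} Q\<close> modulo \<open>\<pi>\<close> when \<open>\<pi>\<close> divides \<open>P\<close> and \<open>Q\<close>, and
  yield \<open>\<pi>^2 dvd e\<close> once the repeated root lies at \<open>(0 : 1)\<close>.

  A non-minimal model becomes, by elementary divisors, integral of smaller discriminant after
  \<open>x \<leftarrow> \<kappa> x\<close>, so up to integral equivalence its coefficients satisfy one of two systems of lower
  bounds, according to whether \<open>v \<kappa> = 1\<close> or \<open>v \<kappa> \<ge> 2\<close>. In such coordinates the repeated root already
  lies at \<open>(0 : 1)\<close>; one step of the procedure turns the second system into the first, and the first into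
  \<open>v(P, Q) \<ge> 2\<close>.
\<close>

section \<open>Weierstrass equations\<close>

text \<open>In residue characteristic two the square cannot be completed over O_K, so c_4 and c_6 do
  not control the model; everything is read off a_1, ..., a_6 of \<open>jac F\<close>, which are
  integer polynomials, by comparing lower bounds of valuations. The procedure leaves its matrix and
  y-substitutions free, so its outcome is followed only up to \<open>int_equiv\<close>. The obstacle
  is that the contraction x <- \<pi> x respects \<open>int_equiv\<close> only for substitutions that
  fix (0 : 1) modulo \<pi> and whose y-shift has z^2-coefficient divisible by \<pi>. The first
  condition holds because both coordinate systems have the repeated root at (0 : 1), the second
  because \<pi> divides e in both. The second system of bounds is weaker because the y-shift leading
  to the smaller model may have a non-integral x^2-coefficient when v \<kappa> >= 2, and that
  coefficient has to be dropped. This touches only l, a, b, whose bounds say nothing beyond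
  integrality in that case, and c, where the error is that coefficient times n of the shifted model
  and is still divisible by \<pi>^2.\<close>

definition w_trans :: "'a::field weier \<Rightarrow> 'a \<Rightarrow> 'a \<Rightarrow> 'a \<Rightarrow> 'a \<Rightarrow> 'a weier \<Rightarrow> bool" where
  "w_trans W u r s t W' \<longleftrightarrow>
     u * wa1 W' = wa1 W + 2 * s \<and>
     u^2 * wa2 W' = wa2 W - s * wa1 W + 3 * r - s^2 \<and>
     u^3 * wa3 W' = wa3 W + r * wa1 W + 2 * t \<and>
     u^4 * wa4 W' = wa4 W - s * wa3 W + 2 * r * wa2 W - (t + r * s) * wa1 W + 3 * r^2 - 2 * s * t \<and>
     u^6 * wa6 W' = wa6 W + r * wa4 W + r^2 * wa2 W + r^3 - t * wa3 W - t^2 - r * t * wa1 W"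

text \<open>\<open>w_iso\<close> hides \<open>u\<close>, whose valuation measures the change of
  level; \<open>w_trans\<close> keeps it visible.\<close>

lemma w_iso_iff: "w_iso W W' \<longleftrightarrow> (\<exists>u r s t. u \<noteq> 0 \<and> w_trans W u r s t W')"
  by (simp add: w_iso_def w_trans_def)

lemma w_trans_comp:
  assumes "w_trans W u r s t W'" "w_trans W' u' r' s' t' W''"
  shows "w_trans W (u * u') (r + u^2 * r') (s + u * s') (t + u^3 * t' + s * u^2 * r') W''"
proof -
  note 1 = assms(1)[unfolded w_trans_def] and 2 = assms(2)[unfolded w_trans_def]
  \<comment> \<open>Each relation is multiplied by a power of u, so that W' enters only through u^i
    a_i, which the first transformation gives as polynomials in the coefficients of W.\<close>
  have "(u * u') * wa1 W'' = u * wa1 W' + 2 * (u * s')"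
    using 2 by algebra
  moreover have "(u * u')^2 * wa2 W'' = u^2 * wa2 W' - (u * s') * (u * wa1 W') + 3 * (u^2 * r') - (u * s')^2"
    using 2 by algebra
  moreover have "(u * u')^3 * wa3 W'' = u^3 * wa3 W' + (u^2 * r') * (u * wa1 W') + 2 * (u^3 * t')"
    using 2 by algebra
  moreover have "(u * u')^4 * wa4 W'' = u^4 * wa4 W' - (u * s') * (u^3 * wa3 W') + 2 * (u^2 * r') * (u^2 * wa2 W')
      - (u^3 * t' + u^2 * r' * (u * s')) * (u * wa1 W') + 3 * (u^2 * r')^2 - 2 * (u * s') * (u^3 * t')"
    using 2 by algebra
  moreover have "(u * u')^6 * wa6 W'' = u^6 * wa6 W' + (u^2 * r') * (u^4 * wa4 W') + (u^2 * r')^2 * (u^2 * wa2 W')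
     + (u^2 * r')^3 - (u^3 * t') * (u^3 * wa3 W') - (u^3 * t')^2 - (u^2 * r') * (u^3 * t') * (u * wa1 W')"
    using 2 by algebra
  ultimately show ?thesis
    using 1 unfolding w_trans_def by algebra
qed

lemma w_trans_inverse:
  
  assumes "w_trans W u r s t W'" and "u \<noteq> 0"
  shows "w_trans W' (1 / u) (- r / u^2) (- s / u) ((r * s - t) / u^3) W"
proof -
  note 1 = assms(1)[unfolded w_trans_def]
  define i where "i = 1 / u"
  have i: "u * i = 1" using assms(2) by (simp add: i_def)
  have e: "- r / u^2 = - r * i^2" "- s / u = - s * i" "(r * s - t) / u^3 = (r * s - t) * i^3" "1 / u = i"
    by (simp_all add: i_def field_simps)
  have c: "wa1 W' = i * (u * wa1 W')" "wa2 W' = i^2 * (u^2 * wa2 W')" "wa3 W' = i^3 * (u^3 * wa3 W')"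
     "wa4 W' = i^4 * (u^4 * wa4 W')" "wa6 W' = i^6 * (u^6 * wa6 W')"
    using i by algebra+
  have c': "wa1 W' = i * (wa1 W + 2 * s)" "wa2 W' = i^2 * (wa2 W - s * wa1 W + 3 * r - s^2)"
     "wa3 W' = i^3 * (wa3 W + r * wa1 W + 2 * t)"
     "wa4 W' = i^4 * (wa4 W - s * wa3 W + 2 * r * wa2 W - (t + r * s) * wa1 W + 3 * r^2 - 2 * s * t)"
     "wa6 W' = i^6 * (wa6 W + r * wa4 W + r^2 * wa2 W + r^3 - t * wa3 W - t^2 - r * t * wa1 W)"
    using 1 c by simp_all
  show ?thesis
    unfolding w_trans_def e c' by (intro conjI; algebra)
qed

text \<open>The change of variables is followed on b_2, b_4, b_6, b_8, on which s and t have no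
  effect, instead of on the expanded discriminant.\<close>

lemma w_disc_trans:
  assumes "w_trans W u r s t W'"
  shows "u^12 * w_disc W' = w_disc W"
proof -
  obtain a1 a2 a3 a4 a6 where W: "W = Weier a1 a2 a3 a4 a6" by (cases W)
  obtain b1 b2 b3 b4 b6 where W': "W' = Weier b1 b2 b3 b4 b6" by (cases W')
  note 1 = assms[unfolded w_trans_def W W' weier.sel]
  define B2 B4 B6 B8 where "B2 = a1^2 + 4 * a2" "B4 = 2 * a4 + a1 * a3" "B6 = a3^2 + 4 * a6"
     "B8 = a1^2 * a6 + 4 * a2 * a6 - a1 * a3 * a4 + a2 * a3^2 - a4^2"
  note B = this
  define C2 C4 C6 C8 where "C2 = b1^2 + 4 * b2" "C4 = 2 * b4 + b1 * b3" "C6 = b3^2 + 4 * b6"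
     "C8 = b1^2 * b6 + 4 * b2 * b6 - b1 * b3 * b4 + b2 * b3^2 - b4^2"
  note C = this
  have h: "u^2 * C2 = B2 + 12 * r" "u^4 * C4 = B4 + r * B2 + 6 * r^2"
    "u^6 * C6 = B6 + 2 * r * B4 + r^2 * B2 + 4 * r^3"
  proof -
    have "u^2 * C2 = (u * b1)^2 + 4 * (u^2 * b2)" unfolding C by algebra
    then show "u^2 * C2 = B2 + 12 * r" using 1 unfolding B by algebra
    have "u^4 * C4 = 2 * (u^4 * b4) + (u * b1) * (u^3 * b3)" unfolding C by algebra
    then show "u^4 * C4 = B4 + r * B2 + 6 * r^2" using 1 unfolding B by algebra
    have "u^6 * C6 = (u^3 * b3)^2 + 4 * (u^6 * b6)" unfolding C by algebra
    then show "u^6 * C6 = B6 + 2 * r * B4 + r^2 * B2 + 4 * r^3" using 1 unfolding B by algebra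
  qed
  have h8: "u^8 * C8 = B8 + 3 * r * B6 + 3 * r^2 * B4 + r^3 * B2 + 3 * r^4"
  proof -
    have "u^8 * C8 = (u * b1)^2 * (u^6 * b6) + 4 * (u^2 * b2) * (u^6 * b6)
         - (u * b1) * (u^3 * b3) * (u^4 * b4) + (u^2 * b2) * (u^3 * b3)^2 - (u^4 * b4)^2"
      unfolding C by algebra
    also have "\<dots> = B8 + 3 * r * B6 + 3 * r^2 * B4 + r^3 * B2 + 3 * r^4"
      using 1 unfolding B by algebra
    finally show ?thesis .
  qed
  have "u^12 * w_disc W' = - ((u^2 * C2)^2 * (u^8 * C8)) - 8 * (u^4 * C4)^3 - 27 * (u^6 * C6)^2
     + 9 * (u^2 * C2) * (u^4 * C4) * (u^6 * C6)"
    unfolding W' w_disc_def weier.case Let_def C by algebra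
  also have "\<dots> = - (B2^2 * B8) - 8 * B4^3 - 27 * B6^2 + 9 * B2 * B4 * B6"
  proof -
    \<comment> \<open>With the b_i treated as independent the discriminant is not invariant under
      translation by r; this relation cancels the remaining terms.\<close>
    have "4 * B8 = B2 * B6 - B4^2" unfolding B by algebra
    then show ?thesis unfolding h h8 by algebra
  qed
  also have "\<dots> = w_disc W"
    unfolding W w_disc_def weier.case Let_def B by (rule refl)
  finally show ?thesis .
qed

text \<open>This ties the long polynomial to a Weierstrass discriminant, so that its behaviour under
  substitutions follows from \<open>w_disc_trans\<close>.\<close>

lemma w_disc_jac: "w_disc (jac F) = gbq_disc (F :: 'a::field gbq)"
proof -
  obtain l m n a b c d e where F: "F = GBQ l m n a b c d e" by (cases F)
  show ?thesis
    unfolding F w_disc_def jac_def gbq_disc_def gbq.case weier.case Let_def by algebra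
qed

section \<open>Substitutions of binary quartics and their Jacobians\<close>

lemma infinite_poly_eqI:
  fixes p q :: "'a::idom poly"
  assumes "infinite (UNIV :: 'a set)" and "\<And>x. poly p x = poly q x"
  shows "p = q"
  using poly_roots_finite[of "p - q"] assms by auto

lemma binary_quadratic_eqD:
  fixes l m n :: "'a::idom"
  assumes "infinite (UNIV :: 'a set)"
    and "\<And>x z. l * x^2 + m * x * z + n * z^2 = l' * x^2 + m' * x * z + n' * z^2"
  shows "l = l' \<and> m = m' \<and> n = n'"
proof -
  have "[:n, m, l:] = [:n', m', l':]"
    using assms(2)[where z = 1] by (intro infinite_poly_eqI assms(1)) (simp add: algebra_simps power2_eq_square)
  then show ?thesis by simp
qed

lemma binary_quartic_eqD:
  fixes a b c d e :: "'a::idom"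
  assumes "infinite (UNIV :: 'a set)"
    and "\<And>x z. a * x^4 + b * x^3 * z + c * x^2 * z^2 + d * x * z^3 + e * z^4
       = a' * x^4 + b' * x^3 * z + c' * x^2 * z^2 + d' * x * z^3 + e' * z^4"
  shows "a = a' \<and> b = b' \<and> c = c' \<and> d = d' \<and> e = e'"
proof -
  have "[:e, d, c, b, a:] = [:e', d', c', b', a':]"
    using assms(2)[where z = 1]
    by (intro infinite_poly_eqI assms(1)) (simp add: algebra_simps power2_eq_square power3_eq_cube power4_eq_xxxx)
  then show ?thesis by simp
qed

definition lin_sub :: "'a::field gbq \<Rightarrow> 'a \<Rightarrow> 'a \<Rightarrow> 'a \<Rightarrow> 'a \<Rightarrow> 'a gbq" where
  "lin_sub F m11 m12 m21 m22 = (case F of GBQ l m n a b c d e \<Rightarrow> GBQ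
     (m11^2 * l + m11 * m12 * m + m12^2 * n)
     (2 * m11 * m21 * l + (m11 * m22 + m12 * m21) * m + 2 * m12 * m22 * n)
     (m21^2 * l + m21 * m22 * m + m22^2 * n)
     (m11^4 * a + m11^3 * m12 * b + m11^2 * m12^2 * c + m11 * m12^3 * d + m12^4 * e)
     (4 * m11^3 * m21 * a + (3 * m11^2 * m12 * m21 + m11^3 * m22) * b
       + 2 * m11 * m12 * (m11 * m22 + m12 * m21) * c + (3 * m11 * m12^2 * m22 + m12^3 * m21) * d
       + 4 * m12^3 * m22 * e)
     (6 * m11^2 * m21^2 * a + 3 * m11 * m21 * (m11 * m22 + m12 * m21) * b
       + (m11^2 * m22^2 + 4 * m11 * m12 * m21 * m22 + m12^2 * m21^2) * c
       + 3 * m12 * m22 * (m11 * m22 + m12 * m21) * d + 6 * m12^2 * m22^2 * e)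
     (4 * m11 * m21^3 * a + (3 * m11 * m21^2 * m22 + m12 * m21^3) * b
       + 2 * m21 * m22 * (m11 * m22 + m12 * m21) * c + (m11 * m22^3 + 3 * m12 * m21 * m22^2) * d
       + 4 * m12 * m22^3 * e)
     (m21^4 * a + m21^3 * m22 * b + m21^2 * m22^2 * c + m21 * m22^3 * d + m22^4 * e))"

definition y_shift :: "'a::field gbq \<Rightarrow> 'a \<Rightarrow> 'a \<Rightarrow> 'a \<Rightarrow> 'a gbq" where
  "y_shift F r0 r1 r2 = (case F of GBQ l m n a b c d e \<Rightarrow> GBQ
     (l + 2 * r0) (m + 2 * r1) (n + 2 * r2)
     (a - r0^2 - l * r0)
     (b - 2 * r0 * r1 - l * r1 - m * r0)
     (c - r1^2 - 2 * r0 * r2 - l * r2 - m * r1 - n * r0)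
     (d - 2 * r1 * r2 - m * r2 - n * r1)
     (e - r2^2 - n * r2))"

definition gscale :: "'a::field \<Rightarrow> 'a gbq \<Rightarrow> 'a gbq" where
  "gscale \<mu> F = (case F of GBQ l m n a b c d e \<Rightarrow>
     GBQ (\<mu> * l) (\<mu> * m) (\<mu> * n) (\<mu>^2 * a) (\<mu>^2 * b) (\<mu>^2 * c) (\<mu>^2 * d) (\<mu>^2 * e))"

lemma gscale_1 [simp]: "gscale 1 F = F"
  by (cases F) (simp add: gscale_def)

lemma y_shift_0 [simp]: "y_shift F 0 0 0 = F"
  by (cases F) (simp add: y_shift_def)

lemma lin_sub_1 [simp]: "lin_sub F 1 0 0 1 = F"
  by (cases F) (simp add: lin_sub_def)

lemma lin_sub_gscale: "lin_sub (gscale \<mu> F) m11 m12 m21 m22 = gscale \<mu> (lin_sub F m11 m12 m21 m22)"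
  by (cases F) (simp add: lin_sub_def gscale_def algebra_simps)

lemma Pev_lin_sub: "Pev (lin_sub F m11 m12 m21 m22) x z = Pev F (m11 * x + m21 * z) (m12 * x + m22 * z)"
proof -
  obtain l m n a b c d e where F: "F = GBQ l m n a b c d e" by (cases F)
  show ?thesis unfolding F lin_sub_def Pev_def gbq.case gbq.sel by algebra
qed

lemma Qev_lin_sub: "Qev (lin_sub F m11 m12 m21 m22) x z = Qev F (m11 * x + m21 * z) (m12 * x + m22 * z)"
proof -
  obtain l m n a b c d e where F: "F = GBQ l m n a b c d e" by (cases F)
  show ?thesis unfolding F lin_sub_def Qev_def gbq.case gbq.sel by algebra
qed

lemma Pev_y_shift: "Pev (y_shift F r0 r1 r2) x z = Pev F x z + 2 * (r0 * x^2 + r1 * x * z + r2 * z^2)"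
proof -
  obtain l m n a b c d e where F: "F = GBQ l m n a b c d e" by (cases F)
  show ?thesis unfolding F y_shift_def Pev_def gbq.case gbq.sel by algebra
qed

lemma Qev_y_shift:
  "Qev (y_shift F r0 r1 r2) x z = Qev F x z - (r0 * x^2 + r1 * x * z + r2 * z^2)^2
     - Pev F x z * (r0 * x^2 + r1 * x * z + r2 * z^2)"
proof -
  obtain l m n a b c d e where F: "F = GBQ l m n a b c d e" by (cases F)
  show ?thesis unfolding F y_shift_def Pev_def Qev_def gbq.case gbq.sel by algebra
qed

lemma Pev_gscale: "Pev (gscale \<mu> F) x z = \<mu> * Pev F x z"
  by (cases F) (simp add: gscale_def Pev_def algebra_simps)

lemma Qev_gscale: "Qev (gscale \<mu> F) x z = \<mu>^2 * Qev F x z"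
  by (cases F) (simp add: gscale_def Qev_def algebra_simps)

lemma gbq_eqI:
  fixes F G :: "'a::field gbq"
  assumes "infinite (UNIV :: 'a set)"
    and "\<And>x z. Pev F x z = Pev G x z" "\<And>x z. Qev F x z = Qev G x z"
  shows "F = G"
  using binary_quadratic_eqD[OF assms(1) assms(2)[unfolded Pev_def]]
    binary_quartic_eqD[OF assms(1) assms(3)[unfolded Qev_def]]
  by (cases F; cases G) simp

text \<open>Fixes the order of the three operations: linear substitution, then y-shift, then
  scaling.\<close>

lemma gen_sub_explicit:
  "gen_sub F (gscale \<mu> (y_shift (lin_sub F m11 m12 m21 m22) r0 r1 r2)) m11 m12 m21 m22 \<mu> r0 r1 r2"
  by (simp add: gen_sub_def Let_def Pev_gscale Qev_gscale Pev_y_shift Qev_y_shift Pev_lin_sub Qev_lin_sub)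

lemma gen_sub_iff:
  fixes F G :: "'a::field gbq"
  assumes "infinite (UNIV :: 'a set)"
  shows "gen_sub F G m11 m12 m21 m22 \<mu> r0 r1 r2 \<longleftrightarrow>
     G = gscale \<mu> (y_shift (lin_sub F m11 m12 m21 m22) r0 r1 r2)"
    (is "_ \<longleftrightarrow> G = ?H")
proof
  assume "gen_sub F G m11 m12 m21 m22 \<mu> r0 r1 r2"
  with gen_sub_explicit[of F \<mu> m11 m12 m21 m22 r0 r1 r2] show "G = ?H"
    by (intro gbq_eqI assms) (simp_all add: gen_sub_def Let_def)
qed (simp add: gen_sub_explicit)

text \<open>The first shift is pulled back along the second matrix; the second shift is applied to a
  y already scaled by \<mu>, hence enters divided by \<mu>.\<close>

lemma gen_sub_comp:
  assumes "gen_sub F G a11 a12 a21 a22 \<mu> r0 r1 r2" "gen_sub G H b11 b12 b21 b22 \<nu> s0 s1 s2"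
    and "\<mu> \<noteq> 0"
  shows "gen_sub F H (a11 * b11 + a21 * b12) (a12 * b11 + a22 * b12)
     (a11 * b21 + a21 * b22) (a12 * b21 + a22 * b22) (\<mu> * \<nu>)
     (b11^2 * r0 + b11 * b12 * r1 + b12^2 * r2 + s0 / \<mu>)
     (2 * b11 * b21 * r0 + (b11 * b22 + b12 * b21) * r1 + 2 * b12 * b22 * r2 + s1 / \<mu>)
     (b21^2 * r0 + b21 * b22 * r1 + b22^2 * r2 + s2 / \<mu>)"
  unfolding gen_sub_def Let_def
proof (intro allI)
  fix x z
  define X Z where "X = b11 * x + b21 * z" "Z = b12 * x + b22 * z"
  note XZ = this
  define R S where "R = r0 * X^2 + r1 * X * Z + r2 * Z^2" "S = s0 * x^2 + s1 * x * z + s2 * z^2"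
  note RS = this
  define p q where "p = Pev F (a11 * X + a21 * Z) (a12 * X + a22 * Z)"
    "q = Qev F (a11 * X + a21 * Z) (a12 * X + a22 * Z)"
  note pq = this
  have args: "(a11 * b11 + a21 * b12) * x + (a11 * b21 + a21 * b22) * z = a11 * X + a21 * Z"
     "(a12 * b11 + a22 * b12) * x + (a12 * b21 + a22 * b22) * z = a12 * X + a22 * Z"
    unfolding XZ by algebra+
  define i where "i = 1 / \<mu>"
  have i: "\<mu> * i = 1" using assms(3) by (simp add: i_def)
  have RS': "(b11^2 * r0 + b11 * b12 * r1 + b12^2 * r2 + s0 / \<mu>) * x^2
     + (2 * b11 * b21 * r0 + (b11 * b22 + b12 * b21) * r1 + 2 * b12 * b22 * r2 + s1 / \<mu>) * x * z
     + (b21^2 * r0 + b21 * b22 * r1 + b22^2 * r2 + s2 / \<mu>) * z^2 = R + i * S"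
    unfolding RS XZ divide_inverse i_def by algebra
  have "Pev G X Z = \<mu> * (p + 2 * R)" "Qev G X Z = \<mu>^2 * (q - R^2 - p * R)"
    using assms(1) unfolding gen_sub_def Let_def pq RS by simp_all
  moreover have "Pev H x z = \<nu> * (Pev G X Z + 2 * S)"
     "Qev H x z = \<nu>^2 * (Qev G X Z - S^2 - Pev G X Z * S)"
    using assms(2) unfolding gen_sub_def Let_def XZ RS by simp_all
  ultimately have "Pev H x z = \<mu> * \<nu> * (p + 2 * (R + i * S))"
      "Qev H x z = (\<mu> * \<nu>)^2 * (q - (R + i * S)^2 - p * (R + i * S))"
    using i by algebra+
  then show "Pev H x z = \<mu> * \<nu> * (Pev F ((a11 * b11 + a21 * b12) * x + (a11 * b21 + a21 * b22) * z)
        ((a12 * b11 + a22 * b12) * x + (a12 * b21 + a22 * b22) * z)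
      + 2 * ((b11^2 * r0 + b11 * b12 * r1 + b12^2 * r2 + s0 / \<mu>) * x^2
     + (2 * b11 * b21 * r0 + (b11 * b22 + b12 * b21) * r1 + 2 * b12 * b22 * r2 + s1 / \<mu>) * x * z
     + (b21^2 * r0 + b21 * b22 * r1 + b22^2 * r2 + s2 / \<mu>) * z^2)) \<and>
     Qev H x z = (\<mu> * \<nu>)^2 * (Qev F ((a11 * b11 + a21 * b12) * x + (a11 * b21 + a21 * b22) * z)
        ((a12 * b11 + a22 * b12) * x + (a12 * b21 + a22 * b22) * z)
      - ((b11^2 * r0 + b11 * b12 * r1 + b12^2 * r2 + s0 / \<mu>) * x^2
     + (2 * b11 * b21 * r0 + (b11 * b22 + b12 * b21) * r1 + 2 * b12 * b22 * r2 + s1 / \<mu>) * x * z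
     + (b21^2 * r0 + b21 * b22 * r1 + b22^2 * r2 + s2 / \<mu>) * z^2)^2
     - Pev F ((a11 * b11 + a21 * b12) * x + (a11 * b21 + a21 * b22) * z)
        ((a12 * b11 + a22 * b12) * x + (a12 * b21 + a22 * b22) * z)
      * ((b11^2 * r0 + b11 * b12 * r1 + b12^2 * r2 + s0 / \<mu>) * x^2
     + (2 * b11 * b21 * r0 + (b11 * b22 + b12 * b21) * r1 + 2 * b12 * b22 * r2 + s1 / \<mu>) * x * z
     + (b21^2 * r0 + b21 * b22 * r1 + b22^2 * r2 + s2 / \<mu>) * z^2))"
    unfolding RS' args pq by simp
qed

text \<open>Shears, the swap, diagonal matrices and y-shifts generate all substitutions, so the
  Jacobian is compared for these only. Here s, r, t are found by comparing a_1, a_2, a_3 over the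
  integers; only diagonal matrices and scalings need u other than 1.\<close>

lemma jac_shear: "w_trans (jac F) 1 (2 * ca F * k^2 + cb F * k) (cl F * k)
    (2 * ca F * k * cn F + ca F * k^2 * cm F + 4 * ca F * k^3 * cl F + 2 * cb F * k^2 * cl F + cc F * k * cl F)
    (jac (lin_sub F 1 0 k 1))"
proof -
  obtain l m n a b c d e where F: "F = GBQ l m n a b c d e" by (cases F)
  have sub: "lin_sub F 1 0 k 1 = GBQ l (2 * k * l + m) (k^2 * l + k * m + n) a (4 * k * a + b)
      (6 * k^2 * a + 3 * k * b + c) (4 * k^3 * a + 3 * k^2 * b + 2 * k * c + d)
      (k^4 * a + k^3 * b + k^2 * c + k * d + e)"
    by (simp add: F lin_sub_def)
  show ?thesis
    unfolding sub unfolding F w_trans_def jac_def gbq.case gbq.sel weier.sel power_one mult_1_left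
    by (intro conjI refl; algebra)
qed

lemma jac_swap: "jac (lin_sub F 0 1 1 0) = jac F"
proof -
  obtain l m n a b c d e where F: "F = GBQ l m n a b c d e" by (cases F)
  have sub: "lin_sub F 0 1 1 0 = GBQ n m l e d c b a"
    by (simp add: F lin_sub_def)
  show ?thesis
    unfolding sub unfolding F jac_def gbq.case weier.inject by (intro conjI refl; algebra)
qed

lemma jac_diag:
  fixes F :: "'a::field gbq"
  assumes "\<alpha> * \<beta> * \<mu> \<noteq> 0"
  shows "w_trans (jac F) (1 / (\<alpha> * \<beta> * \<mu>)) 0 0 0 (jac (gscale \<mu> (lin_sub F \<alpha> 0 0 \<beta>)))"
proof -
  obtain l m n a b c d e where F: "F = GBQ l m n a b c d e" by (cases F)
  define i where "i = 1 / (\<alpha> * \<beta> * \<mu>)"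
  have i: "\<alpha> * \<beta> * \<mu> * i = 1" using assms by (simp add: i_def)
  have sub: "gscale \<mu> (lin_sub F \<alpha> 0 0 \<beta>) = GBQ (\<mu> * \<alpha>^2 * l) (\<mu> * \<alpha> * \<beta> * m) (\<mu> * \<beta>^2 * n)
      (\<mu>^2 * \<alpha>^4 * a) (\<mu>^2 * \<alpha>^3 * \<beta> * b) (\<mu>^2 * \<alpha>^2 * \<beta>^2 * c) (\<mu>^2 * \<alpha> * \<beta>^3 * d) (\<mu>^2 * \<beta>^4 * e)"
    by (simp add: F lin_sub_def gscale_def)
  define W where "W = jac (gscale \<mu> (lin_sub F \<alpha> 0 0 \<beta>))"
  have "wa1 W = (\<alpha> * \<beta> * \<mu>) * wa1 (jac F)" "wa2 W = (\<alpha> * \<beta> * \<mu>)^2 * wa2 (jac F)"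
     "wa3 W = (\<alpha> * \<beta> * \<mu>)^3 * wa3 (jac F)" "wa4 W = (\<alpha> * \<beta> * \<mu>)^4 * wa4 (jac F)"
     "wa6 W = (\<alpha> * \<beta> * \<mu>)^6 * wa6 (jac F)"
    unfolding W_def sub unfolding F jac_def gbq.case weier.sel by algebra+
  then have "w_trans (jac F) i 0 0 0 W"
    unfolding w_trans_def using i by simp (intro conjI; algebra)
  then show ?thesis by (simp add: i_def W_def)
qed

lemma jac_y_shift: "w_trans (jac F) 1 (- cl F * r2 - cn F * r0 - 2 * r0 * r2) r1
    (cb F * r2 + cd F * r0 - cl F * cn F * r1 - 2 * cl F * r1 * r2 - cm F * r0 * r2
      - 2 * cn F * r0 * r1 - 4 * r0 * r1 * r2)
    (jac (y_shift F r0 r1 r2))"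
proof -
  obtain l m n a b c d e where F: "F = GBQ l m n a b c d e" by (cases F)
  show ?thesis
    unfolding F w_trans_def jac_def y_shift_def gbq.case gbq.sel weier.sel power_one mult_1_left
    by (intro conjI refl; algebra)
qed

lemma arg_cong4: "a = a' \<Longrightarrow> b = b' \<Longrightarrow> c = c' \<Longrightarrow> d = d' \<Longrightarrow> f a b c d = f a' b' c' d'"
  by simp

section \<open>Valuations and integral equivalence\<close>

locale discretely_valued =
  fixes v :: "'a::field \<Rightarrow> int"
  assumes val: "discrete_valuation v"
begin

lemma v_mult: "x \<noteq> 0 \<Longrightarrow> y \<noteq> 0 \<Longrightarrow> v (x * y) = v x + v y"
  using val by (simp add: discrete_valuation_def)

lemma v_add: "x \<noteq> 0 \<Longrightarrow> y \<noteq> 0 \<Longrightarrow> x + y \<noteq> 0 \<Longrightarrow> min (v x) (v y) \<le> v (x + y)"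
  using val by (simp add: discrete_valuation_def)

lemma v_1 [simp]: "v 1 = 0"
  using v_mult[of 1 1] by simp

lemma v_minus [simp]: "v (- x) = v x"
proof (cases "x = 0")
  case False
  have "v (-1) = 0" using v_mult[of "-1" "-1"] by simp
  then show ?thesis using v_mult[of "-1" x] False by simp
qed simp

lemma v_power: "x \<noteq> 0 \<Longrightarrow> v (x ^ n) = int n * v x"
  by (induction n) (simp_all add: v_mult algebra_simps)

lemma v_inverse: "x \<noteq> 0 \<Longrightarrow> v (inverse x) = - v x"
  using v_mult[of x "inverse x"] by simp

lemma v_divide: "x \<noteq> 0 \<Longrightarrow> y \<noteq> 0 \<Longrightarrow> v (x / y) = v x - v y"
  by (simp add: divide_inverse v_mult v_inverse)

lemma vge_0 [simp]: "vge v 0 k"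
  by (simp add: vge_def)

lemma vge_1: "vge v 1 0"
  by (simp add: vge_def)

lemma vge_mono: "vge v x j \<Longrightarrow> k \<le> j \<Longrightarrow> vge v x k"
  by (auto simp: vge_def)

lemma vge_minus: "vge v x k \<Longrightarrow> vge v (- x) k"
  by (auto simp: vge_def)

lemma vge_add_min: "vge v x i \<Longrightarrow> vge v y j \<Longrightarrow> vge v (x + y) (min i j)"
  using v_add[of x y] by (cases "x = 0"; cases "y = 0"; cases "x + y = 0") (auto simp: vge_def)

lemma vge_diff_min: "vge v x i \<Longrightarrow> vge v y j \<Longrightarrow> vge v (x - y) (min i j)"
  using vge_add_min[of x i "- y" j] vge_minus[of y j] by simp

lemma vge_add: "vge v x k \<Longrightarrow> vge v y k \<Longrightarrow> vge v (x + y) k"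
  using vge_add_min[of x k y k] by simp

lemma vge_diff: "vge v x k \<Longrightarrow> vge v y k \<Longrightarrow> vge v (x - y) k"
  using vge_diff_min[of x k y k] by simp

lemma vge_mult: "vge v x i \<Longrightarrow> vge v y j \<Longrightarrow> vge v (x * y) (i + j)"
  by (cases "x = 0"; cases "y = 0") (auto simp: vge_def v_mult)

lemma vge_power: "vge v x i \<Longrightarrow> vge v (x ^ n) (int n * i)"
  by (cases "x = 0") (auto simp: vge_def v_power mult_left_mono power_0_left)

lemma vge_of_nat: "vge v (of_nat n) 0"
  by (induction n) (auto intro: vge_add vge_1)

lemma vge_numeral: "vge v (numeral k) 0"
  using vge_of_nat[of "numeral k"] by simp

lemma vge_mult_iff: "x \<noteq> 0 \<Longrightarrow> vge v (x * y) k \<longleftrightarrow> vge v y (k - v x)"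
  by (cases "y = 0") (auto simp: vge_def v_mult)

lemma vge_divide_iff: "x \<noteq> 0 \<Longrightarrow> vge v (y / x) k \<longleftrightarrow> vge v y (k + v x)"
  by (cases "y = 0") (auto simp: vge_def v_divide)

text \<open>Valuations are integers: v x <= i - 1 and v y <= j - 1 would give v (x y) <= i + j -
  2.\<close>

lemma vge_multD: "vge v (x * y) (i + j - 1) \<Longrightarrow> vge v x i \<or> vge v y j"
  by (cases "x = 0"; cases "y = 0") (auto simp: vge_def v_mult)

lemma vge_mult_unitD: "vge v (x * y) k \<Longrightarrow> \<not> vge v x 1 \<Longrightarrow> vge v y k"
  using vge_multD[of x y 1 k] by simp

lemma vge_power2D: "vge v (x ^ 2) (2 * k - 1) \<Longrightarrow> vge v x k"
  using vge_multD[of x x k k] by (simp add: power2_eq_square)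

text \<open>The rules compute a bound by recursion on the term, after \<open>vge_mono\<close> has
  left the bound open; \<open>simp\<close> then compares it with the goal. Known bounds are listed
  before them, so that 2 and 4 count as 1 and 2 rather than as plain numerals.\<close>

lemmas vge_lower_bound =
  vge_1 vge_numeral vge_add_min vge_diff_min vge_minus vge_mult vge_power

text \<open>If v x < j <= 0 and p is integral, then x + p also has valuation below j, and the
  product x (x + p) is too small. For j = 0 this is integral closedness.\<close>

lemma vge_quadraticD:
  assumes "vge v (x^2 + p * x) (2 * j)" and "vge v p 0" and "j \<le> 0"
  shows "vge v x j"
proof (rule ccontr)
  assume x: "\<not> vge v x j"
  have "\<not> vge v (x + p) j"
    using vge_diff[of "x + p" j p] vge_mono[OF assms(2,3)] x by auto
  moreover have "vge v (x * (x + p)) (2 * j - 1)"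
    using assms(1) by (auto intro: vge_mono simp: power2_eq_square algebra_simps)
  ultimately show False
    using vge_multD[of x "x + p" j j] x by simp
qed

lemma infinite_field: "infinite (UNIV :: 'a set)"
proof -
  obtain p where p: "p \<noteq> 0" "v p = 1"
    using val by (auto simp: discrete_valuation_def)
  have "inj (\<lambda>n. p ^ n)"
    by (rule injI) (use p v_power[of p] in \<open>metis mult.right_neutral of_nat_eq_iff\<close>)
  then show ?thesis
    using finite_imageD[of "\<lambda>n. p ^ n" UNIV] by (metis finite_subset infinite_UNIV_nat subset_UNIV)
qed

lemmas gen_sub_eq = gen_sub_iff[OF infinite_field]

lemma lin_sub_lin_sub:
  fixes F :: "'a gbq"
  shows "lin_sub (lin_sub F a11 a12 a21 a22) b11 b12 b21 b22 =
    lin_sub F (a11 * b11 + a21 * b12) (a12 * b11 + a22 * b12) (a11 * b21 + a21 * b22) (a12 * b21 + a22 * b22)"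
  by (rule gbq_eqI[OF infinite_field]) (simp_all add: Pev_lin_sub Qev_lin_sub algebra_simps)

lemma lin_sub_y_shift:
  fixes F :: "'a gbq"
  shows "lin_sub (y_shift F r0 r1 r2) b11 b12 b21 b22 =
    y_shift (lin_sub F b11 b12 b21 b22) (b11^2 * r0 + b11 * b12 * r1 + b12^2 * r2)
      (2 * b11 * b21 * r0 + (b11 * b22 + b12 * b21) * r1 + 2 * b12 * b22 * r2)
      (b21^2 * r0 + b21 * b22 * r1 + b22^2 * r2)"
proof -
  have "r0 * (b11 * x + b21 * z)^2 + r1 * (b11 * x + b21 * z) * (b12 * x + b22 * z) + r2 * (b12 * x + b22 * z)^2
      = (b11^2 * r0 + b11 * b12 * r1 + b12^2 * r2) * x^2
      + (2 * b11 * b21 * r0 + (b11 * b22 + b12 * b21) * r1 + 2 * b12 * b22 * r2) * x * z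
      + (b21^2 * r0 + b21 * b22 * r1 + b22^2 * r2) * z^2" for x z
    by algebra
  then show ?thesis
    by (intro gbq_eqI[OF infinite_field]) (simp_all add: Pev_lin_sub Qev_lin_sub Pev_y_shift Qev_y_shift)
qed

lemma y_shift_y_shift:
  fixes F :: "'a gbq"
  shows "y_shift (y_shift F r0 r1 r2) s0 s1 s2 = y_shift F (r0 + s0) (r1 + s1) (r2 + s2)"
proof -
  have "(r0 + s0) * x^2 + (r1 + s1) * x * z + (r2 + s2) * z^2
      = (r0 * x^2 + r1 * x * z + r2 * z^2) + (s0 * x^2 + s1 * x * z + s2 * z^2)" for x z
    by algebra
  then show ?thesis
    by (intro gbq_eqI[OF infinite_field])
      (simp_all add: Pev_y_shift Qev_y_shift power2_eq_square[of "_ + _"] algebra_simps)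
qed

section \<open>Change of the discriminant and of the level under substitutions\<close>

text \<open>Only v u is recorded: it is additive under composition, and k = 0 means that the level
  does not change.\<close>

definition jac_rel :: "int \<Rightarrow> 'a gbq \<Rightarrow> 'a gbq \<Rightarrow> bool" where
  "jac_rel k F G \<longleftrightarrow> (\<exists>u r s t. u \<noteq> 0 \<and> v u = k \<and> w_trans (jac F) u r s t (jac G))"

lemma jac_rel_trans: "jac_rel i F G \<Longrightarrow> jac_rel j G H \<Longrightarrow> jac_rel (i + j) F H"
  unfolding jac_rel_def using w_trans_comp by (metis mult_eq_0_iff v_mult)

text \<open>For m22 nonzero the matrix is a shear, a diagonal matrix and a transposed shear, the
  last being a shear conjugated by the swap. For m22 = 0 the swap brings m12, then nonzero, into its
  place.\<close>

lemma jac_rel_lin_sub: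
  assumes "m11 * m22 - m12 * m21 \<noteq> 0"
  shows "jac_rel (- v (m11 * m22 - m12 * m21)) F (lin_sub F m11 m12 m21 m22)"
proof -
  have shear: "jac_rel 0 F (lin_sub F 1 0 k 1)" for F k
    unfolding jac_rel_def using jac_shear by (metis v_1 zero_neq_one)
  have swap: "jac_rel 0 F (lin_sub F 0 1 1 0)" for F
    unfolding jac_rel_def jac_swap
    by (intro exI[of _ 1] exI[of _ 0]) (simp add: w_trans_def)
  have diag: "jac_rel (- v (\<alpha> * \<beta>)) F (lin_sub F \<alpha> 0 0 \<beta>)" if "\<alpha> \<noteq> 0" "\<beta> \<noteq> 0" for F \<alpha> \<beta>
    unfolding jac_rel_def using jac_diag[of \<alpha> \<beta> 1 F] that
    by (intro exI[of _ "1 / (\<alpha> * \<beta>)"] exI[of _ 0]) (simp add: v_divide)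
  have main: "jac_rel (- v (m11 * m22 - m12 * m21)) F (lin_sub F m11 m12 m21 m22)"
    if m22: "m22 \<noteq> 0" and det: "m11 * m22 - m12 * m21 \<noteq> 0" for m11 m12 m21 m22
  proof -
    define \<delta> where "\<delta> = (m11 * m22 - m12 * m21) / m22"
    have "\<delta> \<noteq> 0" "\<delta> * m22 = m11 * m22 - m12 * m21" using that by (simp_all add: \<delta>_def)
    note \<delta> = this
    let ?F1 = "lin_sub F 1 0 (m21 / m22) 1" let ?F2 = "lin_sub ?F1 \<delta> 0 0 m22"
    let ?F3 = "lin_sub ?F2 0 1 1 0" let ?F4 = "lin_sub ?F3 1 0 (m12 / m22) 1"
    let ?F5 = "lin_sub ?F4 0 1 1 0"
    have "jac_rel (0 + - v (\<delta> * m22) + 0 + 0 + 0) F ?F5"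
      by (intro jac_rel_trans[OF _ swap] jac_rel_trans[OF _ shear] jac_rel_trans[OF shear diag] \<delta> m22)
    moreover have "?F5 = lin_sub F m11 m12 m21 m22"
      using m22 by (simp add: lin_sub_lin_sub \<delta>_def field_simps)
    ultimately show ?thesis by (simp add: \<delta>)
  qed
  show ?thesis
  proof (cases "m22 = 0")
    case False
    then show ?thesis by (intro main assms)
  next
    case True
    have "jac_rel (- v (m21 * m12 - m22 * m11)) F (lin_sub F m21 m22 m11 m12)"
      using assms True by (intro main) auto
    from jac_rel_trans[OF this swap] show ?thesis
      using True v_minus[of "m12 * m21"] by (simp add: lin_sub_lin_sub mult.commute)
  qed
qed

lemma jac_rel_gen_sub:
  assumes "gen_sub F G m11 m12 m21 m22 \<mu> r0 r1 r2" "\<mu> \<noteq> 0" "m11 * m22 - m12 * m21 \<noteq> 0"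
  shows "jac_rel (- v \<mu> - v (m11 * m22 - m12 * m21)) F G"
proof -
  have y: "jac_rel 0 F (y_shift F r0 r1 r2)" for F
    unfolding jac_rel_def using jac_y_shift by (metis v_1 zero_neq_one)
  have sc: "jac_rel (- v \<mu>) F (gscale \<mu> F)" for F
    unfolding jac_rel_def using jac_diag[of 1 1 \<mu> F] assms(2)
    by (intro exI[of _ "1 / \<mu>"] exI[of _ 0]) (simp add: v_divide)
  from jac_rel_trans[OF jac_rel_trans[OF jac_rel_lin_sub[OF assms(3)] y] sc] assms(1)
  show ?thesis by (simp add: gen_sub_eq algebra_simps)
qed

lemma jac_rel_disc:
  assumes "jac_rel k F G" "gbq_disc F \<noteq> 0"
  shows "gbq_disc G \<noteq> 0" "v (gbq_disc F) = 12 * k + v (gbq_disc G)"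
proof -
  obtain u r s t where u: "u \<noteq> 0" "v u = k" "w_trans (jac F) u r s t (jac G)"
    using assms(1) by (auto simp: jac_rel_def)
  from w_disc_trans[OF u(3)] have eq: "u^12 * gbq_disc G = gbq_disc F"
    by (simp add: w_disc_jac)
  then show nz: "gbq_disc G \<noteq> 0" using assms(2) by auto
  show "v (gbq_disc F) = 12 * k + v (gbq_disc G)"
    using eq nz u by (simp add: v_mult v_power flip: eq)
qed

text \<open>The level depends only on the isomorphism class of the Jacobian and on the valuation of
  the discriminant, and both are kept when v u = 0.\<close>

lemma has_level_jac_rel:
  assumes "jac_rel 0 F G" "gbq_disc F \<noteq> 0" "has_level v F lev"
  shows "has_level v G lev"
proof -
  obtain u r s t where u: "u \<noteq> 0" "w_trans (jac F) u r s t (jac G)"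
    using assms(1) by (auto simp: jac_rel_def)
  have "w_iso (jac F) W \<longleftrightarrow> w_iso (jac G) W" for W
    unfolding w_iso_iff
    using w_trans_comp[OF u(2)] w_trans_comp[OF w_trans_inverse[OF u(2,1)]] u(1)
    by (metis divide_eq_0_iff mult_eq_0_iff zero_neq_one)
  with assms(3) jac_rel_disc[OF assms(1,2)] show ?thesis
    by (simp add: has_level_def)
qed

lemma vge_smult: "vge v x 0 \<Longrightarrow> vge v y k \<Longrightarrow> vge v (x * y) k"
  using vge_mult[of x 0 y k] by simp

lemma vge_power_0: "vge v x 0 \<Longrightarrow> vge v (x ^ n) 0"
  using vge_power[of x 0 n] by simp

lemmas vge_intros = vge_add vge_diff vge_minus vge_smult vge_power_0 vge_numeral vge_1 vge_0

lemma vge_cancel_left: "vge v (x + y) k \<Longrightarrow> vge v x k \<Longrightarrow> vge v y k"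
  using vge_diff[of "x + y" k x] by simp

lemma vform_P_iff: "vform_ge v (Pcoeffs F) k \<longleftrightarrow> vge v (cl F) k \<and> vge v (cm F) k \<and> vge v (cn F) k"
  by (simp add: vform_ge_def Pcoeffs_def)

lemma vform_Q_iff: "vform_ge v (Qcoeffs F) k \<longleftrightarrow>
    vge v (ca F) k \<and> vge v (cb F) k \<and> vge v (cc F) k \<and> vge v (cd F) k \<and> vge v (ce F) k"
  by (simp add: vform_ge_def Qcoeffs_def)

section \<open>Equivalence over O_K and invariance of v(P,Q)\<close>

definition unimod :: "'a \<Rightarrow> 'a \<Rightarrow> 'a \<Rightarrow> 'a \<Rightarrow> bool" where
  "unimod m11 m12 m21 m22 \<longleftrightarrow> vge v m11 0 \<and> vge v m12 0 \<and> vge v m21 0 \<and> vge v m22 0 \<and>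
     m11 * m22 - m12 * m21 \<noteq> 0 \<and> v (m11 * m22 - m12 * m21) = 0"

lemma unimod_1: "unimod 1 0 0 1"
  by (simp add: unimod_def vge_1)

lemma unimod_swap: "unimod 0 1 1 0"
  by (simp add: unimod_def vge_1)

lemma unimod_mult:
  assumes "unimod a11 a12 a21 a22" "unimod b11 b12 b21 b22"
  shows "unimod (a11 * b11 + a21 * b12) (a12 * b11 + a22 * b12) (a11 * b21 + a21 * b22) (a12 * b21 + a22 * b22)"
proof -
  have "(a11 * b11 + a21 * b12) * (a12 * b21 + a22 * b22) - (a12 * b11 + a22 * b12) * (a11 * b21 + a21 * b22)
      = (a11 * a22 - a12 * a21) * (b11 * b22 - b12 * b21)"
    by algebra
  with assms show ?thesis
    by (auto simp: unimod_def v_mult intro!: vge_intros)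
qed

lemma unimod_inverse:
  assumes "unimod m11 m12 m21 m22" and "\<delta> = m11 * m22 - m12 * m21"
  shows "unimod (m22 / \<delta>) (- m12 / \<delta>) (- m21 / \<delta>) (m11 / \<delta>)"
proof -
  have "m22 / \<delta> * (m11 / \<delta>) - - m12 / \<delta> * (- m21 / \<delta>) = 1 / \<delta>"
    using assms by (simp add: unimod_def diff_divide_distrib [symmetric] mult.commute)
  with assms show ?thesis
    by (auto simp: unimod_def vge_divide_iff v_divide intro!: vge_minus)
qed

text \<open>Equivalence over O_K with \<mu> = 1. The fixed order, linear part then shift, is no
  restriction: an integral shift pulled back along an integral matrix is again an integral
  shift.\<close>

definition int_equiv :: "'a gbq \<Rightarrow> 'a gbq \<Rightarrow> bool" where
  "int_equiv F G \<longleftrightarrow> (\<exists>m11 m12 m21 m22 r0 r1 r2. unimod m11 m12 m21 m22 \<and>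
     vge v r0 0 \<and> vge v r1 0 \<and> vge v r2 0 \<and> G = y_shift (lin_sub F m11 m12 m21 m22) r0 r1 r2)"

lemma int_equivI:
  "unimod m11 m12 m21 m22 \<Longrightarrow> vge v r0 0 \<Longrightarrow> vge v r1 0 \<Longrightarrow> vge v r2 0 \<Longrightarrow>
    int_equiv F (y_shift (lin_sub F m11 m12 m21 m22) r0 r1 r2)"
  unfolding int_equiv_def by blast

lemma int_equiv_lin_sub: "unimod m11 m12 m21 m22 \<Longrightarrow> int_equiv F (lin_sub F m11 m12 m21 m22)"
  unfolding int_equiv_def by (metis vge_0 y_shift_0)

lemma int_equiv_y_shift: "vge v r0 0 \<Longrightarrow> vge v r1 0 \<Longrightarrow> vge v r2 0 \<Longrightarrow> int_equiv F (y_shift F r0 r1 r2)"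
  unfolding int_equiv_def by (metis unimod_1 lin_sub_1)

lemma int_equiv_refl: "int_equiv F F"
  using int_equiv_lin_sub[OF unimod_1] by simp

lemma int_equiv_trans:
  assumes "int_equiv F G" "int_equiv G H"
  shows "int_equiv F H"
proof -
  obtain a11 a12 a21 a22 r0 r1 r2 where A: "unimod a11 a12 a21 a22" "vge v r0 0" "vge v r1 0" "vge v r2 0"
      "G = y_shift (lin_sub F a11 a12 a21 a22) r0 r1 r2"
    using assms(1) by (auto simp: int_equiv_def)
  obtain b11 b12 b21 b22 s0 s1 s2 where B: "unimod b11 b12 b21 b22" "vge v s0 0" "vge v s1 0" "vge v s2 0"
      "H = y_shift (lin_sub G b11 b12 b21 b22) s0 s1 s2"
    using assms(2) by (auto simp: int_equiv_def)
  have b: "vge v b11 0" "vge v b12 0" "vge v b21 0" "vge v b22 0"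
    using B(1) by (simp_all add: unimod_def)
  show ?thesis
    unfolding A(5) B(5) lin_sub_y_shift y_shift_y_shift lin_sub_lin_sub
    by (intro int_equivI unimod_mult vge_intros A(1-4) B(1-4) b)
qed

lemma int_equiv_sym:
  assumes "int_equiv F G"
  shows "int_equiv G F"
proof -
  obtain m11 m12 m21 m22 r0 r1 r2 where m: "unimod m11 m12 m21 m22"
      and r: "vge v r0 0" "vge v r1 0" "vge v r2 0"
      and G: "G = y_shift (lin_sub F m11 m12 m21 m22) r0 r1 r2"
    using assms by (auto simp: int_equiv_def)
  define \<delta> where "\<delta> = m11 * m22 - m12 * m21"
  have \<delta>: "\<delta> \<noteq> 0" using m by (simp add: \<delta>_def unimod_def)
  have shift: "y_shift G (- r0) (- r1) (- r2) = lin_sub F m11 m12 m21 m22"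
    by (simp add: G y_shift_y_shift)
  have "lin_sub (y_shift G (- r0) (- r1) (- r2)) (m22 / \<delta>) (- m12 / \<delta>) (- m21 / \<delta>) (m11 / \<delta>) = lin_sub F 1 0 0 1"
    unfolding shift lin_sub_lin_sub using \<delta>
    by (intro arg_cong4[where f = "lin_sub F"]) (simp_all add: \<delta>_def diff_divide_distrib [symmetric] mult.commute)
  moreover have "int_equiv G (y_shift G (- r0) (- r1) (- r2))"
    by (intro int_equiv_y_shift vge_minus r)
  ultimately show ?thesis
    using int_equiv_trans int_equiv_lin_sub[OF unimod_inverse[OF m \<delta>_def]] by (metis lin_sub_1)
qed

lemma lin_sub_vform_P:
  assumes "unimod m11 m12 m21 m22" "vform_ge v (Pcoeffs F) k"
  shows "vform_ge v (Pcoeffs (lin_sub F m11 m12 m21 m22)) k"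
  using assms unfolding vform_P_iff unimod_def
  by (cases F) (auto simp: lin_sub_def intro!: vge_intros)

lemma lin_sub_vform_Q:
  assumes "unimod m11 m12 m21 m22" "vform_ge v (Qcoeffs F) k"
  shows "vform_ge v (Qcoeffs (lin_sub F m11 m12 m21 m22)) k"
  using assms unfolding vform_Q_iff unimod_def
  by (cases F) (auto simp: lin_sub_def intro!: vge_intros)

lemma y_shift_integral:
  assumes "gbq_integral v F" "vge v r0 0" "vge v r1 0" "vge v r2 0"
  shows "gbq_integral v (y_shift F r0 r1 r2)"
  using assms unfolding gbq_integral_def vform_P_iff vform_Q_iff
  by (cases F) (auto simp: y_shift_def intro!: vge_intros)

lemma int_equiv_integral: "int_equiv F G \<Longrightarrow> gbq_integral v F \<Longrightarrow> gbq_integral v G"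
  unfolding int_equiv_def
  by (auto intro!: y_shift_integral) (simp add: gbq_integral_def lin_sub_vform_P lin_sub_vform_Q)

lemma int_equiv_gen_sub:
  assumes "int_equiv F G"
  obtains m11 m12 m21 m22 r0 r1 r2 where "unimod m11 m12 m21 m22" "gen_sub F G m11 m12 m21 m22 1 r0 r1 r2"
  using assms by (auto simp: int_equiv_def gen_sub_eq)

lemma int_equiv_jac_rel: "int_equiv F G \<Longrightarrow> jac_rel 0 F G"
  using jac_rel_gen_sub by (fastforce elim!: int_equiv_gen_sub simp: unimod_def)

lemma y_sub_iff: "y_sub v F G \<longleftrightarrow> (\<exists>r0 r1 r2. vge v r0 0 \<and> vge v r1 0 \<and> vge v r2 0 \<and> G = y_shift F r0 r1 r2)"
  by (simp add: y_sub_def gen_sub_eq intg_def)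

lemma y_sub_int_equiv: "y_sub v F G \<Longrightarrow> int_equiv F G"
  by (auto simp: y_sub_iff int_equiv_y_shift)

text \<open>Both 2 v(P') >= 1 and 2 v(P') >= 2 mean v(P') >= 1.\<close>

lemma vPQ_ge_iff:
  assumes "k \<in> {1, 2}"
  shows "vPQ_ge v F k \<longleftrightarrow> (\<exists>G. y_sub v F G \<and> vform_ge v (Pcoeffs G) 1 \<and> vform_ge v (Qcoeffs G) k)"
proof -
  have "(c = 0 \<or> k \<le> 2 * v c) = vge v c 1" for c
    using assms by (auto simp: vge_def)
  then show ?thesis by (simp add: vPQ_ge_def vform_ge_def)
qed

text \<open>The witness \<open>G1\<close> leads to F by a linear substitution, which preserves the
  bounds, and an integral shift; undoing only the shift gives a witness for F.\<close>

lemma vPQ_ge_int_equivD: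
  assumes "int_equiv F G" "vPQ_ge v G k" "k \<in> {1, 2}"
  shows "vPQ_ge v F k"
proof -
  obtain G1 where G1: "y_sub v G G1" "vform_ge v (Pcoeffs G1) 1" "vform_ge v (Qcoeffs G1) k"
    using assms(2,3) by (auto simp: vPQ_ge_iff)
  have "int_equiv G1 F"
    using assms(1) G1(1) int_equiv_sym int_equiv_trans y_sub_int_equiv by blast
  then obtain m11 m12 m21 m22 r0 r1 r2 where m: "unimod m11 m12 m21 m22"
      and r: "vge v r0 0" "vge v r1 0" "vge v r2 0"
      and F: "F = y_shift (lin_sub G1 m11 m12 m21 m22) r0 r1 r2"
    by (auto simp: int_equiv_def)
  have "lin_sub G1 m11 m12 m21 m22 = y_shift F (- r0) (- r1) (- r2)"
    by (simp add: F y_shift_y_shift)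
  then have "y_sub v F (lin_sub G1 m11 m12 m21 m22)"
    using r by (auto simp: y_sub_iff intro!: vge_minus)
  with G1 m show ?thesis
    unfolding vPQ_ge_iff[OF assms(3)] by (blast intro: lin_sub_vform_P lin_sub_vform_Q)
qed

lemma vPQ_ge_int_equiv: "int_equiv F G \<Longrightarrow> k \<in> {1, 2} \<Longrightarrow> vPQ_ge v F k \<longleftrightarrow> vPQ_ge v G k"
  using vPQ_ge_int_equivD int_equiv_sym by blast

end

section \<open>Positive level as divisibility in the Jacobian, and its consequences\<close>

text \<open>The situation in which Tate's algorithm finds a non-minimal equation: after an integral
  translation \<pi>^i divides a_i, and the reduction is y^2 = x^3.\<close>

definition cuspidal :: "('a::field \<Rightarrow> int) \<Rightarrow> 'a weier \<Rightarrow> bool" where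
  "cuspidal v W \<longleftrightarrow> (\<exists>r s t. vge v r 0 \<and> vge v s 0 \<and> vge v t 0 \<and>
     vge v (wa1 W + 2 * s) 1 \<and>
     vge v (wa2 W - s * wa1 W + 3 * r - s^2) 2 \<and>
     vge v (wa3 W + r * wa1 W + 2 * t) 3 \<and>
     vge v (wa4 W - s * wa3 W + 2 * r * wa2 W - (t + r * s) * wa1 W + 3 * r^2 - 2 * s * t) 4 \<and>
     vge v (wa6 W + r * wa4 W + r^2 * wa2 W + r^3 - t * wa3 W - t^2 - r * t * wa1 W) 6)"

locale residue_char_two = discretely_valued +
  assumes vge_2: "vge v 2 1"
begin

lemma not_vge_1_1: "\<not> vge v 1 1"
  by (simp add: vge_def)

lemma not_vge_3_1: "\<not> vge v 3 1"
  using vge_diff[of 3 1 2] vge_2 not_vge_1_1 by auto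

lemma vge_4: "vge v 4 2"
  using vge_mult[OF vge_2 vge_2] by simp

text \<open>What needs proof is that r, s, t are integral. First r, from the law for b_8; then s and
  t are roots of monic quadratics with integral coefficients, given by a_2 and a_6.\<close>

lemma cuspidal_of_w_trans:
  assumes tr: "w_trans W u r s t W'" and u: "vge v u 1"
    and W: "w_integral v W" and W': "w_integral v W'"
  shows "cuspidal v W"
proof -
  obtain a1 a2 a3 a4 a6 where W_eq: "W = Weier a1 a2 a3 a4 a6" by (cases W)
  obtain b1 b2 b3 b4 b6 where W'_eq: "W' = Weier b1 b2 b3 b4 b6" by (cases W')
  note 1 = tr[unfolded w_trans_def W_eq W'_eq weier.sel]
  have a: "vge v a1 0" "vge v a2 0" "vge v a3 0" "vge v a4 0" "vge v a6 0"
    and b: "vge v b1 0" "vge v b2 0" "vge v b3 0" "vge v b4 0" "vge v b6 0"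
    using W W' by (simp_all add: w_integral_def intg_def W_eq W'_eq)
  have u0: "vge v u 0" using u vge_mono by fastforce
  define B2 B4 B6 B8 where "B2 = a1^2 + 4 * a2" "B4 = 2 * a4 + a1 * a3" "B6 = a3^2 + 4 * a6"
     "B8 = a1^2 * a6 + 4 * a2 * a6 - a1 * a3 * a4 + a2 * a3^2 - a4^2"
  note B = this
  have B0: "vge v B2 0" "vge v B4 0" "vge v B6 0" "vge v B8 0"
    unfolding B by (intro vge_intros a)+
  define C8 where "C8 = u^8 * (b1^2 * b6 + 4 * b2 * b6 - b1 * b3 * b4 + b2 * b3^2 - b4^2)"
  have C8: "vge v C8 0"
    unfolding C8_def by (intro vge_intros b u0)
  have "C8 = (u * b1)^2 * (u^6 * b6) + 4 * (u^2 * b2) * (u^6 * b6)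
         - (u * b1) * (u^3 * b3) * (u^4 * b4) + (u^2 * b2) * (u^3 * b3)^2 - (u^4 * b4)^2"
    unfolding C8_def by algebra
  also have "\<dots> = B8 + 3 * r * B6 + 3 * r^2 * B4 + r^3 * B2 + 3 * r^4"
    using 1 unfolding B by algebra
  \<comment> \<open>The law for b_8 is used because its leading coefficient 3 is a unit; the law for
    b_6 has leading coefficient 4.\<close>
  finally have eq8: "3 * r^4 = C8 - B8 - r * (3 * B6) - r^2 * (3 * B4) - r^3 * B2" by algebra
  have r: "vge v r 0"
  proof (rule ccontr)
    \<comment> \<open>The right-hand side has valuation at least 3 v r, which exceeds 4 v r for
      negative v r.\<close>
    assume "\<not> vge v r 0"
    then have r: "r \<noteq> 0" "v r < 0" by (auto simp: vge_def)
    then have vr: "vge v r (v r)" "vge v (r^2) (3 * v r)" "vge v (r^3) (3 * v r)"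
      by (auto simp: vge_def v_power)
    have "vge v (3 * r^4) (3 * v r)"
      unfolding eq8 using r vr B0 C8
      by (intro vge_diff)
        (auto intro: vge_mono vge_mult[where j = 0, simplified] intro!: vge_smult vge_numeral
          simp: mult.commute[of r] mult.commute[of "r^_"])
    then have "vge v (r^4) (3 * v r)"
      using vge_mult_unitD not_vge_3_1 by blast
    then show False using r by (auto simp: vge_def v_power)
  qed
  have "vge v (s^2 + a1 * s) (2 * 0)"
  proof -
    have "s^2 + a1 * s = a2 + 3 * r - u^2 * b2" using 1 by algebra
    then show ?thesis by (auto intro!: vge_intros a b u0 r)
  qed
  then have s: "vge v s 0" by (rule vge_quadraticD) (simp_all add: a)
  have "vge v (t^2 + (a3 + r * a1) * t) (2 * 0)"
  proof -
    have "t^2 + (a3 + r * a1) * t = a6 + r * a4 + r^2 * a2 + r^3 - u^6 * b6" using 1 by algebra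
    then show ?thesis by (auto intro!: vge_intros a b u0 r)
  qed
  then have t: "vge v t 0" by (rule vge_quadraticD) (auto intro!: vge_intros a r)
  have pow: "vge v (u^i * x) (int i)" if "vge v x 0" for i x
    using vge_mult[OF vge_power[OF u, of i] that] by simp
  show ?thesis
    unfolding cuspidal_def W_eq weier.sel using 1 r s t pow[OF b(1), of 1] pow[OF b(2), of 2]
      pow[OF b(3), of 3] pow[OF b(4), of 4] pow[OF b(5), of 6]
    by (intro exI[of _ r] exI[of _ s] exI[of _ t]) simp
qed

lemma jac_integral: "gbq_integral v F \<Longrightarrow> w_integral v (jac F)"
  unfolding gbq_integral_def vform_P_iff vform_Q_iff
  by (cases F) (auto simp: jac_def w_integral_def intg_def intro!: vge_intros)

text \<open>Comparing discriminants with the minimal equation gives 12 v u = 12 lev, so v u >=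
  1.\<close>

lemma cuspidal_jac:
  assumes "has_level v F lev" "lev > 0" "gbq_integral v F" "gbq_disc F \<noteq> 0"
  shows "cuspidal v (jac F)"
proof -
  obtain W where W: "w_integral v W" "w_iso (jac F) W" "v (gbq_disc F) = v (w_disc W) + 12 * lev"
    using assms(1) by (auto simp: has_level_def)
  then obtain u r s t where u: "u \<noteq> 0" "w_trans (jac F) u r s t W"
    by (auto simp: w_iso_iff)
  from w_disc_trans[OF u(2)] have eq: "u^12 * w_disc W = gbq_disc F"
    by (simp add: w_disc_jac)
  then have "w_disc W \<noteq> 0" using assms(4) by auto
  then have "12 * v u + v (w_disc W) = v (gbq_disc F)"
    using u(1) by (simp add: v_mult v_power flip: eq)
  then have "vge v u 1" using W(3) assms(2) by (simp add: vge_def)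
  then show ?thesis
    using cuspidal_of_w_trans u(2) jac_integral[OF assms(3)] W(1) by blast
qed

lemma cuspidal_jac_m:
  assumes "cuspidal v (jac F)" "gbq_integral v F"
  shows "vge v (cm F) 1"
proof -
  obtain s where "vge v (wa1 (jac F) + 2 * s) 1" "vge v s 0"
    using assms(1) by (auto simp: cuspidal_def)
  moreover have "wa1 (jac F) = cm F" by (cases F) (simp add: jac_def)
  ultimately show ?thesis
    using vge_cancel_left[of "2 * s" "cm F" 1] vge_mult[OF vge_2, of s 0] by (simp add: add.commute)
qed

text \<open>The case v(P) = 0 with the root at (0 : 1). Modulo \<pi>, a_3 gives d = 0, then a_4
  gives r = 0, a_2 gives c = s^2 and a_6 gives t = 0. The bound on e comes from a_6 and a_4 modulo
  \<pi>^2.\<close>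

lemma cuspidal_P_unit:
  assumes cusp: "cuspidal v (jac (GBQ l m n a b c d e))" and int: "gbq_integral v (GBQ l m n a b c d e)"
    and l: "\<not> vge v l 1" and n: "vge v n 1" and e: "vge v e 1"
  shows "vge v d 1 \<and> vge v e 2"
proof -
  have m: "vge v m 1" using cuspidal_jac_m[OF cusp int] by simp
  have i: "vge v l 0" "vge v a 0" "vge v b 0" "vge v c 0" "vge v d 0"
    using int by (auto simp: gbq_integral_def vform_P_iff vform_Q_iff)
  obtain r s t where i': "vge v r 0" "vge v s 0" "vge v t 0"
    and A2: "vge v (c - l * n - s * m + 3 * r - s^2) 2"
    and A3: "vge v (l * d + n * b + r * m + 2 * t) 3"
    and A4: "vge v ((b * d - 4 * a * e - l^2 * e - l * n * c - n^2 * a) - s * (l * d + n * b)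
        + 2 * r * (c - l * n) - (t + r * s) * m + 3 * r^2 - 2 * s * t) 4"
    and A6: "vge v ((a * d^2 + b^2 * e - 4 * a * c * e - l^2 * c * e + l * m * b * e - l * n * b * d
        - m^2 * a * e + m * n * a * d - n^2 * a * c)
        + r * (b * d - 4 * a * e - l^2 * e - l * n * c - n^2 * a)
        + r^2 * (c - l * n) + r^3 - t * (l * d + n * b) - t^2 - r * t * m) 6"
    using cusp by (auto simp: cuspidal_def jac_def)
  note h = vge_2 vge_4 m n e
  have "vge v (l * d) 1"
  proof (rule vge_cancel_left)
    show "vge v ((n * b + r * m + 2 * t) + l * d) 1"
      using vge_mono[OF A3, of 1] by (simp add: algebra_simps)
    show "vge v (n * b + r * m + 2 * t) 1"
      by (rule vge_mono) ((rule h i i' vge_lower_bound)+, simp)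
  qed
  then have d: "vge v d 1" using l vge_mult_unitD by blast
  have "vge v (3 * r^2) 1"
  proof (rule vge_cancel_left)
    let ?x = "(b * d - 4 * a * e - l^2 * e - l * n * c - n^2 * a) - s * (l * d + n * b)
        + 2 * r * (c - l * n) - (t + r * s) * m - 2 * s * t"
    show "vge v (?x + 3 * r^2) 1"
      using vge_mono[OF A4, of 1] by (simp add: algebra_simps)
    show "vge v ?x 1"
      by (rule vge_mono) ((rule d h i i' vge_lower_bound)+, simp)
  qed
  then have r: "vge v r 1" using vge_mult_unitD[OF _ not_vge_3_1] vge_power2D[of r 1] by simp
  have cs: "vge v (c - s^2) 1"
  proof (rule vge_cancel_left)
    show "vge v ((- l * n - s * m + 3 * r) + (c - s^2)) 1"
      using vge_mono[OF A2, of 1] by (simp add: algebra_simps)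
    show "vge v (- l * n - s * m + 3 * r) 1"
      by (rule vge_mono) ((rule d r h i i' vge_lower_bound)+, simp)
  qed
  have "vge v (- (t^2)) 1"
  proof (rule vge_cancel_left)
    let ?x = "(a * d^2 + b^2 * e - 4 * a * c * e - l^2 * c * e + l * m * b * e - l * n * b * d
        - m^2 * a * e + m * n * a * d - n^2 * a * c)
        + r * (b * d - 4 * a * e - l^2 * e - l * n * c - n^2 * a)
        + r^2 * (c - l * n) + r^3 - t * (l * d + n * b) - r * t * m"
    show "vge v (?x + - (t^2)) 1"
      using vge_mono[OF A6, of 1] by (simp add: algebra_simps)
    show "vge v ?x 1"
      by (rule vge_mono) ((rule d r h i i' vge_lower_bound)+, simp)
  qed
  then have t: "vge v t 1" using vge_power2D[of t 1] vge_minus by fastforce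
  have "vge v (e * (b^2 - l^2 * c)) 2"
  proof (rule vge_cancel_left)
    let ?x = "(a * d^2 - 4 * a * c * e + l * m * b * e - l * n * b * d
        - m^2 * a * e + m * n * a * d - n^2 * a * c)
        + r * (b * d - 4 * a * e - l^2 * e - l * n * c - n^2 * a)
        + r^2 * (c - l * n) + r^3 - t * (l * d + n * b) - t^2 - r * t * m"
    show "vge v (?x + e * (b^2 - l^2 * c)) 2"
      using vge_mono[OF A6, of 2] by (simp add: algebra_simps)
    show "vge v ?x 2"
      by (rule vge_mono) ((rule d r t h i i' vge_lower_bound)+, simp)
  qed
  \<comment> \<open>In the second alternative c = s^2 modulo \<pi> turns b^2 - l^2 c into (b - l
    s)^2, so b = l s modulo \<pi>; then every term of the a_4 condition other than l^2 e lies in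
    \<pi>^2.\<close>
  then consider "vge v e 2" | "vge v (b^2 - l^2 * c) 1"
    using vge_multD[of e "b^2 - l^2 * c" 2 1] by auto
  then have "vge v e 2"
  proof cases
    case 2
    have "vge v ((b - l * s)^2) 1"
    proof -
      have "(b - l * s)^2 = (b^2 - l^2 * c) + l^2 * (c - s^2) - 2 * (l * s * (b - l * s))" by algebra
      moreover have "vge v \<dots> 1"
        by (rule vge_mono) ((rule 2 cs h i i' vge_lower_bound)+, simp)
      ultimately show ?thesis by simp
    qed
    then have bs: "vge v (b - l * s) 1" using vge_power2D[of _ 1] by simp
    have "vge v (- (l^2 * e)) 2"
    proof (rule vge_cancel_left)
      let ?x = "d * (b - l * s) - n * (l * (c - s^2) + s * (b - l * s) + 2 * l * s^2) - 4 * a * e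
          - n^2 * a + 2 * r * (c - l * n) - (t + r * s) * m + 3 * r^2 - 2 * s * t"
      have eq: "?x + - (l^2 * e) = (b * d - 4 * a * e - l^2 * e - l * n * c - n^2 * a) - s * (l * d + n * b)
        + 2 * r * (c - l * n) - (t + r * s) * m + 3 * r^2 - 2 * s * t" by algebra
      show "vge v (?x + - (l^2 * e)) 2" unfolding eq using A4 by (rule vge_mono) simp
      show "vge v ?x 2"
        by (rule vge_mono) ((rule bs cs d r t h i i' vge_lower_bound)+, simp)
    qed
    then have "vge v (l^2 * e) 2" using vge_minus by fastforce
    moreover have "\<not> vge v (l^2) 1" using l vge_power2D[of l 1] by auto
    ultimately show ?thesis using vge_mult_unitD by blast
  qed
  with d show ?thesis by simp
qed

text \<open>The case v(P) >= 1, v(P,Q) = 0 with the root at (0 : 1). Modulo \<pi>, a_4 gives r = 0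
  and a_6 gives t = 0; modulo \<pi>^2, a_6 reduces to b^2 e with b a unit.\<close>

lemma cuspidal_P_even:
  assumes cusp: "cuspidal v (jac (GBQ l m n a b c d e))" and int: "gbq_integral v (GBQ l m n a b c d e)"
    and l: "vge v l 1" and m: "vge v m 1" and n: "vge v n 1"
    and b: "\<not> vge v b 1" and d: "vge v d 1" and e: "vge v e 1"
  shows "vge v e 2"
proof -
  have i: "vge v a 0" "vge v b 0" "vge v c 0"
    using int by (auto simp: gbq_integral_def vform_P_iff vform_Q_iff)
  obtain r s t where i': "vge v r 0" "vge v s 0" "vge v t 0"
    and A4: "vge v ((b * d - 4 * a * e - l^2 * e - l * n * c - n^2 * a) - s * (l * d + n * b)
        + 2 * r * (c - l * n) - (t + r * s) * m + 3 * r^2 - 2 * s * t) 4"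
    and A6: "vge v ((a * d^2 + b^2 * e - 4 * a * c * e - l^2 * c * e + l * m * b * e - l * n * b * d
        - m^2 * a * e + m * n * a * d - n^2 * a * c)
        + r * (b * d - 4 * a * e - l^2 * e - l * n * c - n^2 * a)
        + r^2 * (c - l * n) + r^3 - t * (l * d + n * b) - t^2 - r * t * m) 6"
    using cusp by (auto simp: cuspidal_def jac_def)
  note h = vge_2 vge_4 l m n d e i i'
  have "vge v (3 * r^2) 1"
  proof (rule vge_cancel_left)
    let ?x = "(b * d - 4 * a * e - l^2 * e - l * n * c - n^2 * a) - s * (l * d + n * b)
        + 2 * r * (c - l * n) - (t + r * s) * m - 2 * s * t"
    show "vge v (?x + 3 * r^2) 1"
      using vge_mono[OF A4, of 1] by (simp add: algebra_simps)
    show "vge v ?x 1"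
      by (rule vge_mono) ((rule h vge_lower_bound)+, simp)
  qed
  then have r: "vge v r 1" using vge_mult_unitD[OF _ not_vge_3_1] vge_power2D[of r 1] by simp
  have "vge v (- (t^2)) 1"
  proof (rule vge_cancel_left)
    let ?x = "(a * d^2 + b^2 * e - 4 * a * c * e - l^2 * c * e + l * m * b * e - l * n * b * d
        - m^2 * a * e + m * n * a * d - n^2 * a * c)
        + r * (b * d - 4 * a * e - l^2 * e - l * n * c - n^2 * a)
        + r^2 * (c - l * n) + r^3 - t * (l * d + n * b) - r * t * m"
    show "vge v (?x + - (t^2)) 1"
      using vge_mono[OF A6, of 1] by (simp add: algebra_simps)
    show "vge v ?x 1"
      by (rule vge_mono) ((rule r h vge_lower_bound)+, simp)
  qed
  then have t: "vge v t 1" using vge_power2D[of t 1] vge_minus by fastforce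
  have "vge v (b^2 * e) 2"
  proof (rule vge_cancel_left)
    let ?x = "(a * d^2 - 4 * a * c * e - l^2 * c * e + l * m * b * e - l * n * b * d
        - m^2 * a * e + m * n * a * d - n^2 * a * c)
        + r * (b * d - 4 * a * e - l^2 * e - l * n * c - n^2 * a)
        + r^2 * (c - l * n) + r^3 - t * (l * d + n * b) - t^2 - r * t * m"
    show "vge v (?x + b^2 * e) 2"
      using vge_mono[OF A6, of 2] by (simp add: algebra_simps)
    show "vge v ?x 2"
      by (rule vge_mono) ((rule r t h vge_lower_bound)+, simp)
  qed
  moreover have "\<not> vge v (b^2) 1" using b vge_power2D[of b 1] by auto
  ultimately show ?thesis using vge_mult_unitD by blast
qed

text \<open>Since \<pi> divides P and Q, c agrees with r modulo \<pi>^2; substituting c for r in the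
  conditions for a_4 and a_6 leaves these two expressions. Signs may be changed at will, since 2 is
  divisible by \<pi>.\<close>

lemma cuspidal_Q_even:
  assumes cusp: "cuspidal v (jac (GBQ l m n a b c d e))"
    and l: "vge v l 1" "vge v m 1" "vge v n 1"
    and a: "vge v a 1" "vge v b 1" "vge v c 1" "vge v d 1" "vge v e 1"
  shows "vge v (c^2 + b * d) 3" "vge v (a * d^2 + b^2 * e + b * c * d) 4"
proof -
  obtain r s t where i': "vge v r 0" "vge v s 0" "vge v t 0"
    and A2: "vge v (c - l * n - s * m + 3 * r - s^2) 2"
    and A3: "vge v (l * d + n * b + r * m + 2 * t) 3"
    and A4: "vge v ((b * d - 4 * a * e - l^2 * e - l * n * c - n^2 * a) - s * (l * d + n * b)
        + 2 * r * (c - l * n) - (t + r * s) * m + 3 * r^2 - 2 * s * t) 4"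
    and A6: "vge v ((a * d^2 + b^2 * e - 4 * a * c * e - l^2 * c * e + l * m * b * e - l * n * b * d
        - m^2 * a * e + m * n * a * d - n^2 * a * c)
        + r * (b * d - 4 * a * e - l^2 * e - l * n * c - n^2 * a)
        + r^2 * (c - l * n) + r^3 - t * (l * d + n * b) - t^2 - r * t * m) 6"
    using cusp by (auto simp: cuspidal_def jac_def)
  note h = vge_2 vge_4 l a i'
  have "vge v (3 * r^2) 1"
  proof (rule vge_cancel_left)
    let ?x = "(b * d - 4 * a * e - l^2 * e - l * n * c - n^2 * a) - s * (l * d + n * b)
        + 2 * r * (c - l * n) - (t + r * s) * m - 2 * s * t"
    show "vge v (?x + 3 * r^2) 1"
      using vge_mono[OF A4, of 1] by (simp add: algebra_simps)
    show "vge v ?x 1"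
      by (rule vge_mono) ((rule h vge_lower_bound)+, simp)
  qed
  then have r: "vge v r 1" using vge_mult_unitD[OF _ not_vge_3_1] vge_power2D[of r 1] by simp
  have "vge v (- (s^2)) 1"
  proof (rule vge_cancel_left)
    show "vge v ((c - l * n - s * m + 3 * r) + - (s^2)) 1"
      using vge_mono[OF A2, of 1] by (simp add: algebra_simps)
    show "vge v (c - l * n - s * m + 3 * r) 1"
      by (rule vge_mono) ((rule r h vge_lower_bound)+, simp)
  qed
  then have s: "vge v s 1" using vge_power2D[of s 1] vge_minus by fastforce
  \<comment> \<open>Bootstrap: the a_6 condition modulo \<pi> gives that \<pi> divides t; with this
    it gives t^2 modulo \<pi>^3, and by parity \<pi>^2 divides t.\<close>
  have "vge v (- (t^2)) 3" if t: "vge v t 1"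
  proof (rule vge_cancel_left)
    let ?x = "(a * d^2 + b^2 * e - 4 * a * c * e - l^2 * c * e + l * m * b * e - l * n * b * d
        - m^2 * a * e + m * n * a * d - n^2 * a * c)
        + r * (b * d - 4 * a * e - l^2 * e - l * n * c - n^2 * a)
        + r^2 * (c - l * n) + r^3 - t * (l * d + n * b) - r * t * m"
    show "vge v (?x + - (t^2)) 3"
      using vge_mono[OF A6, of 3] by (simp add: algebra_simps)
    show "vge v ?x 3"
      by (rule vge_mono) ((rule t r h vge_lower_bound)+, simp)
  qed
  moreover have "vge v (- (t^2)) 1"
  proof (rule vge_cancel_left)
    let ?x = "(a * d^2 + b^2 * e - 4 * a * c * e - l^2 * c * e + l * m * b * e - l * n * b * d
        - m^2 * a * e + m * n * a * d - n^2 * a * c)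
        + r * (b * d - 4 * a * e - l^2 * e - l * n * c - n^2 * a)
        + r^2 * (c - l * n) + r^3 - t * (l * d + n * b) - r * t * m"
    show "vge v (?x + - (t^2)) 1"
      using vge_mono[OF A6, of 1] by (simp add: algebra_simps)
    show "vge v ?x 1"
      by (rule vge_mono) ((rule r h vge_lower_bound)+, simp)
  qed
  ultimately have t: "vge v t 2"
    using vge_power2D[of t 1] vge_power2D[of t 2] vge_minus by fastforce
  have cr: "vge v (c - r) 2"
  proof (rule vge_cancel_left)
    show "vge v ((4 * r - l * n - s * m - s^2) + (c - r)) 2"
      using A2 by (simp add: algebra_simps)
    show "vge v (4 * r - l * n - s * m - s^2) 2"
      by (rule vge_mono) ((rule r s h vge_lower_bound)+, simp)
  qed
  show bd: "vge v (c^2 + b * d) 3"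
  proof (rule vge_cancel_left)
    let ?x = "- 4 * a * e - l^2 * e - l * n * c - n^2 * a - s * (l * d + n * b)
        + 2 * r * (c - l * n) - (t + r * s) * m + 2 * r^2 - 2 * s * t - (c - r) * (c + r)"
    have eq: "?x + (c^2 + b * d) = (b * d - 4 * a * e - l^2 * e - l * n * c - n^2 * a) - s * (l * d + n * b)
        + 2 * r * (c - l * n) - (t + r * s) * m + 3 * r^2 - 2 * s * t" by algebra
    show "vge v (?x + (c^2 + b * d)) 3" unfolding eq using A4 by (rule vge_mono) simp
    show "vge v ?x 3"
      by (rule vge_mono) ((rule cr r s t h vge_lower_bound)+, simp)
  qed
  show "vge v (a * d^2 + b^2 * e + b * c * d) 4"
  proof (rule vge_cancel_left)
    let ?x = "- 4 * a * c * e - l^2 * c * e + l * m * b * e - l * n * b * d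
        - m^2 * a * e + m * n * a * d - n^2 * a * c
        - (c - r) * b * d + r * (- 4 * a * e - l^2 * e - l * n * c - n^2 * a)
        - r^2 * (l * n) + 2 * r^3 + r^2 * (c - r) - t * (l * d + n * b) - t^2 - r * t * m"
    have eq: "?x + (a * d^2 + b^2 * e + b * c * d) = (a * d^2 + b^2 * e - 4 * a * c * e - l^2 * c * e + l * m * b * e - l * n * b * d
        - m^2 * a * e + m * n * a * d - n^2 * a * c)
        + r * (b * d - 4 * a * e - l^2 * e - l * n * c - n^2 * a)
        + r^2 * (c - l * n) + r^3 - t * (l * d + n * b) - t^2 - r * t * m" by algebra
    show "vge v (?x + (a * d^2 + b^2 * e + b * c * d)) 4" unfolding eq using A6 by (rule vge_mono) simp
    show "vge v ?x 4"
      by (rule vge_mono) ((rule cr r s t h vge_lower_bound)+, simp)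
  qed
qed

end

section \<open>Repeated roots over a field of characteristic two\<close>

text \<open>Over a finite field, one plus the product of all X - a has no root.\<close>

lemma infinite_alg_closed: "infinite (UNIV :: 'b::alg_closed_field set)"
proof
  assume fin: "finite (UNIV :: 'b set)"
  define q where "q = (\<Prod>a\<in>(UNIV :: 'b set). [:-a, 1:])"
  have q0: "poly q x = 0" for x
    unfolding q_def poly_prod using fin by (auto simp: prod_zero_iff)
  have "q \<noteq> 0" using fin by (simp add: q_def)
  have "degree (q + 1) > 0"
  proof (rule ccontr)
    assume "\<not> degree (q + 1) > 0"
    then obtain c where "q + 1 = [:c:]" by (auto elim: degree_eq_zeroE)
    then have "q = [:c - 1:]" by (metis add_diff_cancel_right' diff_pCons diff_zero one_pCons)
    with q0[of 0] \<open>q \<noteq> 0\<close> show False by auto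
  qed
  then obtain x where "poly (q + 1) x = 0" using alg_closed_imp_poly_has_root by blast
  then show False by (simp add: q0)
qed

context
  assumes two: "(2 :: 'b::alg_closed_field) = 0"
begin

lemma char2_add_self: "x + x = (0 :: 'b)"
  using two by (metis mult_2 mult_zero_left)

lemma char2_minus: "- x = (x :: 'b)"
  using char2_add_self by (simp add: minus_unique)

lemma char2_square_inj: "x^2 = y^2 \<Longrightarrow> x = (y :: 'b)"
  by (metis char2_minus power2_eq_iff)

text \<open>In characteristic two (Z x - X z)^2 = Z^2 x^2 + X^2 z^2 has no mixed term, so the
  condition is proportionality of coefficients.\<close>

lemma rep_root_quadratic_iff:
  "rep_root [p, q, r :: 'b] X Z \<longleftrightarrow> (X, Z) \<noteq> (0, 0) \<and> q = 0 \<and> p * X^2 = r * Z^2"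
proof -
  have "rep_root [p, q, r] X Z \<longleftrightarrow> (X, Z) \<noteq> (0, 0) \<and>
      (\<exists>g. \<forall>x z. p * x^2 + q * x * z + r * z^2 = (Z^2 * g) * x^2 + 0 * x * z + (X^2 * g) * z^2)"
  proof -
    have "(Z * x - X * z)^2 * g = (Z^2 * g) * x^2 + 0 * x * z + (X^2 * g) * z^2 - 2 * (Z * X * x * z * g)" for x z g
      by algebra
    then have "(Z * x - X * z)^2 * g = (Z^2 * g) * x^2 + 0 * x * z + (X^2 * g) * z^2" for x z g
      by (simp add: two)
    moreover have "(\<exists>g. length g + 2 = length [p, q, r] \<and> Q g) \<longleftrightarrow> (\<exists>g. Q [g])" for Q :: "'b list \<Rightarrow> bool"
      by (auto simp: length_Suc_conv)
    moreover have "form_eval [g] x z = g" for g x z :: 'b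
      by (simp add: form_eval_def)
    moreover have "form_eval [p, q, r] x z = p * x^2 + q * x * z + r * z^2" for x z :: 'b
      by (simp add: form_eval_def eval_nat_numeral)
    ultimately show ?thesis
      unfolding rep_root_def by simp
  qed
  also have "\<dots> \<longleftrightarrow> (X, Z) \<noteq> (0, 0) \<and> (\<exists>g. p = Z^2 * g \<and> q = 0 \<and> r = X^2 * g)"
    using binary_quadratic_eqD[OF infinite_alg_closed, of p q r] by blast
  also have "\<dots> \<longleftrightarrow> (X, Z) \<noteq> (0, 0) \<and> q = 0 \<and> p * X^2 = r * Z^2"
  proof (intro conj_cong refl iffI)
    assume nz: "(X, Z) \<noteq> (0, 0)" and "q = 0 \<and> p * X^2 = r * Z^2"
    then have q: "q = 0" and eq: "p * X^2 = r * Z^2" by auto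
    show "\<exists>g. p = Z^2 * g \<and> q = 0 \<and> r = X^2 * g"
    proof (cases "Z = 0")
      case True
      then have "X \<noteq> 0" using nz by simp
      with True eq q show ?thesis by (intro exI[of _ "r / X^2"]) auto
    next
      case False
      with eq q show ?thesis by (intro exI[of _ "p / Z^2"]) (simp add: field_simps)
    qed
  qed auto
  finally show ?thesis .
qed

text \<open>The divisor Z^2 x^2 + X^2 z^2 is a form in x^2, z^2, so the odd part x z (b x^2 + d z^2)
  and the even part of the quartic must each be divisible by it, that is, vanish at (X^2 : Z^2) as
  forms in x^2, z^2.\<close>

lemma rep_root_quartic_iff:
  "rep_root [a, b, c, d, e :: 'b] X Z \<longleftrightarrow> (X, Z) \<noteq> (0, 0) \<and> b * X^2 = d * Z^2 \<and>
     a * X^4 + c * X^2 * Z^2 + e * Z^4 = 0"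
proof -
  have "rep_root [a, b, c, d, e] X Z \<longleftrightarrow> (X, Z) \<noteq> (0, 0) \<and>
      (\<exists>g0 g1 g2. \<forall>x z. a * x^4 + b * x^3 * z + c * x^2 * z^2 + d * x * z^3 + e * z^4 =
         (Z^2 * g0) * x^4 + (Z^2 * g1) * x^3 * z + (Z^2 * g2 + X^2 * g0) * x^2 * z^2
         + (X^2 * g1) * x * z^3 + (X^2 * g2) * z^4)"
  proof -
    have "(Z * x - X * z)^2 * (g0 * x^2 + g1 * x * z + g2 * z^2)
       = (Z^2 * g0) * x^4 + (Z^2 * g1) * x^3 * z + (Z^2 * g2 + X^2 * g0) * x^2 * z^2
         + (X^2 * g1) * x * z^3 + (X^2 * g2) * z^4
         - 2 * (Z * X * x * z * (g0 * x^2 + g1 * x * z + g2 * z^2))" for x z g0 g1 g2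
      by algebra
    then have "(Z * x - X * z)^2 * (g0 * x^2 + g1 * x * z + g2 * z^2)
       = (Z^2 * g0) * x^4 + (Z^2 * g1) * x^3 * z + (Z^2 * g2 + X^2 * g0) * x^2 * z^2
         + (X^2 * g1) * x * z^3 + (X^2 * g2) * z^4" for x z g0 g1 g2
      by (simp add: two)
    moreover have "form_eval [g0, g1, g2] x z = g0 * x^2 + g1 * x * z + g2 * z^2"
      for g0 g1 g2 x z :: 'b
      by (simp add: form_eval_def eval_nat_numeral)
    moreover have "form_eval [a, b, c, d, e] x z = a * x^4 + b * x^3 * z + c * x^2 * z^2 + d * x * z^3 + e * z^4"
      for x z :: 'b
      by (simp add: form_eval_def eval_nat_numeral)
    moreover have "(\<exists>g. length g + 2 = length [a, b, c, d, e] \<and> Q g) \<longleftrightarrow> (\<exists>g0 g1 g2. Q [g0, g1, g2])"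
      for Q :: "'b list \<Rightarrow> bool"
    proof
      assume "\<exists>g. length g + 2 = length [a, b, c, d, e] \<and> Q g"
      then show "\<exists>g0 g1 g2. Q [g0, g1, g2]"
        by (auto simp: length_Suc_conv eval_nat_numeral)
    next
      assume "\<exists>g0 g1 g2. Q [g0, g1, g2]"
      then obtain g0 g1 g2 where "Q [g0, g1, g2]" by blast
      then show "\<exists>g. length g + 2 = length [a, b, c, d, e] \<and> Q g"
        by (intro exI[of _ "[g0, g1, g2]"]) simp
    qed
    ultimately show ?thesis
      unfolding rep_root_def by simp
  qed
  also have "\<dots> \<longleftrightarrow> (X, Z) \<noteq> (0, 0) \<and> (\<exists>g0 g1 g2. a = Z^2 * g0 \<and> b = Z^2 * g1 \<and>
      c = Z^2 * g2 + X^2 * g0 \<and> d = X^2 * g1 \<and> e = X^2 * g2)"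
    using binary_quartic_eqD[OF infinite_alg_closed, of a b c d e] by (intro conj_cong refl ex_cong1) blast
  also have "\<dots> \<longleftrightarrow> (X, Z) \<noteq> (0, 0) \<and> b * X^2 = d * Z^2 \<and> a * X^4 + c * X^2 * Z^2 + e * Z^4 = 0"
  proof (intro conj_cong refl iffI)
    assume "\<exists>g0 g1 g2. a = Z^2 * g0 \<and> b = Z^2 * g1 \<and> c = Z^2 * g2 + X^2 * g0 \<and> d = X^2 * g1 \<and> e = X^2 * g2"
    then obtain g0 g1 g2 where g: "a = Z^2 * g0" "b = Z^2 * g1" "c = Z^2 * g2 + X^2 * g0" "d = X^2 * g1" "e = X^2 * g2"
      by blast
    show "b * X^2 = d * Z^2 \<and> a * X^4 + c * X^2 * Z^2 + e * Z^4 = 0"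
    proof
      show "b * X^2 = d * Z^2" unfolding g by algebra
      have "a * X^4 + c * X^2 * Z^2 + e * Z^4 = 2 * (Z^2 * g0 * X^4 + X^2 * g2 * Z^4)"
        unfolding g by algebra
      then show "a * X^4 + c * X^2 * Z^2 + e * Z^4 = 0" by (simp add: two)
    qed
  next
    assume nz: "(X, Z) \<noteq> (0, 0)" and "b * X^2 = d * Z^2 \<and> a * X^4 + c * X^2 * Z^2 + e * Z^4 = 0"
    then have eq: "b * X^2 = d * Z^2" "a * X^4 + c * X^2 * Z^2 + e * Z^4 = 0" by auto
    show "\<exists>g0 g1 g2. a = Z^2 * g0 \<and> b = Z^2 * g1 \<and> c = Z^2 * g2 + X^2 * g0 \<and> d = X^2 * g1 \<and> e = X^2 * g2"
    proof (cases "Z = 0")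
      case True
      then have "X \<noteq> 0" using nz by simp
      with True eq show ?thesis by (intro exI[of _ "c / X^2"] exI[of _ "d / X^2"] exI[of _ "e / X^2"]) auto
    next
      case False
      \<comment> \<open>The coefficients of the quotient come from a, b and c in turn; the equation
        for e then holds up to an even term.\<close>
      define w where "w = 1 / Z^2"
      have w: "Z^2 * w = 1" using False by (simp add: w_def)
      show ?thesis
      proof (intro exI conjI)
        show "a = Z^2 * (a * w)" "b = Z^2 * (b * w)" "d = X^2 * (b * w)"
          "c = Z^2 * ((c - X^2 * (a * w)) * w) + X^2 * (a * w)"
          using w eq(1) by algebra+
        have "X^2 * ((c - X^2 * (a * w)) * w) = e + 2 * (c * X^2 * w)"
          using w eq(2) by algebra
        then show "e = X^2 * ((c - X^2 * (a * w)) * w)" by (simp add: two)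
      qed
    qed
  qed
  finally show ?thesis .
qed

end

lemma proportional:
  fixes x0 z0 :: "'b::field"
  assumes "(x0, z0) \<noteq> (0, 0)" "z0 * X = x0 * Z"
  shows "\<exists>t. X = t * x0 \<and> Z = t * z0"
proof (cases "x0 = 0")
  case True
  then show ?thesis using assms by (intro exI[of _ "Z / z0"]) auto
next
  case False
  then show ?thesis using assms by (intro exI[of _ "X / x0"]) (auto simp: field_simps)
qed

section \<open>Effect on d and e of the substitution that moves the root\<close>

context residue_char_two
begin

text \<open>Modulo 2 the mixed derivative of Q is b x^2 + d z^2. The substitution evaluates it at
  (m21, m22) and multiplies it by the determinant, and this is the new d up to an even term.\<close>

lemma lin_sub_d_ge:
  assumes "unimod m11 m12 m21 m22" "vform_ge v (Qcoeffs F) k"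
    and "vge v (m21^2 * cb F + m22^2 * cd F) (k + 1)"
  shows "vge v (cd (lin_sub F m11 m12 m21 m22)) (k + 1)"
proof -
  have m: "vge v m11 0" "vge v m12 0" "vge v m21 0" "vge v m22 0"
    using assms(1) by (auto simp: unimod_def)
  have q: "vge v (ca F) k" "vge v (cb F) k" "vge v (cc F) k" "vge v (cd F) k" "vge v (ce F) k"
    using assms(2) by (auto simp: vform_Q_iff)
  let ?x = "2 * m11 * m21^3 * ca F + (m11 * m21^2 * m22 + m12 * m21^3) * cb F
      + m21 * m22 * (m11 * m22 + m12 * m21) * cc F + 2 * m12 * m21 * m22^2 * cd F + 2 * m12 * m22^3 * ce F"
  have "cd (lin_sub F m11 m12 m21 m22) = (m11 * m22 - m12 * m21) * (m21^2 * cb F + m22^2 * cd F) + 2 * ?x"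
  proof -
    obtain l m n a b c d e where F: "F = GBQ l m n a b c d e" by (cases F)
    show ?thesis unfolding F lin_sub_def gbq.case gbq.sel by algebra
  qed
  moreover have "vge v (2 * ?x) (1 + k)"
    by (rule vge_mult[OF vge_2]) (intro vge_intros m q)
  moreover have "vge v ((m11 * m22 - m12 * m21) * (m21^2 * cb F + m22^2 * cd F)) (k + 1)"
    by (rule vge_smult[OF _ assms(3)]) (intro vge_intros m)
  ultimately show ?thesis by (simp add: vge_add add.commute)
qed

lemma lin_sub_e_ge:
  assumes "unimod m11 m12 m21 m22"
    and bd: "vge v (m21^2 * cb F + m22^2 * cd F) k"
    and ace: "vge v (m21^4 * ca F + m21^2 * m22^2 * cc F + m22^4 * ce F) k"
  shows "vge v (ce (lin_sub F m11 m12 m21 m22)) k"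
proof -
  have m: "vge v m11 0" "vge v m12 0" "vge v m21 0" "vge v m22 0"
    using assms(1) by (auto simp: unimod_def)
  have "ce (lin_sub F m11 m12 m21 m22) = (m21^4 * ca F + m21^2 * m22^2 * cc F + m22^4 * ce F)
     + m21 * m22 * (m21^2 * cb F + m22^2 * cd F)"
  proof -
    obtain l m n a b c d e where F: "F = GBQ l m n a b c d e" by (cases F)
    show ?thesis unfolding F lin_sub_def gbq.case gbq.sel by algebra
  qed
  then show ?thesis using ace bd m by (simp add: vge_intros)
qed

lemma vform_P_int_equiv:
  assumes "int_equiv F G" "vform_ge v (Pcoeffs F) 1"
  shows "vform_ge v (Pcoeffs G) 1"
proof -
  obtain m11 m12 m21 m22 r0 r1 r2 where m: "unimod m11 m12 m21 m22"
      and r: "vge v r0 0" "vge v r1 0" "vge v r2 0"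
      and G: "G = y_shift (lin_sub F m11 m12 m21 m22) r0 r1 r2"
    using assms(1) by (auto simp: int_equiv_def)
  have "vge v (2 * x) 1" if "vge v x 0" for x
    using vge_mult[OF vge_2 that] by simp
  with lin_sub_vform_P[OF m assms(2)] r show ?thesis
    unfolding G vform_P_iff by (cases "lin_sub F m11 m12 m21 m22") (auto simp: y_shift_def intro!: vge_add)
qed

text \<open>A y-shift changes P by an even form only.\<close>

lemma vPQ_ge_1_P: "vPQ_ge v F 1 \<Longrightarrow> vform_ge v (Pcoeffs F) 1"
  using vPQ_ge_iff[of 1 F] vform_P_int_equiv int_equiv_sym y_sub_int_equiv by blast

end

section \<open>Existence and rationality of the repeated root\<close>

locale dyadic_field = residue_char_two v
  for v :: "'a::field \<Rightarrow> int" +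
  fixes \<pi> :: 'a and red :: "'a \<Rightarrow> 'b::alg_closed_field"
  assumes \<pi>_nz: "\<pi> \<noteq> 0" and v_\<pi>: "v \<pi> = 1"
    and perfect: "residue_perfect v" and resmap: "residue_map v red"
begin

lemma red_add: "vge v x 0 \<Longrightarrow> vge v y 0 \<Longrightarrow> red (x + y) = red x + red y"
  and red_mult: "vge v x 0 \<Longrightarrow> vge v y 0 \<Longrightarrow> red (x * y) = red x * red y"
  and red_1: "red 1 = 1"
  and red_eq_0_iff: "vge v x 0 \<Longrightarrow> red x = 0 \<longleftrightarrow> vge v x 1"
  using resmap by (auto simp: residue_map_def intg_def)

lemma red_power: "vge v x 0 \<Longrightarrow> red (x ^ n) = red x ^ n"
  by (induction n) (simp_all add: red_1 red_mult vge_power_0)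

lemmas red_simps = red_add red_mult red_power

lemma red_two: "(2 :: 'b) = 0"
  using red_add[OF vge_1 vge_1] red_eq_0_iff[OF vge_mono[OF vge_2], of ] vge_2 by (simp add: red_1)

lemma sqrt_mod:
  assumes "vge v x 0"
  obtains y where "vge v y 0" "vge v (x - y^2) 1"
  using perfect[unfolded residue_perfect_def, rule_format, of 2 x] vge_2 assms
  by (auto simp: intg_def)

lemma sqrt_red:
  assumes "vge v x 0"
  obtains y where "vge v y 0" "red y ^ 2 = red x"
proof -
  obtain y where y: "vge v y 0" "vge v (x - y^2) 1" using sqrt_mod[OF assms] .
  have "red x = red (x - y^2) + red (y^2)"
    using red_add[of "x - y^2" "y^2"] y by (simp add: vge_mono vge_power_0)
  also have "red (x - y^2) = 0" using y red_eq_0_iff vge_mono by fastforce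
  finally show ?thesis using that y by (simp add: red_power)
qed

text \<open>The root is (sqrt r : sqrt p), rational because k is perfect and unique because squaring
  is injective.\<close>

lemma unique_rep_root_quadratic:
  assumes "vge v p 0" "vge v q 1" "vge v r 0" and "\<not> (vge v p 1 \<and> vge v r 1)"
  shows "unique_rep_root_over_k v red [p, q, r]"
proof -
  obtain x0 z0 where x0: "vge v x0 0" "red x0 ^ 2 = red r" and z0: "vge v z0 0" "red z0 ^ 2 = red p"
    using sqrt_red assms(1,3) by metis
  have q: "red q = 0" using assms(2) red_eq_0_iff vge_mono by fastforce
  have nz: "(red x0, red z0) \<noteq> (0, 0)"
    using assms(4) x0(2) z0(2) red_eq_0_iff[OF assms(1)] red_eq_0_iff[OF assms(3)] by auto
  have "\<exists>t. X = t * red x0 \<and> Z = t * red z0" if "rep_root (map red [p, q, r]) X Z" for X Z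
  proof (rule proportional[OF nz])
    have "red p * X^2 = red r * Z^2" using that by (simp add: rep_root_quadratic_iff[OF red_two])
    then have "(red z0 * X)^2 = (red x0 * Z)^2" by (simp add: power_mult_distrib x0 z0)
    then show "red z0 * X = red x0 * Z" by (rule char2_square_inj[OF red_two])
  qed
  moreover have "rep_root (map red [p, q, r]) (red x0) (red z0)"
    using nz by (simp add: rep_root_quadratic_iff[OF red_two] q x0 z0)
  ultimately show ?thesis
    unfolding unique_rep_root_over_k_def intg_def using x0(1) z0(1) by blast
qed

text \<open>If b or d is nonzero modulo \<pi>, the odd part allows only (sqrt d : sqrt b), and J
  says that the even part vanishes there. Otherwise I gives c = 0 and a x^4 + e z^4 is a fourth
  power, with root given by fourth roots of e and a.\<close>

lemma unique_rep_root_quartic: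
  assumes int: "vge v a 0" "vge v b 0" "vge v c 0" "vge v d 0" "vge v e 0"
    and I: "vge v (c^2 + b * d) 1" and J: "vge v (a * d^2 + b^2 * e + b * c * d) 1"
    and nz: "\<not> (vge v a 1 \<and> vge v b 1 \<and> vge v c 1 \<and> vge v d 1 \<and> vge v e 1)"
  shows "unique_rep_root_over_k v red [a, b, c, d, e]"
proof -
  note two = red_two
  have "red (c^2 + b * d) = 0" using I red_eq_0_iff vge_mono by fastforce
  then have I': "red c ^ 2 + red b * red d = 0" using int by (simp add: red_simps vge_intros)
  have "red (a * d^2 + b^2 * e + b * c * d) = 0" using J red_eq_0_iff vge_mono by fastforce
  then have J': "red a * red d ^ 2 + red b ^ 2 * red e + red b * red c * red d = 0"
    using int by (simp add: red_simps vge_intros)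
  have nz': "\<not> (red a = 0 \<and> red b = 0 \<and> red c = 0 \<and> red d = 0 \<and> red e = 0)"
    using nz int by (simp add: red_eq_0_iff)
  show ?thesis
  proof (cases "red b = 0 \<and> red d = 0")
    case False
    obtain x0 z0 where x0: "vge v x0 0" "red x0 ^ 2 = red d" and z0: "vge v z0 0" "red z0 ^ 2 = red b"
      using sqrt_red int by metis
    have nz0: "(red x0, red z0) \<noteq> (0, 0)" using False x0 z0 by auto
    have "\<exists>t. X = t * red x0 \<and> Z = t * red z0" if "rep_root (map red [a, b, c, d, e]) X Z" for X Z
    proof (rule proportional[OF nz0])
      have "red b * X^2 = red d * Z^2" using that by (simp add: rep_root_quartic_iff[OF two])
      then have "(red z0 * X)^2 = (red x0 * Z)^2" by (simp add: power_mult_distrib x0 z0)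
      then show "red z0 * X = red x0 * Z" by (rule char2_square_inj[OF two])
    qed
    moreover have "red a * red x0 ^ 4 + red c * red x0 ^ 2 * red z0 ^ 2 + red e * red z0 ^ 4 = 0"
    proof -
      have "red a * red x0 ^ 4 + red c * red x0 ^ 2 * red z0 ^ 2 + red e * red z0 ^ 4
        = red a * (red x0 ^ 2)^2 + red c * red x0 ^ 2 * red z0 ^ 2 + red e * (red z0 ^ 2)^2"
        by algebra
      then show ?thesis using J' by (simp add: x0 z0 algebra_simps)
    qed
    then have "rep_root (map red [a, b, c, d, e]) (red x0) (red z0)"
      using nz0 by (simp add: rep_root_quartic_iff[OF two] x0 z0)
    ultimately show ?thesis
      unfolding unique_rep_root_over_k_def intg_def using x0(1) z0(1) by blast
  next
    case True
    then have c: "red c = 0" using I' by simp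
    obtain x1 z1 where x1: "vge v x1 0" "red x1 ^ 2 = red e" and z1: "vge v z1 0" "red z1 ^ 2 = red a"
      using sqrt_red int by metis
    obtain x0 z0 where x0: "vge v x0 0" "red x0 ^ 2 = red x1" and z0: "vge v z0 0" "red z0 ^ 2 = red z1"
      using sqrt_red x1 z1 by metis
    have x4: "red x0 ^ 4 = red e" and z4: "red z0 ^ 4 = red a"
      using x0 x1 z0 z1 by (metis power_mult numeral_times_numeral mult_2 semiring_norm(12,13) power_even_eq)+
    have nz0: "(red x0, red z0) \<noteq> (0, 0)" using True c nz' x4 z4 by auto
    have "\<exists>t. X = t * red x0 \<and> Z = t * red z0" if "rep_root (map red [a, b, c, d, e]) X Z" for X Z
    proof (rule proportional[OF nz0])
      have "red a * X^4 + red e * Z^4 = 0" using that c by (simp add: rep_root_quartic_iff[OF two])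
      then have "red a * X^4 = red e * Z^4"
        by (simp add: add_eq_0_iff2 char2_minus[OF two])
      moreover have "((red z0 * X)^2)^2 = red z0 ^ 4 * X^4" "((red x0 * Z)^2)^2 = red x0 ^ 4 * Z^4"
        by algebra+
      ultimately have "((red z0 * X)^2)^2 = ((red x0 * Z)^2)^2"
        by (simp add: x4 z4)
      then show "red z0 * X = red x0 * Z" using char2_square_inj[OF two] by blast
    qed
    moreover have "red a * red x0 ^ 4 + red e * red z0 ^ 4 = 0"
      by (simp add: x4 z4 mult.commute[of "red e"] char2_add_self[OF two])
    then have "rep_root (map red [a, b, c, d, e]) (red x0) (red z0)"
      using nz0 True c by (simp add: rep_root_quartic_iff[OF two])
    ultimately show ?thesis
      unfolding unique_rep_root_over_k_def intg_def using x0(1) z0(1) by blast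
  qed
qed

text \<open>Modulo \<pi> the quartic is a x^4 + c x^2 z^2 + e z^4, a square over the perfect field
  k, and subtracting its square root from y removes it. Hence v(P) >= 1 and v(P,Q) = 0 force b or d
  to be a unit.\<close>

lemma vPQ_ge_1I:
  assumes int: "gbq_integral v F" and P: "vform_ge v (Pcoeffs F) 1"
    and b: "vge v (cb F) 1" and d: "vge v (cd F) 1"
  shows "vPQ_ge v F 1"
proof -
  obtain l m n a b' c d' e where F: "F = GBQ l m n a b' c d' e" by (cases F)
  have q: "vge v a 0" "vge v b' 1" "vge v c 0" "vge v d' 1" "vge v e 0" and p: "vge v l 1" "vge v m 1" "vge v n 1"
    using int P b d by (auto simp: gbq_integral_def vform_Q_iff vform_P_iff F)
  obtain r0 r1 r2 where r: "vge v r0 0" "vge v (a - r0^2) 1" "vge v r1 0" "vge v (c - r1^2) 1"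
      "vge v r2 0" "vge v (e - r2^2) 1"
    using sqrt_mod q by metis
  have "vge v (b' - 2 * r0 * r1 - l * r1 - m * r0) 1" "vge v (d' - 2 * r1 * r2 - m * r2 - n * r1) 1"
     "vge v (a - r0^2 - l * r0) 1" "vge v (c - r1^2 - 2 * r0 * r2 - l * r2 - m * r1 - n * r0) 1"
     "vge v (e - r2^2 - n * r2) 1"
    by - ((rule vge_mono, (rule vge_2 p q r vge_lower_bound)+, simp)+)
  moreover have "vform_ge v (Pcoeffs (y_shift F r0 r1 r2)) 1"
    using P r int_equiv_y_shift vform_P_int_equiv by blast
  ultimately show ?thesis
    using r unfolding vPQ_ge_iff[of 1, simplified] y_sub_iff vform_Q_iff
    by (intro exI[of _ "y_shift F r0 r1 r2"]) (auto simp: F y_shift_def)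
qed

text \<open>The last hypothesis expresses that the initial y-substitution of the procedure has been
  made. Each case has its own reason for \<open>Q1\<close> to be nonzero modulo \<pi>; in the last
  one it is that v(P,Q) < 2.\<close>

lemma Q1_unique_rep_root:
  assumes int: "gbq_integral v F" and cusp: "cuspidal v (jac F)" and n2: "\<not> vPQ_ge v F 2"
    and Q: "vPQ_ge v F 1 \<Longrightarrow> vform_ge v (Qcoeffs F) 1"
  shows "unique_rep_root_over_k v red (Q1 v \<pi> F)"
proof -
  obtain l m n a b c d e where F: "F = GBQ l m n a b c d e" by (cases F)
  have i: "vge v l 0" "vge v m 0" "vge v n 0" "vge v a 0" "vge v b 0" "vge v c 0" "vge v d 0" "vge v e 0"
    using int by (auto simp: gbq_integral_def vform_Q_iff vform_P_iff F)
  consider "\<not> vform_ge v (Pcoeffs F) 1" | "vform_ge v (Pcoeffs F) 1" "\<not> vPQ_ge v F 1"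
    | "vform_ge v (Pcoeffs F) 1" "vPQ_ge v F 1" by blast
  then show ?thesis
  proof cases
    case 1
    have m: "vge v m 1" using cuspidal_jac_m[OF cusp int] by (simp add: F)
    have "unique_rep_root_over_k v red [l, m, n]"
      using 1 m by (intro unique_rep_root_quadratic i) (auto simp: F vform_P_iff)
    with 1 show ?thesis by (simp add: Q1_def Pcoeffs_def F)
  next
    case 2
    have "\<not> (vge v b 1 \<and> vge v d 1)"
      using vPQ_ge_1I[OF int 2(1)] 2(2) by (auto simp: F)
    then have "\<not> (vge v (3 * b) 1 \<and> vge v (3 * d) 1)"
      using vge_mult_unitD[OF _ not_vge_3_1] by blast
    moreover have "vge v (4 * c) 1"
      using vge_mult[OF vge_4 i(6)] by (auto intro: vge_mono)
    ultimately have "unique_rep_root_over_k v red [3 * b, 4 * c, 3 * d]"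
      by (intro unique_rep_root_quadratic) (auto intro: vge_smult vge_numeral i)
    with 2 show ?thesis by (simp add: Q1_def F)
  next
    case 3
    have p: "vge v l 1" "vge v m 1" "vge v n 1" using 3 by (auto simp: F vform_P_iff)
    have q: "vge v a 1" "vge v b 1" "vge v c 1" "vge v d 1" "vge v e 1"
      using Q[OF 3(2)] by (auto simp: F vform_Q_iff)
    have "\<not> vform_ge v (Qcoeffs F) 2"
      using n2 3(1) by (metis vPQ_ge_iff[of 2] y_sub_iff y_shift_0 vge_0 insertCI)
    then have nz: "\<not> (vge v (a / \<pi>) 1 \<and> vge v (b / \<pi>) 1 \<and> vge v (c / \<pi>) 1 \<and> vge v (d / \<pi>) 1 \<and> vge v (e / \<pi>) 1)"
      by (simp add: vge_divide_iff \<pi>_nz v_\<pi> F vform_Q_iff)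
    note IJ = cuspidal_Q_even[OF cusp[unfolded F] p q]
    have "(c / \<pi>)^2 + (b / \<pi>) * (d / \<pi>) = (c^2 + b * d) / \<pi>^2"
      by (simp add: field_simps \<pi>_nz power2_eq_square)
    then have I: "vge v ((c / \<pi>)^2 + (b / \<pi>) * (d / \<pi>)) 1"
      using IJ(1) by (simp add: vge_divide_iff \<pi>_nz v_\<pi> v_power)
    have "(a / \<pi>) * (d / \<pi>)^2 + (b / \<pi>)^2 * (e / \<pi>) + (b / \<pi>) * (c / \<pi>) * (d / \<pi>) = (a * d^2 + b^2 * e + b * c * d) / \<pi>^3"
      by (simp add: field_simps \<pi>_nz power2_eq_square power3_eq_cube)
    then have J: "vge v ((a / \<pi>) * (d / \<pi>)^2 + (b / \<pi>)^2 * (e / \<pi>) + (b / \<pi>) * (c / \<pi>) * (d / \<pi>)) 1"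
      using IJ(2) by (simp add: vge_divide_iff \<pi>_nz v_\<pi> v_power)
    have "unique_rep_root_over_k v red [a / \<pi>, b / \<pi>, c / \<pi>, d / \<pi>, e / \<pi>]"
      by (intro unique_rep_root_quartic I J nz) (simp_all add: vge_divide_iff \<pi>_nz v_\<pi> q)
    with 3 show ?thesis by (simp add: Q1_def Qcoeffs_def F)
  qed
qed

end

section \<open>The procedure\<close>

context dyadic_field
begin

definition contract :: "'a gbq \<Rightarrow> 'a gbq" where
  "contract F = gscale (1 / \<pi>) (lin_sub F \<pi> 0 0 1)"

lemma contract_GBQ: "contract (GBQ l m n a b c d e) =
    GBQ (\<pi> * l) m (n / \<pi>) (\<pi>^2 * a) (\<pi> * b) c (d / \<pi>) (e / \<pi>^2)"
  using \<pi>_nz by (simp add: contract_def gscale_def lin_sub_def power2_eq_square power3_eq_cube power4_eq_xxxx)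

lemma Pev_contract: "Pev (contract F) x z = Pev F (\<pi> * x) z / \<pi>"
  by (simp add: contract_def Pev_gscale Pev_lin_sub)

lemma Qev_contract: "Qev (contract F) x z = Qev F (\<pi> * x) z / \<pi>^2"
  by (simp add: contract_def Qev_gscale Qev_lin_sub power_one_over)

lemma eq_contract_iff:
  "G = contract F \<longleftrightarrow> (\<forall>x z. Pev G x z = Pev F (\<pi> * x) z / \<pi> \<and> Qev G x z = Qev F (\<pi> * x) z / \<pi>^2)"
  using gbq_eqI[OF infinite_field, of G "contract F"] by (auto simp: Pev_contract Qev_contract)

lemma gen_sub_contract: "gen_sub F (contract F) \<pi> 0 0 1 (1 / \<pi>) 0 0 0"
  by (simp add: gen_sub_eq contract_def)

text \<open>The determinant \<pi> and the scaling 1 / \<pi> cancel.\<close>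

lemma jac_rel_contract: "jac_rel 0 F (contract F)"
  using jac_rel_gen_sub[OF gen_sub_contract] \<pi>_nz v_\<pi> by (simp add: v_divide)

lemma red_eqD:
  assumes "vge v x 0" "vge v y 0" "red x = red y"
  shows "vge v (x - y) 1"
proof -
  have "red x = red (x - y) + red y"
    using red_add[of "x - y" y] assms by (simp add: vge_diff)
  then show ?thesis using assms red_eq_0_iff[of "x - y"] by (simp add: vge_diff)
qed

text \<open>Turns the vanishing of \<open>Q1\<close> at (m21 : m22) into divisibility of the
  coefficients that govern the point (0 : 1) after the substitution. In the last case
  \<open>Q1\<close> is Q divided by \<pi>, which gains one power.\<close>

lemma Q1_root:
  assumes M: "unimod m11 m12 m21 m22" and int: "gbq_integral v F"
    and root: "rep_root (map red (Q1 v \<pi> F)) (red m21) (red m22)"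
    and Q: "vPQ_ge v F 1 \<Longrightarrow> vform_ge v (Qcoeffs F) 1"
  shows "\<not> vform_ge v (Pcoeffs F) 1 \<Longrightarrow> vge v (cn (lin_sub F m11 m12 m21 m22)) 1"
    and "vform_ge v (Pcoeffs F) 1 \<Longrightarrow> \<not> vPQ_ge v F 1 \<Longrightarrow> vge v (cd (lin_sub F m11 m12 m21 m22)) 1"
    and "vPQ_ge v F 1 \<Longrightarrow> vge v (cd (lin_sub F m11 m12 m21 m22)) 2 \<and> vge v (ce (lin_sub F m11 m12 m21 m22)) 2"
proof -
  obtain l m n a b c d e where F: "F = GBQ l m n a b c d e" by (cases F)
  have i: "vge v l 0" "vge v m 0" "vge v n 0" "vge v a 0" "vge v b 0" "vge v c 0" "vge v d 0" "vge v e 0"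
    using int by (auto simp: gbq_integral_def vform_Q_iff vform_P_iff F)
  have mi: "vge v m11 0" "vge v m12 0" "vge v m21 0" "vge v m22 0"
    using M by (auto simp: unimod_def)
  have quad: "vge v (m21^2 * p + m22^2 * q) 1"
    if "vge v p 0" "vge v q 0" "red p * red m21 ^ 2 = red q * red m22 ^ 2" for p q
  proof -
    have "vge v (p * m21^2 - q * m22^2) 1"
      using that by (intro red_eqD) (simp_all add: red_simps vge_intros mi)
    moreover have "vge v (2 * (q * m22^2)) 1"
      using vge_mult[OF vge_2, of "q * m22^2" 0] that mi by (simp add: vge_intros)
    ultimately have "vge v ((p * m21^2 - q * m22^2) + 2 * (q * m22^2)) 1" by (rule vge_add)
    moreover have "(p * m21^2 - q * m22^2) + 2 * (q * m22^2) = m21^2 * p + m22^2 * q" by algebra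
    ultimately show ?thesis by (simp only:)
  qed
  show "vge v (cn (lin_sub F m11 m12 m21 m22)) 1" if "\<not> vform_ge v (Pcoeffs F) 1"
  proof -
    have r: "red m = 0" "red l * red m21 ^ 2 = red n * red m22 ^ 2"
      using root that by (simp_all add: Q1_def F Pcoeffs_def rep_root_quadratic_iff[OF red_two])
    then have "vge v (m21 * m22 * m) 1" using i red_eq_0_iff by (simp add: vge_intros mi)
    from vge_add[OF quad[OF i(1,3) r(2)] this] show ?thesis
      by (simp add: F lin_sub_def algebra_simps)
  qed
  show "vge v (cd (lin_sub F m11 m12 m21 m22)) 1" if "vform_ge v (Pcoeffs F) 1" "\<not> vPQ_ge v F 1"
  proof -
    have "red (3 * b) * red m21 ^ 2 = red (3 * d) * red m22 ^ 2"
      using root that by (simp add: Q1_def F rep_root_quadratic_iff[OF red_two])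
    from quad[OF _ _ this] have "vge v (3 * (m21^2 * b + m22^2 * d)) 1"
      by (simp add: algebra_simps vge_smult vge_numeral i)
    then have "vge v (m21^2 * b + m22^2 * d) 1" using vge_mult_unitD not_vge_3_1 by blast
    then show ?thesis using lin_sub_d_ge[OF M, of F 0] int by (simp add: F gbq_integral_def)
  qed
  show "vge v (cd (lin_sub F m11 m12 m21 m22)) 2 \<and> vge v (ce (lin_sub F m11 m12 m21 m22)) 2" if "vPQ_ge v F 1"
  proof -
    have P: "vform_ge v (Pcoeffs F) 1" using that by (rule vPQ_ge_1_P)
    have q: "vge v a 1" "vge v b 1" "vge v c 1" "vge v d 1" "vge v e 1"
      using Q[OF that] by (auto simp: F vform_Q_iff)
    have q': "vge v (a / \<pi>) 0" "vge v (b / \<pi>) 0" "vge v (c / \<pi>) 0" "vge v (d / \<pi>) 0" "vge v (e / \<pi>) 0"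
      using q by (simp_all add: vge_divide_iff \<pi>_nz v_\<pi>)
    have r: "red (b / \<pi>) * red m21 ^ 2 = red (d / \<pi>) * red m22 ^ 2"
      "red (a / \<pi>) * red m21 ^ 4 + red (c / \<pi>) * red m21 ^ 2 * red m22 ^ 2 + red (e / \<pi>) * red m22 ^ 4 = 0"
      using root P that by (simp_all add: Q1_def F Qcoeffs_def rep_root_quartic_iff[OF red_two])
    have "(m21^2 * b + m22^2 * d) / \<pi> = m21^2 * (b / \<pi>) + m22^2 * (d / \<pi>)"
      by (simp add: add_divide_distrib)
    then have bd: "vge v (m21^2 * b + m22^2 * d) 2"
      using quad[OF q'(2,4) r(1)] vge_divide_iff[of \<pi> "m21^2 * b + m22^2 * d" 1] \<pi>_nz v_\<pi> by simp
    have "red ((a / \<pi>) * m21^4 + (c / \<pi>) * m21^2 * m22^2 + (e / \<pi>) * m22^4) = 0"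
      using r(2) by (simp add: red_simps vge_intros mi q' del: times_divide_eq_left)
    then have "vge v ((a / \<pi>) * m21^4 + (c / \<pi>) * m21^2 * m22^2 + (e / \<pi>) * m22^4) 1"
      by (subst (asm) red_eq_0_iff) (intro vge_intros mi q')
    moreover have "(m21^4 * a + m21^2 * m22^2 * c + m22^4 * e) / \<pi>
       = (a / \<pi>) * m21^4 + (c / \<pi>) * m21^2 * m22^2 + (e / \<pi>) * m22^4"
      by (simp add: add_divide_distrib algebra_simps)
    ultimately have ace: "vge v (m21^4 * a + m21^2 * m22^2 * c + m22^4 * e) 2"
      using vge_divide_iff[of \<pi> "m21^4 * a + m21^2 * m22^2 * c + m22^4 * e" 1] \<pi>_nz v_\<pi> by simp
    show ?thesis
      using lin_sub_d_ge[OF M Q[OF that]] lin_sub_e_ge[OF M, of F 2] bd ace by (simp add: F)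
  qed
qed

lemma proc_step_iff: "proc_step v \<pi> red F F' \<longleftrightarrow> (\<exists>F1 F2 F3.
     (if vPQ_ge v F 1 then y_sub v F F1 \<and> vform_ge v (Qcoeffs F1) 1 else F1 = F) \<and>
     (\<exists>m11 m12 m21 m22. unimod m11 m12 m21 m22 \<and> F2 = lin_sub F1 m11 m12 m21 m22 \<and>
        rep_root (map red (Q1 v \<pi> F1)) (red m21) (red m22)) \<and>
     y_sub v F2 F3 \<and> vge v (ce F3) 1 \<and> F' = contract F3)"
  unfolding proc_step_def eq_contract_iff gen_sub_eq unimod_def intg_def by (simp add: conj_assoc)

text \<open>Forgets the matrix and the first y-substitution: later arguments need only that
  \<open>F2\<close> is equivalent to F and has the root at (0 : 1).\<close>

lemma proc_stepE:
  assumes step: "proc_step v \<pi> red F F'" and int: "gbq_integral v F"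
  obtains F2 F3 where "int_equiv F F2" "y_sub v F2 F3" "vge v (ce F3) 1" "F' = contract F3"
    "\<not> vform_ge v (Pcoeffs F) 1 \<Longrightarrow> vge v (cn F2) 1"
    "vform_ge v (Pcoeffs F) 1 \<Longrightarrow> \<not> vPQ_ge v F 1 \<Longrightarrow> vge v (cd F2) 1"
    "vPQ_ge v F 1 \<Longrightarrow> vform_ge v (Qcoeffs F2) 1 \<and> vge v (cd F2) 2 \<and> vge v (ce F2) 2"
proof -
  obtain F1 F2 F3 m11 m12 m21 m22 where
    F1: "if vPQ_ge v F 1 then y_sub v F F1 \<and> vform_ge v (Qcoeffs F1) 1 else F1 = F"
    and M: "unimod m11 m12 m21 m22" and F2: "F2 = lin_sub F1 m11 m12 m21 m22"
    and root: "rep_root (map red (Q1 v \<pi> F1)) (red m21) (red m22)"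
    and F3: "y_sub v F2 F3" "vge v (ce F3) 1" "F' = contract F3"
    using step unfolding proc_step_iff by blast
  have FF1: "int_equiv F F1"
    using F1 y_sub_int_equiv int_equiv_refl by (auto split: if_splits)
  have vPQ: "vPQ_ge v F1 1 \<longleftrightarrow> vPQ_ge v F 1" using vPQ_ge_int_equiv[OF FF1] by simp
  have P: "vform_ge v (Pcoeffs F1) 1 \<longleftrightarrow> vform_ge v (Pcoeffs F) 1"
    using vform_P_int_equiv FF1 int_equiv_sym by blast
  have Q: "vPQ_ge v F1 1 \<Longrightarrow> vform_ge v (Qcoeffs F1) 1" using F1 vPQ by simp
  note root = Q1_root[OF M int_equiv_integral[OF FF1 int] root Q, folded F2, unfolded P vPQ]
  have "int_equiv F F2"
    unfolding F2 using FF1 int_equiv_lin_sub[OF M] int_equiv_trans by blast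
  moreover have "vform_ge v (Qcoeffs F2) 1" if "vPQ_ge v F 1"
    unfolding F2 using lin_sub_vform_Q[OF M Q] that vPQ by simp
  ultimately show ?thesis using that F3 root by blast
qed

lemma proc_step_integral:
  assumes step: "proc_step v \<pi> red F F'" and int: "gbq_integral v F" and n2: "\<not> vPQ_ge v F 2"
    and nonsing: "gbq_disc F \<noteq> 0" and lev: "has_level v F lev" "lev > 0"
  shows "gbq_integral v F'" "K_equiv F F'" "has_level v F' lev"
proof -
  obtain F2 F3 where F2: "int_equiv F F2" and F3: "y_sub v F2 F3" and e3: "vge v (ce F3) 1"
    and F': "F' = contract F3"
    and c1: "\<not> vform_ge v (Pcoeffs F) 1 \<Longrightarrow> vge v (cn F2) 1"
    and c2: "vform_ge v (Pcoeffs F) 1 \<Longrightarrow> \<not> vPQ_ge v F 1 \<Longrightarrow> vge v (cd F2) 1"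
    and c3: "vPQ_ge v F 1 \<Longrightarrow> vform_ge v (Qcoeffs F2) 1 \<and> vge v (cd F2) 2 \<and> vge v (ce F2) 2"
    using proc_stepE[OF step int] by metis
  have FF3: "int_equiv F F3" using F2 F3 y_sub_int_equiv int_equiv_trans by blast
  have int3: "gbq_integral v F3" using FF3 int int_equiv_integral by blast
  have lev3: "has_level v F3 lev"
    using has_level_jac_rel[OF int_equiv_jac_rel[OF FF3] nonsing lev(1)] .
  have nonsing3: "gbq_disc F3 \<noteq> 0" using jac_rel_disc[OF int_equiv_jac_rel[OF FF3] nonsing] by simp
  have cusp: "cuspidal v (jac F3)" using cuspidal_jac[OF lev3 lev(2) int3 nonsing3] .
  show "has_level v F' lev"
    unfolding F' using has_level_jac_rel[OF jac_rel_contract nonsing3 lev3] .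
  show "K_equiv F F'"
  proof -
    obtain m11 m12 m21 m22 r0 r1 r2 where M: "unimod m11 m12 m21 m22"
        and g: "gen_sub F F3 m11 m12 m21 m22 1 r0 r1 r2"
      using FF3 by (rule int_equiv_gen_sub)
    have "m11 * \<pi> * m22 - m12 * \<pi> * m21 = \<pi> * (m11 * m22 - m12 * m21)" by algebra
    then have "m11 * \<pi> * m22 - m12 * \<pi> * m21 \<noteq> 0"
      using M \<pi>_nz by (simp add: unimod_def)
    with gen_sub_comp[OF g gen_sub_contract] \<pi>_nz show ?thesis
      unfolding K_equiv_def F' by (intro exI conjI) auto
  qed
  obtain l m n a b c d e where F2_eq: "F2 = GBQ l m n a b c d e" by (cases F2)
  have i: "vge v l 0" "vge v m 0" "vge v n 0" "vge v a 0" "vge v b 0" "vge v c 0" "vge v d 0" "vge v e 0"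
    using int_equiv_integral[OF F2 int] by (auto simp: gbq_integral_def vform_Q_iff vform_P_iff F2_eq)
  obtain r0 r1 r2 where r: "vge v r0 0" "vge v r1 0" "vge v r2 0" and F3_eq: "F3 = y_shift F2 r0 r1 r2"
    using F3 by (auto simp: y_sub_iff)
  obtain l3 m3 n3 a3 b3 c3' d3 e3' where F3': "F3 = GBQ l3 m3 n3 a3 b3 c3' d3 e3'" by (cases F3)
  have eqs: "n3 = n + 2 * r2" "d3 = d - 2 * r1 * r2 - m * r2 - n * r1" "e3' = e - r2^2 - n * r2"
    using F3_eq by (simp_all add: F3' F2_eq y_shift_def)
  have i3: "vge v l3 0" "vge v m3 0" "vge v a3 0" "vge v b3 0" "vge v c3' 0"
    using int3 by (auto simp: gbq_integral_def vform_Q_iff vform_P_iff F3')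
  have e3': "vge v e3' 1" using e3 by (simp add: F3')
  have P3: "vform_ge v (Pcoeffs F3) 1 \<longleftrightarrow> vform_ge v (Pcoeffs F) 1"
    using vform_P_int_equiv FF3 int_equiv_sym by blast
  have vPQ3: "vPQ_ge v F3 1 \<longleftrightarrow> vPQ_ge v F 1" using vPQ_ge_int_equiv[OF FF3] by simp
  \<comment> \<open>The contraction divides n, d, e by \<pi>, \<pi>, \<pi>^2 and no other
    coefficient.\<close>
  have "vge v n3 1 \<and> vge v d3 1 \<and> vge v e3' 2"
  proof -
    consider "\<not> vform_ge v (Pcoeffs F) 1" | "vform_ge v (Pcoeffs F) 1" "\<not> vPQ_ge v F 1"
      | "vform_ge v (Pcoeffs F) 1" "vPQ_ge v F 1" by blast
    then show ?thesis
    proof cases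
      case 1
      have n: "vge v n 1" using c1[OF 1] by (simp add: F2_eq)
      have n3: "vge v n3 1"
        unfolding eqs by (rule vge_mono) ((rule n vge_2 r vge_lower_bound)+, simp)
      have m3: "vge v m3 1" using cuspidal_jac_m[OF cusp int3] by (simp add: F3')
      have "\<not> vge v l3 1" using 1 P3 n3 m3 by (auto simp: vform_P_iff F3')
      then show ?thesis
        using cuspidal_P_unit[OF cusp[unfolded F3'] int3[unfolded F3'] _ n3 e3'] n3 by simp
    next
      case 2
      have p3: "vge v l3 1" "vge v m3 1" "vge v n3 1" using 2 P3 by (auto simp: vform_P_iff F3')
      have "vform_ge v (Pcoeffs F2) 1" using vform_P_int_equiv[OF F2] 2 by blast
      then have p: "vge v m 1" "vge v n 1" by (auto simp: vform_P_iff F2_eq)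
      have d: "vge v d 1" using c2 2 by (simp add: F2_eq)
      have d3: "vge v d3 1"
        unfolding eqs by (rule vge_mono) ((rule p d vge_2 r vge_lower_bound)+, simp)
      have "\<not> vge v b3 1"
        using vPQ_ge_1I[OF int3] 2 P3 vPQ3 d3 by (auto simp: F3')
      then show ?thesis
        using cuspidal_P_even[OF cusp[unfolded F3'] int3[unfolded F3'] p3 _ d3 e3'] d3 p3 by simp
    next
      case 3
      have "vform_ge v (Pcoeffs F2) 1" using vform_P_int_equiv[OF F2] 3 by blast
      then have p: "vge v m 1" "vge v n 1" by (auto simp: vform_P_iff F2_eq)
      have q: "vge v d 2" "vge v e 2" using c3 3 by (auto simp: F2_eq)
      \<comment> \<open>As \<pi> divides e both before and after the shift, it divides r2; hence
        \<pi>^2 still divides e afterwards.\<close>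
      have "vge v (e - e3' - n * r2) 1"
        by (rule vge_mono) ((rule p q e3' r vge_lower_bound)+, simp)
      then have "vge v (r2^2) 1" by (simp add: eqs)
      then have r2: "vge v r2 1" using vge_power2D[of r2 1] by simp
      have "vge v n3 1" "vge v d3 1" "vge v e3' 2"
        unfolding eqs by - ((rule vge_mono, (rule p q r2 vge_2 r vge_lower_bound)+, simp)+)
      then show ?thesis by simp
    qed
  qed
  then show "gbq_integral v F'"
    using i3 vge_mult[of \<pi> 1] vge_mult[OF vge_power, of \<pi> 1 _ 0 2]
    by (auto simp: F' F3' contract_GBQ gbq_integral_def vform_P_iff vform_Q_iff vge_divide_iff \<pi>_nz v_\<pi> v_power
        vge_mult_iff intro: vge_mono)
qed

text \<open>The rational root lifts to O_K with a unit coordinate, so the lift can be completed to a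
  matrix in GL_2(O_K).\<close>

lemma proc_step_exists:
  assumes int: "gbq_integral v F" and n2: "\<not> vPQ_ge v F 2"
    and nonsing: "gbq_disc F \<noteq> 0" and lev: "has_level v F lev" "lev > 0"
  shows "\<exists>F'. proc_step v \<pi> red F F'"
proof -
  obtain F1 where F1: "if vPQ_ge v F 1 then y_sub v F F1 \<and> vform_ge v (Qcoeffs F1) 1 else F1 = F"
  proof (cases "vPQ_ge v F 1")
    case True
    then obtain F1 where "y_sub v F F1" "vform_ge v (Qcoeffs F1) 1"
      using vPQ_ge_iff[of 1 F] by auto
    with True show ?thesis using that by simp
  qed (use that in simp)
  have FF1: "int_equiv F F1"
    using F1 y_sub_int_equiv int_equiv_refl by (auto split: if_splits)
  have int1: "gbq_integral v F1" using int_equiv_integral[OF FF1 int] .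
  have cusp: "cuspidal v (jac F1)"
    using cuspidal_jac[OF has_level_jac_rel[OF int_equiv_jac_rel[OF FF1] nonsing lev(1)] lev(2) int1]
      jac_rel_disc(1)[OF int_equiv_jac_rel[OF FF1] nonsing] by blast
  have vPQ: "vPQ_ge v F1 1 \<longleftrightarrow> vPQ_ge v F 1" "\<not> vPQ_ge v F1 2"
    using vPQ_ge_int_equiv[OF FF1] n2 by simp_all
  have Q: "vPQ_ge v F1 1 \<Longrightarrow> vform_ge v (Qcoeffs F1) 1" using F1 vPQ by simp
  obtain x0 z0 where x0: "vge v x0 0" and z0: "vge v z0 0"
      and root: "rep_root (map red (Q1 v \<pi> F1)) (red x0) (red z0)"
    using Q1_unique_rep_root[OF int1 cusp vPQ(2) Q] by (auto simp: unique_rep_root_over_k_def intg_def)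
  have "(red x0, red z0) \<noteq> (0, 0)" using root by (simp add: rep_root_def)
  then have unit: "\<not> vge v x0 1 \<or> \<not> vge v z0 1" using red_eq_0_iff x0 z0 by auto
  obtain m11 m12 where M: "unimod m11 m12 x0 z0"
  proof (cases "vge v x0 1")
    case True
    then have "unimod 1 0 x0 z0" using unit x0 z0 by (auto simp: unimod_def vge_1 vge_def)
    then show ?thesis using that by blast
  next
    case False
    then have "unimod 0 1 x0 z0" using x0 z0 by (auto simp: unimod_def vge_1 vge_def)
    then show ?thesis using that by blast
  qed
  define F2 where "F2 = lin_sub F1 m11 m12 x0 z0"
  have F1F2: "int_equiv F1 F2" unfolding F2_def using int_equiv_lin_sub[OF M] .
  have int2: "gbq_integral v F2" using int_equiv_integral[OF F1F2 int1] .
  have n: "vge v (cn F2) 1"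
  proof (cases "vform_ge v (Pcoeffs F1) 1")
    case True
    then show ?thesis using vform_P_int_equiv[OF F1F2] by (simp add: vform_P_iff)
  next
    case False
    then show ?thesis unfolding F2_def using Q1_root(1)[OF M int1 root Q] by blast
  qed
  have "vge v (ce F2) 0" using int2 by (simp add: gbq_integral_def vform_Q_iff)
  \<comment> \<open>The shift changes e into e - r2^2 - n r2, and \<pi> divides n, so a square root
    of e modulo \<pi> suffices.\<close>
  then obtain r2 where r2: "vge v r2 0" "vge v (ce F2 - r2^2) 1" using sqrt_mod by blast
  define F3 where "F3 = y_shift F2 0 0 r2"
  have "ce F3 = ce F2 - r2^2 - cn F2 * r2" by (cases F2) (simp add: F3_def y_shift_def)
  then have e: "vge v (ce F3) 1"
    using vge_diff[OF r2(2), of "cn F2 * r2"] vge_mult[OF n r2(1)] by simp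
  have "y_sub v F2 F3" unfolding F3_def y_sub_iff using r2 vge_0 by blast
  with F1 M root e have "proc_step v \<pi> red F (contract F3)"
    unfolding proc_step_iff F2_def by blast
  then show ?thesis by blast
qed

end

section \<open>Non-minimal models\<close>

context discretely_valued
begin

text \<open>The scalar matrix \<beta> multiplies P by \<beta>^2 and Q by \<beta>^4, so it is a
  scaling by \<beta>^2.\<close>

lemma gscale_diag:
  assumes "\<beta> \<noteq> 0"
  shows "gscale \<mu> (y_shift (lin_sub F \<alpha> 0 0 \<beta>) r0 r1 r2) =
    gscale (\<mu> * \<beta>^2) (y_shift (lin_sub F (\<alpha> / \<beta>) 0 0 1) (r0 / \<beta>^2) (r1 / \<beta>^2) (r2 / \<beta>^2))"
proof -
  define i where "i = 1 / \<beta>"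
  have i: "\<beta> * i = 1" using assms by (simp add: i_def)
  have e: "x / \<beta> = x * i" "x / \<beta>^2 = x * i^2" for x
    by (simp_all add: i_def power_one_over)
  obtain l m n a b c d e where F: "F = GBQ l m n a b c d e" by (cases F)
  have s: "lin_sub F x 0 0 y = GBQ (x^2 * l) (x * y * m) (y^2 * n) (x^4 * a) (x^3 * y * b) (x^2 * y^2 * c) (x * y^3 * d) (y^4 * e)"
    for x y by (simp add: F lin_sub_def)
  show ?thesis
    unfolding e s gscale_def y_shift_def gbq.case gbq.inject power_one mult_1_right
    using i by (intro conjI refl; algebra)
qed

text \<open>Elimination with pivot m22: its minimal valuation makes the multipliers p and q
  integral, so they are absorbed into F and H, and makes v \<kappa> nonnegative for \<kappa> =
  \<delta> / m22.\<close>

lemma elementary_divisors_aux: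
  assumes H: "H = gscale \<mu> (y_shift (lin_sub F m11 m12 m21 m22) r0 r1 r2)"
    and nz: "\<mu> \<noteq> 0" "m11 * m22 - m12 * m21 \<noteq> 0" "m22 \<noteq> 0"
    and min: "vge v m11 (v m22)" "vge v m12 (v m22)" "vge v m21 (v m22)"
  shows "\<exists>F' H' \<kappa> \<nu> s0 s1 s2. int_equiv F F' \<and> int_equiv H H' \<and> \<kappa> \<noteq> 0 \<and> \<nu> \<noteq> 0 \<and> 0 \<le> v \<kappa> \<and>
    v \<kappa> + v \<nu> = v \<mu> + v (m11 * m22 - m12 * m21) \<and> H' = gscale \<nu> (y_shift (lin_sub F' \<kappa> 0 0 1) s0 s1 s2)"
proof -
  define p q \<delta> where "p = m21 / m22" "q = m12 / m22" "\<delta> = (m11 * m22 - m12 * m21) / m22"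
  note pq = this
  have pq': "m21 = p * m22" "m12 = q * m22" and \<delta>: "m11 = \<delta> + q * p * m22" "\<delta> \<noteq> 0"
    "\<delta> * m22 = m11 * m22 - m12 * m21"
    using nz by (simp_all add: pq field_simps)
  have int: "vge v p 0" "vge v q 0" using min nz by (simp_all add: pq vge_divide_iff)
  have up: "unimod 1 0 p 1" and uq: "unimod 1 (- q) 0 1"
    using int by (auto simp: unimod_def vge_1 intro: vge_minus)
  define F' H' where "F' = lin_sub F 1 0 p 1" "H' = lin_sub H 1 (- q) 0 1"
  note FH = this
  have F: "F = lin_sub F' 1 0 (- p) 1" by (simp add: FH lin_sub_lin_sub)
  have "lin_sub (lin_sub F m11 m12 m21 m22) 1 (- q) 0 1 = lin_sub F' \<delta> 0 0 m22"
    unfolding F lin_sub_lin_sub by (simp add: pq' \<delta>(1) algebra_simps)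
  then obtain s0 s1 s2 where "H' = gscale \<mu> (y_shift (lin_sub F' \<delta> 0 0 m22) s0 s1 s2)"
    unfolding FH(2) H lin_sub_gscale lin_sub_y_shift by metis
  then obtain t0 t1 t2 where "H' = gscale (\<mu> * m22^2) (y_shift (lin_sub F' (\<delta> / m22) 0 0 1) t0 t1 t2)"
    unfolding gscale_diag[OF nz(3)] by metis
  moreover have "v m22 \<le> v \<delta>"
  proof -
    have "\<delta> = m11 - q * m21" using nz by (simp add: pq field_simps)
    then have "vge v \<delta> (v m22)" using min int by (simp add: vge_diff vge_smult)
    then show ?thesis using \<delta> by (simp add: vge_def)
  qed
  moreover have "v \<delta> + v m22 = v (m11 * m22 - m12 * m21)"
    using \<delta>(2) nz by (simp add: \<delta>(3)[symmetric] v_mult)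
  ultimately show ?thesis
    using int_equiv_lin_sub[OF up, of F] int_equiv_lin_sub[OF uq, of H] \<delta>(2) nz
    unfolding FH[symmetric]
    by (intro exI[of _ F'] exI[of _ H'] exI[of _ "\<delta> / m22"] exI[of _ "\<mu> * m22^2"] exI[of _ t0] exI[of _ t1] exI[of _ t2])
      (simp add: v_divide v_mult v_power)
qed

text \<open>An entry of minimal valuation is brought to position m22 by swapping x and z in F, in H,
  or in both.\<close>

lemma elementary_divisors:
  assumes "gen_sub F H m11 m12 m21 m22 \<mu> r0 r1 r2"
    and nz: "\<mu> \<noteq> 0" "m11 * m22 - m12 * m21 \<noteq> 0"
  shows "\<exists>F' H' \<kappa> \<nu> s0 s1 s2. int_equiv F F' \<and> int_equiv H H' \<and> \<kappa> \<noteq> 0 \<and> \<nu> \<noteq> 0 \<and> 0 \<le> v \<kappa> \<and>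
    v \<kappa> + v \<nu> = v \<mu> + v (m11 * m22 - m12 * m21) \<and> H' = gscale \<nu> (y_shift (lin_sub F' \<kappa> 0 0 1) s0 s1 s2)"
    (is "?P F H m11 m12 m21 m22")
proof -
  have H: "H = gscale \<mu> (y_shift (lin_sub F m11 m12 m21 m22) r0 r1 r2)"
    using assms(1) by (simp add: gen_sub_eq)
  define S where "S = {m11, m12, m21, m22} - {0}"
  have "v ` S \<noteq> {}" "finite (v ` S)" using nz by (auto simp: S_def)
  then have "Min (v ` S) \<in> v ` S" by (intro Min_in)
  then obtain x where x: "x \<in> S" "v x = Min (v ` S)" by auto
  have "vge v y (v x)" if "y \<in> {m11, m12, m21, m22}" for y
  proof (cases "y = 0")
    case False
    then have "y \<in> S" using that by (simp add: S_def)
    then show ?thesis using \<open>finite (v ` S)\<close> by (simp add: vge_def x(2))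
  qed simp
  then have min: "vge v m11 (v x)" "vge v m12 (v x)" "vge v m21 (v x)" "vge v m22 (v x)" by auto
  have "x \<noteq> 0" using x by (auto simp: S_def)
  define Fs Hs where "Fs = lin_sub F 0 1 1 0" "Hs = lin_sub H 0 1 1 0"
  note FHs = this
  have eqv: "int_equiv F Fs" "int_equiv H Hs"
    unfolding FHs by (intro int_equiv_lin_sub unimod_swap)+
  have F: "F = lin_sub Fs 0 1 1 0" by (simp add: FHs lin_sub_lin_sub)
  have det: "v (m12 * m21 - m11 * m22) = v (m11 * m22 - m12 * m21)"
    using v_minus[of "m11 * m22 - m12 * m21"] by simp
  have H_Fs: "H = gscale \<mu> (y_shift (lin_sub Fs m12 m11 m22 m21) r0 r1 r2)"
    unfolding H by (simp add: F lin_sub_lin_sub)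
  have Hs_F: "Hs = gscale \<mu> (y_shift (lin_sub F m21 m22 m11 m12) r2 r1 r0)"
    unfolding FHs H by (simp add: lin_sub_gscale lin_sub_y_shift lin_sub_lin_sub)
  have Hs_Fs: "Hs = gscale \<mu> (y_shift (lin_sub Fs m22 m21 m12 m11) r2 r1 r0)"
    unfolding Hs_F by (simp add: F lin_sub_lin_sub)
  have "x \<in> {m11, m12, m21, m22}" using x by (simp add: S_def)
  then consider "x = m22" | "x = m21" | "x = m12" | "x = m11" by blast
  then show ?thesis
  proof cases
    case 1
    then show ?thesis using elementary_divisors_aux[OF H nz] \<open>x \<noteq> 0\<close> min by simp
  next
    case 2
    have "?P Fs H m11 m12 m21 m22"
      using elementary_divisors_aux[OF H_Fs nz(1)] 2 nz \<open>x \<noteq> 0\<close> min by (simp add: det)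
    then show ?thesis using int_equiv_trans[OF eqv(1)] by blast
  next
    case 3
    have "?P F Hs m11 m12 m21 m22"
      using elementary_divisors_aux[OF Hs_F nz(1)] 3 nz \<open>x \<noteq> 0\<close> min
      by (simp add: det mult.commute[of m21] mult.commute[of m22])
    then show ?thesis using int_equiv_trans[OF eqv(2)] by blast
  next
    case 4
    have "?P Fs Hs m11 m12 m21 m22"
      using elementary_divisors_aux[OF Hs_Fs nz(1)] 4 nz \<open>x \<noteq> 0\<close> min
      by (simp add: mult.commute[of m21] mult.commute[of m22])
    then show ?thesis using int_equiv_trans[OF eqv(1)] int_equiv_trans[OF eqv(2)] by blast
  qed
qed

text \<open>Reached by models that become integral of smaller discriminant after
  \<open>x \<leftarrow> \<kappa> x\<close> with \<open>v \<kappa> = 1\<close> and \<open>v \<kappa> \<ge> 2\<close>, respectively.\<close>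

definition weight_one :: "'a gbq \<Rightarrow> bool" where
  "weight_one F \<longleftrightarrow> gbq_integral v F \<and> vge v (cm F) 1 \<and> vge v (cn F) 2 \<and>
     vge v (cb F) 1 \<and> vge v (cc F) 2 \<and> vge v (cd F) 3 \<and> vge v (ce F) 4"

definition weight_two :: "'a gbq \<Rightarrow> bool" where
  "weight_two F \<longleftrightarrow> gbq_integral v F \<and> vge v (cm F) 1 \<and> vge v (cn F) 3 \<and>
     vge v (cc F) 2 \<and> vge v (cd F) 4 \<and> vge v (ce F) 6"

text \<open>The cases k = 0, k = 1, k >= 2 for k = v \<kappa> give v(P,Q) >= 2, the first and the
  second system. The work lies in showing how far the y-shift can be taken integral.\<close>

lemma weights_of_integral_image:
  assumes int: "gbq_integral v F"
    and H: "H = gscale \<nu> (y_shift (lin_sub F \<kappa> 0 0 1) s0 s1 s2)" "gbq_integral v H"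
    and nz: "\<kappa> \<noteq> 0" "\<nu> \<noteq> 0" and k: "0 \<le> v \<kappa>" "v \<kappa> + v \<nu> < 0"
  shows "vPQ_ge v F 2 \<or> (\<exists>G. int_equiv F G \<and> (weight_one G \<or> weight_two G))"
proof -
  define k where "k = v \<kappa>"
  have k0: "0 \<le> k" and \<nu>: "v \<nu> \<le> - k - 1" using k by (auto simp: k_def)
  \<comment> \<open>The shift moved across x <- \<kappa> x, so that it acts on F directly.\<close>
  define t0 t1 where "t0 = s0 / \<kappa>^2" "t1 = s1 / \<kappa>"
  note t = this
  have s: "s0 = \<kappa>^2 * t0" "s1 = \<kappa> * t1" using nz by (simp_all add: t)
  obtain l m n a b c d e where F: "F = GBQ l m n a b c d e" by (cases F)
  have i: "vge v l 0" "vge v m 0" "vge v n 0" "vge v a 0" "vge v b 0" "vge v c 0" "vge v d 0" "vge v e 0"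
    using int by (auto simp: gbq_integral_def vform_Q_iff vform_P_iff F)
  obtain l' m' n' a' b' c' d' e' where G: "y_shift F t0 t1 s2 = GBQ l' m' n' a' b' c' d' e'"
    by (cases "y_shift F t0 t1 s2")
  have eqs: "l' = l + 2 * t0" "m' = m + 2 * t1" "n' = n + 2 * s2"
     "a' = a - t0^2 - l * t0" "b' = b - 2 * t0 * t1 - l * t1 - m * t0"
     "c' = c - t1^2 - 2 * t0 * s2 - l * s2 - m * t1 - n * t0"
     "d' = d - 2 * t1 * s2 - m * s2 - n * t1" "e' = e - s2^2 - n * s2"
    using G by (simp_all add: F y_shift_def)
  have lin: "lin_sub F \<kappa> 0 0 1 = GBQ (\<kappa>^2 * l) (\<kappa> * m) n (\<kappa>^4 * a) (\<kappa>^3 * b) (\<kappa>^2 * c) (\<kappa> * d) e"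
    by (simp add: F lin_sub_def)
  have "H = GBQ (\<nu> * \<kappa>^2 * l') (\<nu> * \<kappa> * m') (\<nu> * n') (\<nu>^2 * \<kappa>^4 * a') (\<nu>^2 * \<kappa>^3 * b')
     (\<nu>^2 * \<kappa>^2 * c') (\<nu>^2 * \<kappa> * d') (\<nu>^2 * e')"
    unfolding H(1) lin gscale_def y_shift_def gbq.case gbq.inject eqs s by (intro conjI refl; algebra)
  then have "vge v (\<nu> * \<kappa>^2 * l') 0" "vge v (\<nu> * \<kappa> * m') 0" "vge v (\<nu> * n') 0"
     "vge v (\<nu>^2 * \<kappa>^4 * a') 0" "vge v (\<nu>^2 * \<kappa>^3 * b') 0" "vge v (\<nu>^2 * \<kappa>^2 * c') 0"
     "vge v (\<nu>^2 * \<kappa> * d') 0" "vge v (\<nu>^2 * e') 0"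
    using H(2) by (auto simp: gbq_integral_def vform_P_iff vform_Q_iff)
  \<comment> \<open>The coefficient of x^i z^j is multiplied by \<nu> \<kappa>^i in P and by \<nu>^2
    \<kappa>^i in Q, with v \<nu> <= - k - 1; hence the bounds k + 1 - i k and 2 (k + 1) - i
    k.\<close>
  then have w: "vge v l' (1 - k)" "vge v m' 1" "vge v n' (k + 1)" "vge v a' (2 - 2 * k)" "vge v b' (2 - k)"
     "vge v c' 2" "vge v d' (k + 2)" "vge v e' (2 * k + 2)"
    using nz \<nu> by (auto simp: vge_mult_iff v_mult v_power k_def elim!: vge_mono)
  have s2: "vge v s2 0"
  proof (rule vge_quadraticD)
    have "s2^2 + n * s2 = e - e'" by (simp add: eqs)
    then show "vge v (s2^2 + n * s2) (2 * 0)"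
      using i(8) w(8) k0 by (auto intro!: vge_diff elim: vge_mono)
  qed (use i in simp_all)
  have t0: "vge v t0 (min 0 (1 - k))"
  proof (rule vge_quadraticD)
    have "t0^2 + l * t0 = a - a'" by (simp add: eqs)
    then show "vge v (t0^2 + l * t0) (2 * min 0 (1 - k))"
      using vge_diff_min[OF i(4) w(4)] by (auto elim!: vge_mono simp: min_def)
  qed (use i in simp_all)
  \<comment> \<open>For k >= 2 the bound allows t0 a pole of order k - 1, which n' more than
    compensates; this keeps t1 integral.\<close>
  have t0n: "vge v (t0 * n') (min 0 (1 - k) + (k + 1))" using vge_mult[OF t0 w(3)] .
  have t1: "vge v t1 0"
  proof (rule vge_quadraticD)
    have "t1^2 + m * t1 = c - c' - l * s2 - t0 * n'" unfolding eqs by algebra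
    moreover have "vge v (c - c' - l * s2 - t0 * n') 0"
      using vge_mono[OF w(6), of 0] vge_mono[OF t0n, of 0] k0
      by (intro vge_diff i vge_smult[OF i(1) s2]) (auto simp: min_def split: if_splits)
    ultimately show "vge v (t1^2 + m * t1) (2 * 0)" by simp
  qed (use i in simp_all)
  consider "k = 0" | "k = 1" | "k \<ge> 2" using k0 by linarith
  then show ?thesis
  proof cases
    case 1
    then have "y_sub v F (y_shift F t0 t1 s2)"
      using t0 t1 s2 by (auto simp: y_sub_iff)
    moreover have "vform_ge v (Pcoeffs (y_shift F t0 t1 s2)) 1" "vform_ge v (Qcoeffs (y_shift F t0 t1 s2)) 2"
      using w 1 by (simp_all add: G vform_P_iff vform_Q_iff)
    ultimately show ?thesis using vPQ_ge_iff[of 2 F] by auto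
  next
    case 2
    then have t0': "vge v t0 0" using t0 by simp
    have "weight_one (y_shift F t0 t1 s2)"
      unfolding weight_one_def using y_shift_integral[OF int t0' t1 s2] w 2 by (simp add: G)
    then show ?thesis using int_equiv_y_shift[OF t0' t1 s2] by blast
  next
    case 3
    \<comment> \<open>The possibly non-integral t0 is dropped: m, n, d, e do not involve it, and c
      changes by t0 n', of valuation at least 2.\<close>
    let ?G = "y_shift F 0 t1 s2"
    have G': "cm ?G = m'" "cn ?G = n'" "cd ?G = d'" "ce ?G = e'"
      by (simp_all add: F y_shift_def eqs)
    have "cc ?G = c' + t0 * n'"
      by (simp add: F y_shift_def eqs algebra_simps)
    then have "vge v (cc ?G) 2" using vge_add[OF w(6) vge_mono[OF t0n, of 2]] 3 by simp
    then have "weight_two ?G"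
      unfolding weight_two_def G' using y_shift_integral[OF int vge_0 t1 s2] w 3 by (auto elim: vge_mono)
    then show ?thesis using int_equiv_y_shift[OF vge_0 t1 s2] by blast
  qed
qed

text \<open>A smaller discriminant means v \<mu> + v(det) < 0, which elementary divisors turn into v
  \<kappa> + v \<nu> < 0.\<close>

lemma non_minimal_weights:
  assumes "non_minimal v F" "gbq_integral v F" "gbq_disc F \<noteq> 0" "\<not> vPQ_ge v F 2"
  shows "\<exists>G. int_equiv F G \<and> (weight_one G \<or> weight_two G)"
proof -
  obtain H where H: "gbq_integral v H" "K_equiv F H" "v (gbq_disc H) < v (gbq_disc F)"
    using assms(1) by (auto simp: non_minimal_def)
  then obtain m11 m12 m21 m22 \<mu> r0 r1 r2 where g: "\<mu> \<noteq> 0" "m11 * m22 - m12 * m21 \<noteq> 0"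
      "gen_sub F H m11 m12 m21 m22 \<mu> r0 r1 r2"
    by (auto simp: K_equiv_def)
  have neg: "v \<mu> + v (m11 * m22 - m12 * m21) < 0"
    using jac_rel_disc(2)[OF jac_rel_gen_sub[OF g(3,1,2)] assms(3)] H(3) by simp
  obtain F' H' \<kappa> \<nu> s0 s1 s2 where F': "int_equiv F F'" and H': "int_equiv H H'"
      and w: "\<kappa> \<noteq> 0" "\<nu> \<noteq> 0" "0 \<le> v \<kappa>" "v \<kappa> + v \<nu> < 0" "H' = gscale \<nu> (y_shift (lin_sub F' \<kappa> 0 0 1) s0 s1 s2)"
    using elementary_divisors[OF g(3,1,2)] neg by auto
  have "vPQ_ge v F' 2 \<or> (\<exists>G. int_equiv F' G \<and> (weight_one G \<or> weight_two G))"
    using weights_of_integral_image[OF int_equiv_integral[OF F' assms(2)] w(5) int_equiv_integral[OF H' H(1)] w(1-4)] .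
  then show ?thesis
    using vPQ_ge_int_equiv[OF F', of 2] assms(4) int_equiv_trans[OF F'] by auto
qed

end

section \<open>The procedure in adapted coordinates\<close>

context dyadic_field
begin

text \<open>Since \<open>m21\<close> and \<open>r2\<close> vanish modulo \<open>\<pi>\<close>, conjugation by \<open>diag(\<pi>, 1)\<close> preserves integrality.\<close>

lemma int_equiv_contract:
  assumes M: "unimod m11 m12 m21 m22" "vge v m21 1" and r: "vge v r0 0" "vge v r1 0" "vge v r2 1"
  shows "int_equiv (contract F) (contract (y_shift (lin_sub F m11 m12 m21 m22) r0 r1 r2))"
proof -
  have m: "vge v m11 0" "vge v m12 0" "vge v m22 0" "m11 * m22 - m12 * m21 \<noteq> 0" "v (m11 * m22 - m12 * m21) = 0"
    using M by (auto simp: unimod_def)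
  have \<pi>: "vge v \<pi> 0" using v_\<pi> by (simp add: vge_def)
  have "unimod m11 (\<pi> * m12) (m21 / \<pi>) m22"
    using m M(2) \<pi> \<pi>_nz v_\<pi> by (simp add: unimod_def vge_smult vge_divide_iff)
  moreover have "contract (y_shift (lin_sub F m11 m12 m21 m22) r0 r1 r2) =
     y_shift (lin_sub (contract F) m11 (\<pi> * m12) (m21 / \<pi>) m22) (\<pi> * r0) r1 (r2 / \<pi>)"
  proof -
    have X: "\<pi> * (m11 * x + m21 / \<pi> * z) = m11 * (\<pi> * x) + m21 * z"
        "\<pi> * m12 * x + m22 * z = m12 * (\<pi> * x) + m22 * z" for x z
      using \<pi>_nz by (simp_all add: algebra_simps)
    have R: "\<pi> * r0 * x^2 + r1 * x * z + r2 / \<pi> * z^2 = (r0 * (\<pi> * x)^2 + r1 * (\<pi> * x) * z + r2 * z^2) / \<pi>" for x z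
      using \<pi>_nz by (simp add: field_simps power2_eq_square)
    have div: "(p + 2 * \<rho>) / \<pi> = p / \<pi> + 2 * (\<rho> / \<pi>)"
      "(q - \<rho>^2 - p * \<rho>) / \<pi>^2 = q / \<pi>^2 - (\<rho> / \<pi>)^2 - p / \<pi> * (\<rho> / \<pi>)" for p q \<rho>
      by (simp_all add: diff_divide_distrib add_divide_distrib power_divide power2_eq_square)
    show ?thesis
      by (rule gbq_eqI[OF infinite_field])
        (simp_all only: Pev_contract Qev_contract Pev_y_shift Qev_y_shift Pev_lin_sub Qev_lin_sub X R div)
  qed
  ultimately show ?thesis
    using r \<pi> \<pi>_nz v_\<pi> int_equivI[of m11 "\<pi> * m12" "m21 / \<pi>" m22 "\<pi> * r0" r1 "r2 / \<pi>" "contract F"]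
    by (simp add: vge_smult vge_divide_iff)
qed

text \<open>The procedure works in its own coordinates \<open>F2\<close>, \<open>F3\<close>; the
  claim is that the contraction may be done in the adapted ones instead. The bounds assumed are
  common to both systems, and the last conclusion is conditional because only the first system
  bounds b.\<close>

lemma proc_step_contract:
  assumes int: "gbq_integral v G" and w: "vge v (cm G) 1" "vge v (cn G) 2" "vge v (cc G) 2" "vge v (cd G) 3" "vge v (ce G) 4"
    and GF: "int_equiv G F" and n2: "\<not> vPQ_ge v F 2" and step: "proc_step v \<pi> red F F'"
  obtains G1 where "int_equiv (contract G1) F'" "gbq_integral v G1" "cm G1 = cm G" "cn G1 = cn G" "cd G1 = cd G" "ce G1 = ce G"
    "vge v (cc G1) 2" "vge v (cb G) 1 \<Longrightarrow> vge v (cb G1) 1"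
proof -
  have intF: "gbq_integral v F" using int_equiv_integral[OF GF int] .
  obtain F2 F3 where F2: "int_equiv F F2" and F3: "y_sub v F2 F3" and e3: "vge v (ce F3) 1"
    and F': "F' = contract F3"
    and c1: "\<not> vform_ge v (Pcoeffs F) 1 \<Longrightarrow> vge v (cn F2) 1"
    and c2: "vform_ge v (Pcoeffs F) 1 \<Longrightarrow> \<not> vPQ_ge v F 1 \<Longrightarrow> vge v (cd F2) 1"
    and c3: "vPQ_ge v F 1 \<Longrightarrow> vform_ge v (Qcoeffs F2) 1 \<and> vge v (cd F2) 2 \<and> vge v (ce F2) 2"
    using proc_stepE[OF step intF] by metis
  have P: "vform_ge v (Pcoeffs G) 1 \<longleftrightarrow> vform_ge v (Pcoeffs F) 1"
    using vform_P_int_equiv GF int_equiv_sym by blast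
  have vPQ: "vPQ_ge v G 1 \<longleftrightarrow> vPQ_ge v F 1" using vPQ_ge_int_equiv[OF GF] by simp
  \<comment> \<open>Common to the three cases, which differ only in why \<pi> divides m21.\<close>
  have key: "int_equiv (contract G1) F'"
    if G1: "int_equiv G G1" and w1: "vge v (cn G1) 1" "vge v (ce G1) 1"
      and root: "\<And>m11 m12 m21 m22 r0 r1 r2. unimod m11 m12 m21 m22 \<Longrightarrow> vge v r0 0 \<Longrightarrow> vge v r1 0 \<Longrightarrow> vge v r2 0 \<Longrightarrow>
        F2 = y_shift (lin_sub G1 m11 m12 m21 m22) r0 r1 r2 \<Longrightarrow> vge v m21 1" for G1
  proof -
    have "int_equiv G1 F2" using G1 GF F2 int_equiv_sym int_equiv_trans by blast
    then obtain m11 m12 m21 m22 r0 r1 r2 where M: "unimod m11 m12 m21 m22"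
        and r: "vge v r0 0" "vge v r1 0" "vge v r2 0" and F2_eq: "F2 = y_shift (lin_sub G1 m11 m12 m21 m22) r0 r1 r2"
      by (auto simp: int_equiv_def)
    have m21: "vge v m21 1" using root[OF M r F2_eq] .
    obtain s0 s1 s2 where s: "vge v s0 0" "vge v s1 0" "vge v s2 0" and F3_eq: "F3 = y_shift F2 s0 s1 s2"
      using F3 by (auto simp: y_sub_iff)
    define t0 t1 t2 where "t0 = r0 + s0" "t1 = r1 + s1" "t2 = r2 + s2"
    note t = this
    have F3_eq': "F3 = y_shift (lin_sub G1 m11 m12 m21 m22) t0 t1 t2"
      unfolding F3_eq F2_eq y_shift_y_shift t ..
    have t': "vge v t0 0" "vge v t1 0" "vge v t2 0" unfolding t by (intro vge_add r s)+
    obtain l m n a b c d e where G1_eq: "G1 = GBQ l m n a b c d e" by (cases G1)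
    have i: "vge v l 0" "vge v m 0" "vge v a 0" "vge v b 0" "vge v c 0" "vge v d 0" "vge v n 1" "vge v e 1"
      using int_equiv_integral[OF G1 int] w1 by (auto simp: gbq_integral_def vform_Q_iff vform_P_iff G1_eq)
    have m: "vge v m11 0" "vge v m12 0" "vge v m22 0" using M by (auto simp: unimod_def)
    \<comment> \<open>Modulo \<pi> the coefficient e of \<open>F3\<close> is - t2^2, because m21, n
      and e vanish.\<close>
    have "vge v (- (t2^2)) 1"
    proof (rule vge_cancel_left)
      let ?x = "(m21^4 * a + m21^3 * m22 * b + m21^2 * m22^2 * c + m21 * m22^3 * d + m22^4 * e)
        - (m21^2 * l + m21 * m22 * m + m22^2 * n) * t2"
      show "vge v (?x + - (t2^2)) 1"
        using e3 unfolding F3_eq' G1_eq by (simp add: y_shift_def lin_sub_def algebra_simps)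
      show "vge v ?x 1"
        by (rule vge_mono) ((rule m21 m i t' vge_lower_bound)+, simp)
    qed
    then have t2: "vge v t2 1" using vge_power2D[of t2 1] vge_minus by fastforce
    show ?thesis unfolding F' F3_eq' by (rule int_equiv_contract[OF M m21 t'(1,2) t2])
  qed
  obtain l m n a b c d e where G_eq: "G = GBQ l m n a b c d e" by (cases G)
  have i: "vge v l 0" "vge v m 1" "vge v n 2" "vge v a 0" "vge v b 0" "vge v c 2" "vge v d 3" "vge v e 4"
    using int w by (auto simp: gbq_integral_def vform_Q_iff vform_P_iff G_eq)
  have ne: "vge v (cn G) 1" "vge v (ce G) 1" using w by (auto elim: vge_mono)
  consider "\<not> vform_ge v (Pcoeffs F) 1" | "vform_ge v (Pcoeffs F) 1" "\<not> vPQ_ge v F 1"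
    | "vform_ge v (Pcoeffs F) 1" "vPQ_ge v F 1" by blast
  then show thesis
  proof cases
    case 1
    have l: "\<not> vge v l 1" using 1 P ne i by (auto simp: vform_P_iff G_eq)
    have "int_equiv (contract G) F'"
    proof (rule key[OF int_equiv_refl ne])
      fix m11 m12 m21 m22 r0 r1 r2
      assume M: "unimod m11 m12 m21 m22" and r: "vge v r0 0" "vge v r1 0" "vge v r2 0"
        and F2_eq: "F2 = y_shift (lin_sub G m11 m12 m21 m22) r0 r1 r2"
      have mi: "vge v m21 0" "vge v m22 0" using M by (auto simp: unimod_def)
      \<comment> \<open>Modulo \<pi> the coefficient n of \<open>F2\<close> is l m21^2, with l a
        unit.\<close>
      have "vge v (l * m21^2) 1"
      proof (rule vge_cancel_left)
        show "vge v ((m21 * m22 * m + m22^2 * n + 2 * r2) + l * m21^2) 1"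
          using c1[OF 1] by (simp add: F2_eq G_eq lin_sub_def y_shift_def algebra_simps)
        show "vge v (m21 * m22 * m + m22^2 * n + 2 * r2) 1"
          by (rule vge_mono) ((rule mi i vge_2 r vge_lower_bound)+, simp)
      qed
      then show "vge v m21 1" using vge_mult_unitD[OF _ l] vge_power2D[of m21 1] by simp
    qed
    then show thesis using that[of G] int w by simp
  next
    case 2
    have "vge v d 1" using i(7) by (rule vge_mono) simp
    then have b: "\<not> vge v b 1"
      using vPQ_ge_1I[OF int] 2 P vPQ by (auto simp: G_eq)
    have "int_equiv (contract G) F'"
    proof (rule key[OF int_equiv_refl ne])
      fix m11 m12 m21 m22 r0 r1 r2
      assume M: "unimod m11 m12 m21 m22" and r: "vge v r0 0" "vge v r1 0" "vge v r2 0"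
        and F2_eq: "F2 = y_shift (lin_sub G m11 m12 m21 m22) r0 r1 r2"
      have mi: "vge v m11 0" "vge v m12 0" "vge v m21 0" "vge v m22 0" using M by (auto simp: unimod_def)
      obtain l' m' n' a' b' c' d' e' where G': "lin_sub G m11 m12 m21 m22 = GBQ l' m' n' a' b' c' d' e'"
        by (cases "lin_sub G m11 m12 m21 m22")
      have p: "vge v m' 1" "vge v n' 1"
        using lin_sub_vform_P[OF M, of G 1] 2 P by (auto simp: G' vform_P_iff)
      have d2: "vge v (d' - 2 * r1 * r2 - m' * r2 - n' * r1) 1"
        using c2[OF 2] by (simp add: F2_eq G' y_shift_def)
      have "vge v (d' - 2 * r1 * r2 - m' * r2 - n' * r1 + (2 * r1 * r2 + m' * r2 + n' * r1)) 1"
        by (rule vge_add[OF d2], rule vge_mono) ((rule p vge_2 r vge_lower_bound)+, simp)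
      then have d': "vge v d' 1" by simp
      \<comment> \<open>Up to even terms d' is the determinant times b m21^2 + d m22^2, where \<pi>
        divides d and b is a unit.\<close>
      have "vge v ((m11 * m22 - m12 * m21) * (m21^2 * b)) 1"
      proof (rule vge_cancel_left)
        let ?x = "2 * (2 * m11 * m21^3 * a + (m11 * m21^2 * m22 + m12 * m21^3) * b
          + m21 * m22 * (m11 * m22 + m12 * m21) * c + 2 * m12 * m21 * m22^2 * d + 2 * m12 * m22^3 * e)
          + (m11 * m22 - m12 * m21) * (m22^2 * d)"
        have "d' = ?x + (m11 * m22 - m12 * m21) * (m21^2 * b)"
        proof -
          have "d' = 4 * m11 * m21^3 * a + (3 * m11 * m21^2 * m22 + m12 * m21^3) * b
            + 2 * m21 * m22 * (m11 * m22 + m12 * m21) * c + (m11 * m22^3 + 3 * m12 * m21 * m22^2) * d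
            + 4 * m12 * m22^3 * e"
            using G' by (simp add: G_eq lin_sub_def)
          then show ?thesis by algebra
        qed
        then show "vge v (?x + (m11 * m22 - m12 * m21) * (m21^2 * b)) 1" using d' by simp
        show "vge v ?x 1"
          by (rule vge_mono) ((rule i vge_2 mi vge_lower_bound)+, simp)
      qed
      moreover have "\<not> vge v (m11 * m22 - m12 * m21) 1" using M by (simp add: unimod_def vge_def)
      ultimately have "vge v (b * m21^2) 1" using vge_mult_unitD by (metis mult.commute)
      then show "vge v m21 1" using vge_mult_unitD[OF _ b] vge_power2D[of m21 1] by simp
    qed
    then show thesis using that[of G] int w by simp
  next
    case 3
    have l: "vge v l 1" using 3 P by (auto simp: vform_P_iff G_eq)
    have b: "vge v b 1"
    proof -
      obtain s0 s1 s2 where s: "vge v s0 0" "vge v s1 0" and Q: "vform_ge v (Qcoeffs (y_shift G s0 s1 s2)) 1"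
        using 3(2) vPQ vPQ_ge_iff[of 1 G] by (auto simp: y_sub_iff)
      have "vge v (b - 2 * s0 * s1 - l * s1 - m * s0) 1"
        using Q by (simp add: vform_Q_iff G_eq y_shift_def)
      then have "vge v ((b - 2 * s0 * s1 - l * s1 - m * s0) + (2 * s0 * s1 + l * s1 + m * s0)) 1"
        by (rule vge_add) (rule vge_mono, (rule l i vge_2 s vge_lower_bound)+, simp)
      then show ?thesis by simp
    qed
    \<comment> \<open>Shifting by u x^2 makes \<pi> divide all of Q; m, n, d, e do not change and c
      keeps its bound.\<close>
    obtain u where u: "vge v u 0" "vge v (a - u^2) 1" using sqrt_mod[OF i(4)] .
    define G1 where "G1 = y_shift G u 0 0"
    obtain l1 m1 n1 a1 b1 c1 d1 e1 where G1_eq: "G1 = GBQ l1 m1 n1 a1 b1 c1 d1 e1" by (cases G1)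
    have eqs: "l1 = l + 2 * u" "m1 = m" "n1 = n" "a1 = a - u^2 - l * u" "b1 = b - m * u" "c1 = c - n * u" "d1 = d" "e1 = e"
      using G1_eq by (auto simp: G1_def G_eq y_shift_def)
    have w1: "vge v l1 1" "vge v m1 1" "vge v n1 2" "vge v a1 1" "vge v b1 1" "vge v c1 2" "vge v d1 3" "vge v e1 4"
      unfolding eqs by - ((rule vge_mono, (rule l b i vge_2 u vge_lower_bound)+, simp)+)
    have GG1: "int_equiv G G1" unfolding G1_def using u by (intro int_equiv_y_shift) auto
    have "int_equiv (contract G1) F'"
    proof (rule key[OF GG1])
      show "vge v (cn G1) 1" "vge v (ce G1) 1" using ne by (simp_all add: G1_eq G_eq eqs)
      fix m11 m12 m21 m22 r0 r1 r2
      assume M: "unimod m11 m12 m21 m22" and r: "vge v r0 0" "vge v r1 0" "vge v r2 0"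
        and F2_eq: "F2 = y_shift (lin_sub G1 m11 m12 m21 m22) r0 r1 r2"
      have mi: "vge v m11 0" "vge v m12 0" "vge v m21 0" "vge v m22 0" using M by (auto simp: unimod_def)
      obtain l' m' n' a' b' c' d' e' where G': "lin_sub G1 m11 m12 m21 m22 = GBQ l' m' n' a' b' c' d' e'"
        by (cases "lin_sub G1 m11 m12 m21 m22")
      have "vform_ge v (Pcoeffs G1) 1" "vform_ge v (Qcoeffs G1) 1"
        using w1 by (auto simp: vform_P_iff vform_Q_iff G1_eq elim: vge_mono)
      then have p: "vge v l' 1" "vge v m' 1" "vge v n' 1" and q: "vge v c' 1" "vge v e' 1"
        using lin_sub_vform_P[OF M, of G1 1] lin_sub_vform_Q[OF M, of G1 1] by (auto simp: G' vform_P_iff vform_Q_iff)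
      have q2: "vge v (c' - r1^2 - 2 * r0 * r2 - l' * r2 - m' * r1 - n' * r0) 1"
         "vge v (d' - 2 * r1 * r2 - m' * r2 - n' * r1) 2" "vge v (e' - r2^2 - n' * r2) 2"
        using c3[OF 3(2)] by (auto simp: F2_eq G' y_shift_def vform_Q_iff)
      \<comment> \<open>Both \<open>G1\<close> and \<open>F2\<close> have Q divisible by \<pi>,
        which forces \<pi> to divide r2 and r1; the bounds modulo \<pi>^2 on d and e then pass to
        the unshifted form.\<close>
      have "vge v (e' - n' * r2 - (e' - r2^2 - n' * r2)) 1"
        by (rule vge_mono) ((rule p q q2 r vge_lower_bound)+, simp)
      then have r2: "vge v r2 1" using vge_power2D[of r2 1] by simp
      have "vge v (c' - 2 * r0 * r2 - l' * r2 - m' * r1 - n' * r0 - (c' - r1^2 - 2 * r0 * r2 - l' * r2 - m' * r1 - n' * r0)) 1"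
        by (rule vge_mono) ((rule p q q2 r2 r vge_2 vge_lower_bound)+, simp)
      then have r1: "vge v r1 1" using vge_power2D[of r1 1] by simp
      have "vge v ((d' - 2 * r1 * r2 - m' * r2 - n' * r1) + (2 * r1 * r2 + m' * r2 + n' * r1)) 2"
        by (rule vge_add[OF q2(2)], rule vge_mono) ((rule p r1 r2 vge_2 vge_lower_bound)+, simp)
      then have d': "vge v d' 2" by simp
      have "vge v ((e' - r2^2 - n' * r2) + (r2^2 + n' * r2)) 2"
        by (rule vge_add[OF q2(3)], rule vge_mono) ((rule p r2 vge_2 vge_lower_bound)+, simp)
      then have e': "vge v e' 2" by simp
      have "vge v ((m11 * m22 - m12 * m21) * (m21^2 * b1)) 2"
      proof (rule vge_cancel_left)
        let ?x = "2 * (2 * m11 * m21^3 * a1 + (m11 * m21^2 * m22 + m12 * m21^3) * b1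
          + m21 * m22 * (m11 * m22 + m12 * m21) * c1 + 2 * m12 * m21 * m22^2 * d1 + 2 * m12 * m22^3 * e1)
          + (m11 * m22 - m12 * m21) * (m22^2 * d1)"
        have "d' = ?x + (m11 * m22 - m12 * m21) * (m21^2 * b1)"
        proof -
          have "d' = 4 * m11 * m21^3 * a1 + (3 * m11 * m21^2 * m22 + m12 * m21^3) * b1
            + 2 * m21 * m22 * (m11 * m22 + m12 * m21) * c1 + (m11 * m22^3 + 3 * m12 * m21 * m22^2) * d1
            + 4 * m12 * m22^3 * e1"
            using G' by (simp add: G1_eq lin_sub_def)
          then show ?thesis by algebra
        qed
        then show "vge v (?x + (m11 * m22 - m12 * m21) * (m21^2 * b1)) 2" using d' by simp
        show "vge v ?x 2"
          by (rule vge_mono) ((rule w1 vge_2 mi vge_lower_bound)+, simp)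
      qed
      moreover have "\<not> vge v (m11 * m22 - m12 * m21) 1" using M by (simp add: unimod_def vge_def)
      ultimately have b2: "vge v (m21^2 * b1) 2" using vge_mult_unitD by blast
      have a2: "vge v (m21^4 * a1) 2"
      proof (rule vge_cancel_left)
        let ?x = "m21 * m22 * (m21^2 * b1) + m21^2 * m22^2 * c1 + m21 * m22^3 * d1 + m22^4 * e1"
        have "e' = ?x + m21^4 * a1"
          using G' by (simp add: G1_eq lin_sub_def algebra_simps power2_eq_square power3_eq_cube)
        then show "vge v (?x + m21^4 * a1) 2" using e' by simp
        show "vge v ?x 2"
          by (rule vge_mono) ((rule b2 w1 mi vge_lower_bound)+, simp)
      qed
      \<comment> \<open>For a unit m21 the last two bounds make \<pi>^2 divide a1 and b1, hence Q,
        against v(P,Q) < 2.\<close>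
      show "vge v m21 1"
      proof (rule ccontr)
        assume m21: "\<not> vge v m21 1"
        then have m2: "\<not> vge v (m21^2) 1" using vge_power2D[of m21 1] by auto
        then have m4: "\<not> vge v (m21^4) 1" using vge_power2D[of "m21^2" 1] by auto
        have "vform_ge v (Qcoeffs G1) 2"
          using vge_mult_unitD[OF a2 m4] vge_mult_unitD[OF b2 m2] w1
          by (auto simp: vform_Q_iff G1_eq elim: vge_mono)
        then have "vPQ_ge v G1 2"
          using \<open>vform_ge v (Pcoeffs G1) 1\<close> vPQ_ge_iff[of 2 G1] y_sub_iff by (metis insertCI vge_0 y_shift_0)
        then show False
          using n2 vPQ_ge_int_equivD[of F G1 2] GG1 GF int_equiv_sym int_equiv_trans by blast
      qed
    qed
    then show thesis
      using that[of G1] int_equiv_integral[OF GG1 int] w1 by (simp add: G1_eq G_eq eqs)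
  qed
qed

text \<open>The contraction adds 1, 0, -1 to the valuations of l, m, n and 2, 1, 0, -1, -2 to those
  of a, ..., e. Lower bounds 0, 1, 2 and 0, 1, 2, 3, 4 become 1, 1, 1 and 2, 2, 2, 2, 2.\<close>

lemma weight_one_step:
  assumes "weight_one G" "int_equiv G F" "\<not> vPQ_ge v F 2" "proc_step v \<pi> red F F'"
  shows "vPQ_ge v F' 2"
proof -
  obtain G1 where G1: "int_equiv (contract G1) F'" "gbq_integral v G1" "cm G1 = cm G" "cn G1 = cn G"
      "cd G1 = cd G" "ce G1 = ce G" "vge v (cc G1) 2" "vge v (cb G1) 1"
    using proc_step_contract[OF _ _ _ _ _ _ assms(2-4)] assms(1) by (metis weight_one_def)
  have "vform_ge v (Pcoeffs (contract G1)) 1 \<and> vform_ge v (Qcoeffs (contract G1)) 2"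
    using G1(2-8) assms(1) \<pi>_nz v_\<pi>
    by (cases G1) (auto simp: contract_GBQ weight_one_def gbq_integral_def vform_P_iff vform_Q_iff
        vge_mult_iff vge_divide_iff v_power elim: vge_mono)
  then have "vPQ_ge v (contract G1) 2"
    using vPQ_ge_iff[of 2 "contract G1"] y_sub_iff by (metis insertCI vge_0 y_shift_0)
  then show ?thesis using vPQ_ge_int_equivD[OF int_equiv_sym[OF G1(1)]] by simp
qed

text \<open>By the same count, lower bounds 0, 1, 3 and 0, 0, 2, 4, 6 become 1, 1, 2 and 2, 1, 2, 3,
  4, which imply the first system.\<close>

lemma weight_two_step:
  assumes "weight_two G" "int_equiv G F" "\<not> vPQ_ge v F 2" "proc_step v \<pi> red F F'"
  obtains G' where "weight_one G'" "int_equiv G' F'"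
proof -
  have w: "gbq_integral v G" "vge v (cm G) 1" "vge v (cn G) 2" "vge v (cc G) 2" "vge v (cd G) 3" "vge v (ce G) 4"
    using assms(1) by (auto simp: weight_two_def elim: vge_mono)
  obtain G1 where G1: "int_equiv (contract G1) F'" "gbq_integral v G1" "cm G1 = cm G" "cn G1 = cn G"
      "cd G1 = cd G" "ce G1 = ce G" "vge v (cc G1) 2"
    using proc_step_contract[OF w assms(2-4)] by metis
  have "weight_one (contract G1)"
    using G1(2-7) assms(1) \<pi>_nz v_\<pi>
    by (cases G1) (auto simp: contract_GBQ weight_one_def weight_two_def gbq_integral_def vform_P_iff vform_Q_iff
        vge_mult_iff vge_divide_iff v_power elim: vge_mono)
  then show thesis using that G1(1) by blast
qed

lemma two_steps:
  assumes "non_minimal v F" "gbq_integral v F" "gbq_disc F \<noteq> 0" "\<not> vPQ_ge v F 2" "proc_step v \<pi> red F F'"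
  shows "vPQ_ge v F' 2 \<or> (\<forall>F''. proc_step v \<pi> red F' F'' \<longrightarrow> vPQ_ge v F'' 2)"
proof -
  obtain G where G: "int_equiv G F" "weight_one G \<or> weight_two G"
    using non_minimal_weights[OF assms(1-4)] int_equiv_sym by blast
  from G(2) show ?thesis
  proof
    assume "weight_one G"
    then show ?thesis using weight_one_step[OF _ G(1) assms(4,5)] by blast
  next
    assume "weight_two G"
    then obtain G' where "weight_one G'" "int_equiv G' F'"
      using weight_two_step[OF _ G(1) assms(4,5)] by blast
    then show ?thesis using weight_one_step by blast
  qed
qed

end

theorem theorem4p13:
  fixes v :: "'a::field \<Rightarrow> int" and \<pi> :: 'a and F :: "'a gbq"
    and red :: "'a \<Rightarrow> 'b::alg_closed_field"
  assumes val: "discrete_valuation v"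
    and unif: "\<pi> \<noteq> 0" "v \<pi> = 1"
    and perfect: "residue_perfect v"
    and char2: "residue_char v 2"
    and resmap: "residue_map v red"
    and integral: "gbq_integral v F"
    and nonsing: "gbq_disc F \<noteq> 0"
    and vPQ01: "\<not> vPQ_ge v F 2"
    and poslevel: "\<exists>lev > 0. has_level v F lev"
  shows
    "(\<not> vform_ge v (Pcoeffs F) 1 \<longrightarrow> unique_rep_root_over_k v red (Pcoeffs F)) \<and>
     (vform_ge v (Pcoeffs F) 1 \<and> \<not> vPQ_ge v F 1 \<longrightarrow>
        unique_rep_root_over_k v red [3 * cb F, 4 * cc F, 3 * cd F]) \<and>
     (vform_ge v (Pcoeffs F) 1 \<and> vform_ge v (Qcoeffs F) 1 \<and> \<not> vform_ge v (Qcoeffs F) 2 \<longrightarrow>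
        unique_rep_root_over_k v red (map (\<lambda>c. c / \<pi>) (Qcoeffs F)))
     \<and>
     ((\<exists>F'. proc_step v \<pi> red F F') \<and>
      (\<forall>F'. proc_step v \<pi> red F F' \<longrightarrow>
         gbq_integral v F' \<and> K_equiv F F' \<and> (\<exists>lev. has_level v F lev \<and> has_level v F' lev)))
     \<and>
     (non_minimal v F \<longrightarrow>
        (\<forall>F'. proc_step v \<pi> red F F' \<longrightarrow>
           vPQ_ge v F' 2 \<or> (\<forall>F''. proc_step v \<pi> red F' F'' \<longrightarrow> vPQ_ge v F'' 2)))"
proof -
  interpret dyadic_field v \<pi> red
    using val unif perfect char2 resmap by unfold_locales (auto simp: residue_char_def)
  obtain lev where lev: "has_level v F lev" "lev > 0" using poslevel by blast
  have cusp: "cuspidal v (jac F)" using cuspidal_jac[OF lev integral nonsing] .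
  note root = Q1_unique_rep_root[OF integral cusp vPQ01]
  have vPQ1: "vPQ_ge v F 1" if "vform_ge v (Pcoeffs F) 1" "vform_ge v (Qcoeffs F) 1"
    using that vPQ_ge_iff[of 1 F] y_sub_iff by (metis insertCI vge_0 y_shift_0)
  have "unique_rep_root_over_k v red (Pcoeffs F)" if "\<not> vform_ge v (Pcoeffs F) 1"
    \<comment> \<open>When \<pi> does not divide P, \<open>vPQ_ge v F 1\<close> fails and the
      premise of \<open>root\<close> about Q is vacuous.\<close>
    using root that vPQ_ge_1_P by (auto simp: Q1_def)
  moreover have "unique_rep_root_over_k v red [3 * cb F, 4 * cc F, 3 * cd F]"
    if "vform_ge v (Pcoeffs F) 1" "\<not> vPQ_ge v F 1"
    using root that by (simp add: Q1_def)
  moreover have "unique_rep_root_over_k v red (map (\<lambda>c. c / \<pi>) (Qcoeffs F))"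
    if "vform_ge v (Pcoeffs F) 1" "vform_ge v (Qcoeffs F) 1"
    using root that vPQ1 by (simp add: Q1_def)
  ultimately show ?thesis
    using proc_step_exists[OF integral vPQ01 nonsing lev] proc_step_integral[OF _ integral vPQ01 nonsing lev] lev(1)
      two_steps[OF _ integral nonsing vPQ01] by blast
qed

end
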